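(* Let $\rho>0$. The first Bloch eigenvalue $\lambda_1^\rho$ and eigenfunction $\phi_1^\rho$ satisfy: 1. $\lambda_1^\rho(0)=0$. 2. $\lambda_1^\rho(\eta)$ has a critical point at $\eta=0$, i.e. $\frac{\partial\lambda_1^\rho}{\partial\eta_l}(0)=0$ for all $l=1,\dots,d$. 3. For $l=1,\dots,d$, the function $y\mapsto\frac{\partial\phi_1^\rho}{\partial\eta_l}(y;0)-i\,\phi_1^\rho(y;0)\,\chi_l^\rho(y)$ is constant in $y$, where $\chi^\rho_l$ is the solution of the cell problem (defined in the context). 4. The Hessian of $\lambda_1^\rho$ at $\eta=0$ is twice the homogenized matrix $A^{\rho,\mathrm{hom}}$, i.e. for all $k,l=1,\dots,d$, $$\frac12\frac{\partial^2\lambda_1^\rho}{\partial\eta_k\partial\eta_l}(0)=e_k\cdot A^{\rho,\mathrm{hom}}e_l .$$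
   Context: $Y=[0,2\pi)^d$, $Y'=[-\frac12,\frac12)^d$. $A(y)$ is a $d\times d$ matrix with real, bounded, measurable entries on $\mathbb{R}^d$ that is symmetric, $Y$-periodic ($A(y+2\pi p)=A(y)$ for all $p\in\mathbb{Z}^d$, a.e. $y$), and elliptic: there is $\alpha>0$ with $A(y)\xi\cdot\xi\ge\alpha|\xi|^2$ for all $\xi\in\mathbb{R}^d$, a.e. $y$. $H^s_\sharp(Y)$ is the Sobolev space of $Y$-periodic functions, identified with $H^s$ of the torus $\mathbb{R}^d/2\pi\mathbb{Z}^d$; $\mathcal{M}_Y(u)=\frac1{|Y|}\int_Yu\,dy$; $e_j$ is the $j$-th standard unit vector. For $\eta\in Y'$ let $\mathcal{A}^\rho(\eta)=\rho^2(\nabla+i\eta)^4-(\nabla+i\eta)\cdot A(y)(\nabla+i\eta)$, acting on $Y$-periodic functions and associated with the form $a^\rho[\eta](u,v)=\int_Y A(\nabla+i\eta)u\cdot\overline{(\nabla+i\eta)v}\,dy+\rho^2\int_Y(\nabla+i\eta)^2u\,\overline{(\nabla+i\eta)^2v}\,dy$ on $H^2_\sharp(Y)$, where $(\nabla+i\eta)^2u=\Delta u+2i\eta\cdot\nabla u-|\eta|^2u$. $\lambda_1^\rho(\eta)$ is its lowest eigenvalue in $L^2_\sharp(Y)$ and $\phi_1^\rho(\cdot;\eta)$ a corresponding eigenfunction. In a neighbourhood of $\eta=0$, $\lambda_1^\rho$ is analytic and $\phi_1^\rho(\cdot;\eta)$ is chosen analytic in $\eta$ with values in $H^2_\sharp(Y)$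 and normalized by $\mathcal{M}_Y(\phi_1^\rho(\cdot;\eta))=(2\pi)^{-d/2}$. Cell problem: for $1\le j\le d$, $\chi_j^\rho\in H^2_\sharp(Y)$ is the unique $Y$-periodic solution of $\rho^2\Delta^2\chi_j^\rho-\operatorname{div}A(y)(e_j+\nabla\chi_j^\rho)=0$ in $\mathbb{R}^d$ with $\mathcal{M}_Y(\chi_j^\rho)=0$. The homogenized matrix is $A^{\rho,\mathrm{hom}}=\mathcal{M}_Y(A+A\nabla\chi^\rho)$, i.e. $e_k\cdot A^{\rho,\mathrm{hom}}e_l=\mathcal{M}_Y(e_k\cdot Ae_l+e_k\cdot A\nabla\chi_l^\rho)$. *)

theory Defs
  imports "HOL-Analysis.Analysis"
begin

text \<open>
  Functions on the torus \<open>\<real>\<^sup>d / 2\<pi>\<int>\<^sup>d\<close> are represented by periodic functions on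
  \<^typ>\<open>real^'n\<close>, where \<open>d = CARD('n)\<close>. Elements of \<open>L\<^sup>2\<close> and of the Sobolev spaces are
  represented by functions rather than by classes, so equality of such elements is equality
  almost everywhere.
\<close>

definition period_cell :: "(real^'n) set" where
  "period_cell = {y. \<forall>i. 0 \<le> y $ i \<and> y $ i < 2 * pi}"

definition int_vectors :: "(real^'n) set" where
  "int_vectors = {p. \<forall>i. p $ i \<in> \<int>}"

definition periodic :: "(real^'n \<Rightarrow> 'a) \<Rightarrow> bool" where
  "periodic f \<longleftrightarrow> (\<forall>p\<in>int_vectors. \<forall>y. f (y + (2 * pi) *\<^sub>R p) = f y)"

definition ae_periodic :: "(real^'n \<Rightarrow> 'a) \<Rightarrow> bool" where
  "ae_periodic f \<longleftrightarrow>
     (\<forall>p\<in>int_vectors. AE y in lebesgue. f (y + (2 * pi) *\<^sub>R p) = f y)"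

definition cell_mean :: "(real^'n \<Rightarrow> complex) \<Rightarrow> complex" where
  "cell_mean u =
     (LINT y:period_cell|lebesgue. u y) / complex_of_real (measure lebesgue (period_cell :: (real^'n) set))"


subsection \<open>Classical partial derivatives and test functions\<close>

definition partial_deriv ::
  "'n::finite \<Rightarrow> (real^'n \<Rightarrow> 'a::real_normed_vector) \<Rightarrow> real^'n \<Rightarrow> 'a" where
  "partial_deriv j f x = vector_derivative (\<lambda>t. f (x + t *\<^sub>R axis j 1)) (at 0)"

primrec iter_partial_deriv ::
  "'n::finite list \<Rightarrow> (real^'n \<Rightarrow> 'a::real_normed_vector) \<Rightarrow> real^'n \<Rightarrow> 'a" where
  "iter_partial_deriv [] f = f"
| "iter_partial_deriv (j # js) f = partial_deriv j (iter_partial_deriv js f)"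

text \<open>
  A function is \<open>C\<^sup>\<infinity>\<close> iff all its iterated partial derivatives exist and are Frechet
  differentiable everywhere (hence continuous).
\<close>

definition smooth :: "(real^'n \<Rightarrow> 'a::real_normed_vector) \<Rightarrow> bool" where
  "smooth f \<longleftrightarrow> (\<forall>js. iter_partial_deriv js f differentiable_on UNIV)"


subsection \<open>Periodic Sobolev spaces\<close>

definition L2_per :: "(real^'n \<Rightarrow> complex) set" where
  "L2_per = {u. u \<in> borel_measurable lebesgue \<and> ae_periodic u \<and>
                set_integrable lebesgue period_cell (\<lambda>y. (cmod (u y))\<^sup>2)}"

definition is_weak_partial ::
  "'n::finite \<Rightarrow> (real^'n \<Rightarrow> complex) \<Rightarrow> (real^'n \<Rightarrow> complex) \<Rightarrow> bool" where
  "is_weak_partial j u g \<longleftrightarrow> u \<in> L2_per \<and> g \<in> L2_per \<and>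
     (\<forall>f. smooth f \<and> periodic f \<longrightarrow>
        (LINT y:period_cell|lebesgue. g y * f y)
          = - (LINT y:period_cell|lebesgue. u y * partial_deriv j f y))"

text \<open>The choice below is unique up to null sets whenever a weak derivative exists.\<close>

definition weak_partial :: "'n::finite \<Rightarrow> (real^'n \<Rightarrow> complex) \<Rightarrow> real^'n \<Rightarrow> complex" where
  "weak_partial j u = (SOME g. is_weak_partial j u g)"

definition H1_per :: "(real^'n \<Rightarrow> complex) set" where
  "H1_per = {u \<in> L2_per. \<forall>j. \<exists>g. is_weak_partial j u g}"

definition H2_per :: "(real^'n \<Rightarrow> complex) set" where
  "H2_per = {u \<in> H1_per. \<forall>j. weak_partial j u \<in> H1_per}"

definition H2_norm :: "(real^'n \<Rightarrow> complex) \<Rightarrow> real" where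
  "H2_norm u = sqrt (
     (LINT y:period_cell|lebesgue. (cmod (u y))\<^sup>2)
     + (\<Sum>j\<in>UNIV. LINT y:period_cell|lebesgue. (cmod (weak_partial j u y))\<^sup>2)
     + (\<Sum>j\<in>UNIV. \<Sum>k\<in>UNIV.
          LINT y:period_cell|lebesgue. (cmod (weak_partial j (weak_partial k u) y))\<^sup>2))"

definition weak_grad :: "(real^'n \<Rightarrow> complex) \<Rightarrow> real^'n \<Rightarrow> complex^'n" where
  "weak_grad u y = (\<chi> j. weak_partial j u y)"

definition weak_laplacian :: "(real^'n \<Rightarrow> complex) \<Rightarrow> real^'n \<Rightarrow> complex" where
  "weak_laplacian u y = (\<Sum>j\<in>UNIV. weak_partial j (weak_partial j u) y)"


subsection \<open>Functions of a parameter with values in \<open>H\<^sup>2\<close>\<close>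

text \<open>
  Real analyticity of an \<open>H\<^sup>2\<close>-valued map of \<open>d\<close> real variables: near the base point the map is
  the \<open>H\<^sup>2\<close>-limit of an absolutely convergent power series, indexed by multi-indices
  \<open>\<alpha> : 'n \<Rightarrow> nat\<close>.
\<close>

definition H2_analytic_at :: "(real^'n \<Rightarrow> real^'n \<Rightarrow> complex) \<Rightarrow> real^'n \<Rightarrow> bool" where
  "H2_analytic_at \<Phi> \<eta>\<^sub>0 \<longleftrightarrow>
     (\<exists>r>0. \<exists>c :: ('n \<Rightarrow> nat) \<Rightarrow> real^'n \<Rightarrow> complex.
        (\<forall>\<alpha>. c \<alpha> \<in> H2_per) \<and>
        (\<lambda>\<alpha>. H2_norm (c \<alpha>) * r ^ (\<Sum>i\<in>UNIV. \<alpha> i)) summable_on UNIV \<and>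
        (\<forall>\<eta>. (\<forall>i. \<bar>\<eta> $ i - \<eta>\<^sub>0 $ i\<bar> < r) \<longrightarrow>
           \<Phi> \<eta> \<in> H2_per \<and>
           ((\<lambda>F. H2_norm (\<lambda>y. \<Phi> \<eta> y -
                   (\<Sum>\<alpha>\<in>F. complex_of_real (\<Prod>i\<in>UNIV. (\<eta> $ i - \<eta>\<^sub>0 $ i) ^ \<alpha> i) * c \<alpha> y)))
              \<longlongrightarrow> 0) (finite_subsets_at_top UNIV)))"

definition has_H2_partial ::
  "'n::finite \<Rightarrow> (real^'n \<Rightarrow> real^'n \<Rightarrow> complex) \<Rightarrow> real^'n \<Rightarrow> (real^'n \<Rightarrow> complex) \<Rightarrow> bool" where
  "has_H2_partial l \<Phi> \<eta> D \<longleftrightarrow> D \<in> H2_per \<and>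
     ((\<lambda>t::real. H2_norm (\<lambda>y. (\<Phi> (\<eta> + t *\<^sub>R axis l 1) y - \<Phi> \<eta> y) / complex_of_real t - D y))
        \<longlongrightarrow> 0) (at 0)"


subsection \<open>The shifted operator and its lowest eigenvalue\<close>

definition complex_matrix :: "real^'n^'m \<Rightarrow> complex^'n^'m" where
  "complex_matrix M = (\<chi> k l. complex_of_real (M $ k $ l))"

definition cdot :: "complex^'n \<Rightarrow> complex^'n \<Rightarrow> complex" where
  "cdot z w = (\<Sum>k\<in>UNIV. z $ k * cnj (w $ k))"

text \<open>\<open>(\<nabla> + i\<eta>)u\<close> and \<open>(\<nabla> + i\<eta>)\<^sup>2u = \<Delta>u + 2i\<eta>\<cdot>\<nabla>u - |\<eta>|\<^sup>2u\<close>.\<close>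

definition shifted_grad :: "real^'n \<Rightarrow> (real^'n \<Rightarrow> complex) \<Rightarrow> real^'n \<Rightarrow> complex^'n" where
  "shifted_grad \<eta> u y = (\<chi> j. weak_partial j u y + \<i> * complex_of_real (\<eta> $ j) * u y)"

definition shifted_laplacian :: "real^'n \<Rightarrow> (real^'n \<Rightarrow> complex) \<Rightarrow> real^'n \<Rightarrow> complex" where
  "shifted_laplacian \<eta> u y =
     weak_laplacian u y
     + 2 * \<i> * (\<Sum>j\<in>UNIV. complex_of_real (\<eta> $ j) * weak_partial j u y)
     - complex_of_real ((norm \<eta>)\<^sup>2) * u y"

definition bloch_form ::
  "(real^'n \<Rightarrow> real^'n^'n) \<Rightarrow> real \<Rightarrow> real^'n
     \<Rightarrow> (real^'n \<Rightarrow> complex) \<Rightarrow> (real^'n \<Rightarrow> complex) \<Rightarrow> complex" where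
  "bloch_form A \<rho> \<eta> u v =
     (LINT y:period_cell|lebesgue.
        cdot (complex_matrix (A y) *v shifted_grad \<eta> u y) (shifted_grad \<eta> v y))
     + complex_of_real (\<rho>\<^sup>2) *
       (LINT y:period_cell|lebesgue. shifted_laplacian \<eta> u y * cnj (shifted_laplacian \<eta> v y))"

text \<open>
  Eigenfunctions of the operator associated with the form. The form is Hermitian when \<open>A\<close> is real
  and symmetric, so only real eigenvalues need to be considered.
\<close>

definition bloch_eigenfunction ::
  "(real^'n \<Rightarrow> real^'n^'n) \<Rightarrow> real \<Rightarrow> real^'n \<Rightarrow> real \<Rightarrow> (real^'n \<Rightarrow> complex) \<Rightarrow> bool" where
  "bloch_eigenfunction A \<rho> \<eta> \<mu> u \<longleftrightarrow>
     u \<in> H2_per \<and> \<not> (AE y in lebesgue. u y = 0) \<and>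
     (\<forall>v\<in>H2_per. bloch_form A \<rho> \<eta> u v
        = complex_of_real \<mu> * (LINT y:period_cell|lebesgue. u y * cnj (v y)))"

definition bloch_eigenvalue1 ::
  "(real^'n \<Rightarrow> real^'n^'n) \<Rightarrow> real \<Rightarrow> real^'n \<Rightarrow> real" where
  "bloch_eigenvalue1 A \<rho> \<eta> = (LEAST \<mu>. \<exists>u. bloch_eigenfunction A \<rho> \<eta> \<mu> u)"


subsection \<open>The cell problem and the homogenized matrix\<close>

text \<open>
  Weak form of \<open>\<rho>\<^sup>2\<Delta>\<^sup>2c - div A(e\<^sub>j + \<nabla>c) = 0\<close>. Complex-valued \<open>c\<close> are admitted; since
  \<open>A\<close> is real, uniqueness forces the solution to be real almost everywhere.
\<close>

definition cell_solution ::
  "(real^'n \<Rightarrow> real^'n^'n) \<Rightarrow> real \<Rightarrow> 'n \<Rightarrow> (real^'n \<Rightarrow> complex) \<Rightarrow> bool" where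
  "cell_solution A \<rho> j c \<longleftrightarrow>
     c \<in> H2_per \<and> cell_mean c = 0 \<and>
     (\<forall>v\<in>H2_per.
        complex_of_real (\<rho>\<^sup>2) *
          (LINT y:period_cell|lebesgue. weak_laplacian c y * cnj (weak_laplacian v y))
        + (LINT y:period_cell|lebesgue.
             cdot (complex_matrix (A y) *v (axis j 1 + weak_grad c y)) (weak_grad v y))
        = 0)"

definition hom_matrix ::
  "(real^'n \<Rightarrow> real^'n^'n) \<Rightarrow> ('n \<Rightarrow> real^'n \<Rightarrow> complex) \<Rightarrow> complex^'n^'n" where
  "hom_matrix A c = (\<chi> k l. cell_mean (\<lambda>y.
     (complex_matrix (A y) *v axis l 1) $ k + (complex_matrix (A y) *v weak_grad (c l) y) $ k))"

end

theory Submission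
  imports Defs
begin

text \<open>
  The first eigenvalue can be read off from one test function. In the eigenvalue equation
  \<open>a[\<eta>](\<phi>(\<eta>), v) = \<lambda>(\<eta>) \<langle>\<phi>(\<eta>), v\<rangle>\<close> take \<open>v = 1\<close>. Since \<open>(\<nabla> + i\<eta>)1 = i\<eta>\<close> and derivatives of periodic
  functions have mean zero, this gives
  \<open>\<kappa>|Y| \<lambda>(\<eta>) = \<Sum>\<^sub>k \<eta>\<^sub>k (-i G\<^sub>k(\<eta>)) + \<rho>\<^sup>2|\<eta>|\<^sup>4 \<kappa>|Y|\<close>, where \<open>\<kappa>\<close> is the prescribed mean of \<open>\<phi>(\<eta>)\<close> and
  \<open>G\<^sub>k(\<eta>) = \<integral>\<^sub>Y [A(\<nabla> + i\<eta>)\<phi>(\<eta>)]\<^sub>k\<close> (lemma \<open>bloch_form_const_right\<close>). At \<open>\<eta> = 0\<close> the lowest eigenvalue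
  is \<open>0\<close>, and ellipticity forces \<open>\<phi>(0)\<close> to be the constant \<open>\<kappa>\<close> (lemmas \<open>bloch_eigenvalue1_0\<close> and
  \<open>bloch_form_0_kernel\<close>). Hence \<open>G\<^sub>k(0) = 0\<close>: the gradient of \<open>\<lambda>\<close> vanishes at \<open>0\<close>, and the Hessian there
  needs only the first derivatives of the \<open>G\<^sub>k\<close> (lemma \<open>coordinate_sum_derivatives\<close>).

  Differentiating the eigenvalue equation once along \<open>e\<^sub>l\<close> at \<open>0\<close>, where \<open>\<lambda>\<close> and its gradient vanish,
  leaves \<open>a[0](D, v) = -i\<kappa> \<integral> Ae\<^sub>l \<sqdot> \<nabla>v\<^sup>*\<close> for \<open>D = \<partial>\<^sub>l\<phi>(0)\<close> and every \<open>v\<close>. This is \<open>i\<kappa>\<close> times the cell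
  problem, so \<open>D - i\<kappa>\<chi>\<^sub>l\<close> lies in the kernel of \<open>a[0]\<close>, which consists of constants (lemma
  \<open>corrector_derivative\<close>). Inserting \<open>D\<close> into \<open>\<partial>\<^sub>lG\<^sub>k(0)\<close> gives \<open>i\<kappa>|Y| A\<^bsup>hom\<^esup>\<^sub>k\<^sub>l\<close>, and the Hessian is
  \<open>A\<^bsup>hom\<^esup>\<close> plus its transpose. The matrix \<open>A\<^bsup>hom\<^esup>\<close> is symmetric, as testing the equation of \<open>\<chi>\<^sub>k\<close> with the
  conjugate of \<open>\<chi>\<^sub>l\<close> shows (lemma \<open>corrector_symmetric\<close>). It is real because \<open>\<lambda>\<close> is: the imaginary part
  of the formula for \<open>\<lambda>\<close> is the zero function, and its Hessian is twice the imaginary part of \<open>A\<^bsup>hom\<^esup>\<close>.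

  Two analytic facts carry these computations. Weak derivatives are unique, because a square-integrable
  function orthogonal to all exponentials \<open>exp (i m \<sqdot> y)\<close> vanishes almost everywhere (lemma
  \<open>trig_null_AE_zero\<close>); this makes the chosen weak derivatives linear up to null sets. And a bounded linear
  functional on \<open>H\<^sup>2\<close> turns the analytic family \<open>\<phi>\<close> into an absolutely convergent scalar power series, which
  is continuously differentiable (lemma \<open>H2_analytic_functional_C1\<close>). Every integral above is such a
  functional of \<open>\<phi>(\<eta>)\<close>, up to polynomial factors in \<open>\<eta>\<close>.
\<close>

section \<open>Integration over the period cell\<close>

abbreviation cell :: "(real^'n) measure" where
  "cell \<equiv> lebesgue_on period_cell"

lemma period_cell_bounds:
  "box 0 (\<chi> i. 2 * pi) \<subseteq> (period_cell :: (real^'n) set)"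
  "(period_cell :: (real^'n) set) \<subseteq> cbox 0 (\<chi> i. 2 * pi)"
  by (auto simp: period_cell_def mem_box_cart less_imp_le simp del: mult.commute)

lemma borel_period_cell [measurable]: "(period_cell :: (real^'n) set) \<in> sets borel"
proof -
  have "(period_cell :: (real^'n) set) = (\<Inter>i. {y. 0 \<le> y $ i} \<inter> {y. y $ i < 2 * pi})"
    by (auto simp: period_cell_def)
  also have "\<dots> \<in> sets borel"
    by (intro sets.countable_INT'' ) auto
  finally show ?thesis .
qed

lemma sets_period_cell [measurable, simp]: "(period_cell :: (real^'n) set) \<in> sets lebesgue"
  using borel_period_cell by auto

lemma period_cell_lmeasurable [simp]: "(period_cell :: (real^'n) set) \<in> lmeasurable"
  by (rule bounded_set_imp_lmeasurable)
     (use bounded_subset[OF bounded_cbox period_cell_bounds(2)] in auto)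

lemma measure_period_cell_pos: "0 < measure lebesgue (period_cell :: (real^'n) set)"
proof -
  have "0 < measure lebesgue (box 0 (\<chi> i. 2 * pi) :: (real^'n) set)"
  proof -
    have "(\<chi> i. pi) \<in> (box 0 (\<chi> i. 2 * pi) :: (real^'n) set)" by (simp add: mem_box_cart)
    then have "\<not> negligible (box 0 (\<chi> i. 2 * pi) :: (real^'n) set)"
      using open_not_negligible[OF open_box] by blast
    then show ?thesis
      by (metis lmeasurable_box negligible_iff_measure zero_less_measure_iff)
  qed
  also have "\<dots> \<le> measure lebesgue (period_cell :: (real^'n) set)"
    by (rule measure_mono_fmeasurable) (use period_cell_bounds in auto)
  finally show ?thesis .
qed

lemma cell_integral_eq:
  fixes f :: "real^'n \<Rightarrow> 'b::{banach, second_countable_topology}"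
  shows "(LINT y:period_cell|lebesgue. f y) = integral\<^sup>L cell f"
  by (simp add: set_lebesgue_integral_def integral_restrict_space)

lemma cell_integrable_eq:
  fixes f :: "real^'n \<Rightarrow> 'b::{banach, second_countable_topology}"
  shows "set_integrable lebesgue period_cell f \<longleftrightarrow> integrable cell f"
  by (simp add: set_integrable_def integrable_restrict_space)

lemma finite_measure_cell [simp]: "finite_measure (cell :: (real^'n) measure)"
  by (rule finite_measure_lebesgue_on) simp

lemma measurable_cell: "f \<in> borel_measurable lebesgue \<Longrightarrow> f \<in> borel_measurable cell"
  by (rule measurable_restrict_space1)

lemma measure_cell: "measure cell (space (cell :: (real^'n) measure)) = measure lebesgue (period_cell :: (real^'n) set)"
  by (simp add: measure_restrict_space space_restrict_space)

lemma cell_mean_cell: "cell_mean u = (\<integral>y. u y \<partial>cell) / complex_of_real (measure lebesgue (period_cell :: (real^'n) set))"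
  for u :: "real^'n \<Rightarrow> complex"
  by (simp add: cell_mean_def cell_integral_eq)

lemma cell_integral_const: "integral\<^sup>L cell (\<lambda>_ :: real^'n. K) = complex_of_real (measure lebesgue (period_cell :: (real^'n) set)) * K"
  using measure_cell[where 'n='n] by (simp add: scaleR_conv_of_real)

lemma AE_lebesgue_iff_negligible: "(AE y in lebesgue. P y) \<longleftrightarrow> negligible {y. \<not> P y}"
proof
  assume "AE y in lebesgue. P y"
  then obtain N where "N \<in> null_sets lebesgue" "{y. \<not> P y} \<subseteq> N"
    by (auto simp: eventually_ae_filter)
  then show "negligible {y. \<not> P y}"
    by (metis negligible_iff_null_sets negligible_subset)
next
  assume "negligible {y. \<not> P y}"
  then show "AE y in lebesgue. P y"
    by (intro AE_I'[of "{y. \<not> P y}"]) (auto simp: negligible_iff_null_sets)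
qed

lemma AE_cell_iff: "(AE y in cell. P y) \<longleftrightarrow> (AE y in lebesgue. y \<in> period_cell \<longrightarrow> P y)"
  by (rule AE_restrict_space_iff) simp

lemma AE_cell: "AE y in lebesgue. P y \<Longrightarrow> AE y in cell. P y"
  unfolding AE_cell_iff by (erule eventually_mono) blast

definition int_vec :: "('n \<Rightarrow> int) \<Rightarrow> real^'n" where "int_vec m = (\<chi> i. of_int (m i))"

text \<open>
  The translates of the cell by periods cover the space, and there are countably many of them, so a property of
  the values of a periodic function that holds almost everywhere on the cell holds almost everywhere.
\<close>

lemma AE_cell_imp_AE:
  fixes u :: "real^'n \<Rightarrow> 'a"
  assumes per: "ae_periodic u" and ae: "AE y in cell. P (u y)"
  shows "AE y in lebesgue. P (u y)"
proof -
  have neg0: "negligible {y. y \<in> period_cell \<and> \<not> P (u y)}"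
    using ae by (simp add: AE_cell_iff AE_lebesgue_iff_negligible)
  have sh: "AE y in lebesgue. y - (2*pi) *\<^sub>R int_vec m \<in> period_cell \<longrightarrow> P (u y)" for m
  proof -
    let ?p = "(2*pi) *\<^sub>R int_vec m :: real^'n"
    have "int_vec m \<in> int_vectors" by (simp add: int_vec_def int_vectors_def)
    then have "AE y in lebesgue. u (y + ?p) = u y" using per by (auto simp: ae_periodic_def)
    then have n1: "negligible {y. u (y + ?p) \<noteq> u y}" by (simp add: AE_lebesgue_iff_negligible)
    have "negligible ((+) ?p ` ({y. u (y + ?p) \<noteq> u y} \<union> {y. y \<in> period_cell \<and> \<not> P (u y)}))"
      by (rule negligible_translation) (use n1 neg0 in auto)
    then have "negligible {y. \<not> (y - ?p \<in> period_cell \<longrightarrow> P (u y))}"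
    proof (rule negligible_subset)
      show "{y. \<not> (y - ?p \<in> period_cell \<longrightarrow> P (u y))}
        \<subseteq> (+) ?p ` ({y. u (y + ?p) \<noteq> u y} \<union> {y. y \<in> period_cell \<and> \<not> P (u y)})"
      proof
        fix y assume y: "y \<in> {y. \<not> (y - ?p \<in> period_cell \<longrightarrow> P (u y))}"
        have e: "?p + (y - ?p) = y" "(y - ?p) + ?p = y" by auto
        have "y - ?p \<in> {y. u (y + ?p) \<noteq> u y} \<union> {y. y \<in> period_cell \<and> \<not> P (u y)}"
          using y unfolding mem_Collect_eq Un_iff e by metis
        then show "y \<in> (+) ?p ` ({y. u (y + ?p) \<noteq> u y} \<union> {y. y \<in> period_cell \<and> \<not> P (u y)})"
          by (intro image_eqI[where x="y - ?p"]) simp_all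
      qed
    qed
    then show ?thesis by (simp add: AE_lebesgue_iff_negligible)
  qed
  have "AE y in lebesgue. \<forall>m. y - (2*pi) *\<^sub>R int_vec m \<in> period_cell \<longrightarrow> P (u y)"
    by (subst AE_all_countable) (use sh in blast)
  then show ?thesis
  proof (rule AE_mp, intro AE_I2 impI)
    fix y :: "real^'n"
    assume H: "\<forall>m. y - (2*pi) *\<^sub>R int_vec m \<in> period_cell \<longrightarrow> P (u y)"
    \<comment> \<open>Rounding each coordinate down to a multiple of the period moves the point into the cell.\<close>
    have "y - (2*pi) *\<^sub>R int_vec (\<lambda>i. \<lfloor>y $ i / (2*pi)\<rfloor>) \<in> period_cell"
    proof -
      have "0 \<le> y $ i - 2*pi * of_int \<lfloor>y $ i / (2*pi)\<rfloor> \<and> y $ i - 2*pi * of_int \<lfloor>y $ i / (2*pi)\<rfloor> < 2*pi" for i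
      proof -
        define q where "q = y $ i / (2*pi)"
        have y: "y $ i = 2*pi * q" by (simp add: q_def)
        have e: "2*pi * q - 2*pi * of_int \<lfloor>q\<rfloor> = 2*pi * (q - of_int \<lfloor>q\<rfloor>)" by (simp add: right_diff_distrib)
        have "0 \<le> q - of_int \<lfloor>q\<rfloor>" "q - of_int \<lfloor>q\<rfloor> < 1" by linarith+
        then have "0 \<le> 2*pi * (q - of_int \<lfloor>q\<rfloor>)" "2*pi * (q - of_int \<lfloor>q\<rfloor>) < 2*pi * 1"
          by (intro mult_nonneg_nonneg mult_strict_left_mono; simp)+
        then show ?thesis unfolding q_def[symmetric] unfolding y e by simp
      qed
      then show ?thesis by (simp add: period_cell_def int_vec_def)
    qed
    then show "P (u y)" using H by blast
  qed
qed

section \<open>Square-integrable functions on the cell\<close>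

definition cell_L2 :: "(real^'n \<Rightarrow> complex) set" where
  "cell_L2 = {u \<in> borel_measurable cell. integrable cell (\<lambda>y. (cmod (u y))\<^sup>2)}"

definition L2_norm :: "(real^'n \<Rightarrow> complex) \<Rightarrow> real" where
  "L2_norm u = sqrt (\<integral>y. (cmod (u y))\<^sup>2 \<partial>cell)"

lemma cell_L2I:
  "u \<in> borel_measurable cell \<Longrightarrow> integrable cell (\<lambda>y. (cmod (u y))\<^sup>2) \<Longrightarrow> u \<in> cell_L2"
  by (simp add: cell_L2_def)

lemma cell_L2D [simp]: 
  "u \<in> cell_L2 \<Longrightarrow> u \<in> borel_measurable cell"
  "u \<in> cell_L2 \<Longrightarrow> integrable cell (\<lambda>y. (cmod (u y))\<^sup>2)"
  by (auto simp: cell_L2_def)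

lemma L2_per_imp_cell_L2: "u \<in> L2_per \<Longrightarrow> u \<in> cell_L2"
  by (rule cell_L2I) (auto simp: L2_per_def cell_integrable_eq measurable_cell simp del: cell_L2D)

lemma cell_L2_bounded_mult:
  assumes "u \<in> cell_L2" and [measurable]: "b \<in> borel_measurable cell"
    and bd: "AE y in cell. cmod (b y) \<le> M"
  shows "(\<lambda>y. b y * u y) \<in> cell_L2"
proof -
  have [measurable]: "u \<in> borel_measurable cell" using assms by simp
  have "integrable cell (\<lambda>y. (cmod (b y * u y))\<^sup>2)"
  proof (rule Bochner_Integration.integrable_bound)
    show "integrable cell (\<lambda>y. M\<^sup>2 * (cmod (u y))\<^sup>2)" using assms by simp
    show "AE y in cell. norm ((cmod (b y * u y))\<^sup>2) \<le> norm (M\<^sup>2 * (cmod (u y))\<^sup>2)"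
      using bd by eventually_elim (auto simp: norm_mult power_mult_distrib intro!: mult_right_mono power_mono)
  qed simp
  then show ?thesis by (intro cell_L2I) measurable
qed

lemma cell_L2_cmult [intro]: "u \<in> cell_L2 \<Longrightarrow> (\<lambda>y. c * u y) \<in> cell_L2"
  by (rule cell_L2_bounded_mult[where M="cmod c"]) auto

lemma cell_L2_add [intro]:
  assumes "u \<in> cell_L2" "v \<in> cell_L2" shows "(\<lambda>y. u y + v y) \<in> cell_L2"
proof -
  have [measurable]: "u \<in> borel_measurable cell" "v \<in> borel_measurable cell" using assms by auto
  have "integrable cell (\<lambda>y. (cmod (u y + v y))\<^sup>2)"
  proof (rule Bochner_Integration.integrable_bound)
    show "integrable cell (\<lambda>y. 2 * (cmod (u y))\<^sup>2 + 2 * (cmod (v y))\<^sup>2)" using assms by simp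
    have "(cmod (u y + v y))\<^sup>2 \<le> 2 * (cmod (u y))\<^sup>2 + 2 * (cmod (v y))\<^sup>2" for y
    proof -
      have "(cmod (u y + v y))\<^sup>2 \<le> (cmod (u y) + cmod (v y))\<^sup>2"
        by (simp add: norm_triangle_ineq power_mono)
      also have "\<dots> \<le> 2 * (cmod (u y))\<^sup>2 + 2 * (cmod (v y))\<^sup>2"
        using sum_squares_bound[of "cmod (u y)" "cmod (v y)"] by (simp add: power2_sum)
      finally show ?thesis .
    qed
    then show "AE y in cell. norm ((cmod (u y + v y))\<^sup>2) \<le> norm (2 * (cmod (u y))\<^sup>2 + 2 * (cmod (v y))\<^sup>2)"
      by auto
  qed simp
  then show ?thesis by (intro cell_L2I) measurable
qed

lemma cell_L2_cnj [intro]: "u \<in> cell_L2 \<Longrightarrow> (\<lambda>y. cnj (u y)) \<in> cell_L2"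
  by (intro cell_L2I)
     (auto intro: measurable_compose[OF _ borel_measurable_continuous_onI[OF continuous_on_cnj[OF continuous_on_id]]])

lemma cell_L2_const [simp, intro]: "(\<lambda>_. c) \<in> cell_L2"
  by (intro cell_L2I) (auto simp: finite_measure.integrable_const)

lemma cell_L2_sum [intro]: "(\<And>i. i \<in> I \<Longrightarrow> f i \<in> cell_L2) \<Longrightarrow> (\<lambda>y. \<Sum>i\<in>I. f i y) \<in> cell_L2"
  by (induction I rule: infinite_finite_induct) (auto intro!: cell_L2_add)

lemma cell_L2_mult_integrable [intro]:
  assumes "u \<in> cell_L2" "v \<in> cell_L2" shows "integrable cell (\<lambda>y. u y * v y)"
proof (rule Bochner_Integration.integrable_bound)
  have [measurable]: "u \<in> borel_measurable cell" "v \<in> borel_measurable cell" using assms by auto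
  show "(\<lambda>y. u y * v y) \<in> borel_measurable cell" by simp
  show "integrable cell (\<lambda>y. (cmod (u y))\<^sup>2 + (cmod (v y))\<^sup>2)" using assms by simp
  have "cmod (u y) * cmod (v y) \<le> (cmod (u y))\<^sup>2 + (cmod (v y))\<^sup>2" for y
    using sum_squares_bound[of "cmod (u y)" "cmod (v y)"]
      mult_nonneg_nonneg[of "cmod (u y)" "cmod (v y)"] by (simp del: mult_nonneg_nonneg zero_le_mult_iff)
  then show "AE y in cell. norm (u y * v y) \<le> norm ((cmod (u y))\<^sup>2 + (cmod (v y))\<^sup>2)"
    by (simp add: norm_mult)
qed

lemma cell_L2_integrable [intro]: "u \<in> cell_L2 \<Longrightarrow> integrable cell u"
  using cell_L2_mult_integrable[of u "\<lambda>_. 1"] by simp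

lemma L2_norm_nonneg [simp]: "0 \<le> L2_norm u"
  by (simp add: L2_norm_def)

text \<open>
  The quadratic polynomial \<open>\<integral> (t|u| - |v|)\<^sup>2\<close> in \<open>t\<close> is nonnegative; its value at \<open>t = I / a\<close>, where \<open>I\<close> is the
  left-hand side and \<open>a = \<integral> |u|\<^sup>2\<close>, gives the bound. If \<open>a = 0\<close>, letting \<open>t\<close> grow forces \<open>I = 0\<close>.
\<close>

lemma Cauchy_Schwarz_cell:
  assumes "u \<in> cell_L2" "v \<in> cell_L2"
  shows "(\<integral>y. cmod (u y) * cmod (v y) \<partial>cell) \<le> L2_norm u * L2_norm v"
proof -
  have [measurable]: "u \<in> borel_measurable cell" "v \<in> borel_measurable cell" using assms by auto
  have int: "integrable cell (\<lambda>y. cmod (u y) * cmod (v y))"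
    using integrable_norm[OF cell_L2_mult_integrable[OF assms]] by (simp add: norm_mult)
  define I where "I = (\<integral>y. cmod (u y) * cmod (v y) \<partial>cell)"
  define a where "a = (\<integral>y. (cmod (u y))\<^sup>2 \<partial>cell)"
  define b where "b = (\<integral>y. (cmod (v y))\<^sup>2 \<partial>cell)"
  have nn: "0 \<le> a" "0 \<le> b" "0 \<le> I" by (auto simp: a_def b_def I_def)
  have q: "2 * t * I \<le> t\<^sup>2 * a + b" for t
  proof -
    have "0 \<le> (\<integral>y. (t * cmod (u y) - cmod (v y))\<^sup>2 \<partial>cell)" by simp
    also have "(\<lambda>y. (t * cmod (u y) - cmod (v y))\<^sup>2) = 
      (\<lambda>y. t\<^sup>2 * (cmod (u y))\<^sup>2 + (cmod (v y))\<^sup>2 - 2 * t * (cmod (u y) * cmod (v y)))"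
      by (auto simp: power2_diff power_mult_distrib algebra_simps)
    also have "integral\<^sup>L cell \<dots> = t\<^sup>2 * a + b - 2 * t * I"
      using assms int by (simp add: a_def b_def I_def)
    finally show ?thesis by simp
  qed
  have "I\<^sup>2 \<le> a * b"
  proof (cases "a = 0")
    case True
    have "I = 0"
    proof (rule ccontr)
      assume "I \<noteq> 0"
      then have "2 * ((b + 1) / (2*I)) * I = b + 1" by simp
      with q[of "(b+1)/(2*I)"] True show False by simp
    qed
    then show ?thesis using nn by simp
  next
    case False
    then have "a > 0" using nn by simp
    have "2 * (I * I) / a \<le> I\<^sup>2 / a + b"
      using q[of "I / a"] \<open>a > 0\<close> by (simp add: power2_eq_square)
    then have "I\<^sup>2 / a \<le> b" by (simp add: power2_eq_square)
    then show ?thesis using \<open>a > 0\<close> by (simp add: field_simps)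
  qed
  then have "I \<le> sqrt (a * b)" using nn by (intro real_le_rsqrt) 
  then show ?thesis by (simp add: I_def a_def b_def L2_norm_def real_sqrt_mult)
qed

lemma cell_pairing_bound:
  assumes "u \<in> cell_L2" "v \<in> cell_L2"
  shows "cmod (\<integral>y. u y * v y \<partial>cell) \<le> L2_norm v * L2_norm u"
proof -
  have "cmod (\<integral>y. u y * v y \<partial>cell) \<le> (\<integral>y. cmod (u y * v y) \<partial>cell)"
    by (rule integral_norm_bound)
  also have "\<dots> \<le> L2_norm u * L2_norm v"
    using Cauchy_Schwarz_cell[OF assms] by (simp add: norm_mult)
  finally show ?thesis by (simp add: mult.commute)
qed

lemma L2_norm_triangle:
  assumes "u \<in> cell_L2" "v \<in> cell_L2"
  shows "L2_norm (\<lambda>y. u y + v y) \<le> L2_norm u + L2_norm v"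
proof -
  have [measurable]: "u \<in> borel_measurable cell" "v \<in> borel_measurable cell" using assms by auto
  have int: "integrable cell (\<lambda>y. cmod (u y) * cmod (v y))"
    using integrable_norm[OF cell_L2_mult_integrable[OF assms]] by (simp add: norm_mult)
  have "(\<integral>y. (cmod (u y + v y))\<^sup>2 \<partial>cell)
     \<le> (\<integral>y. (cmod (u y))\<^sup>2 + (cmod (v y))\<^sup>2 + 2 * (cmod (u y) * cmod (v y)) \<partial>cell)"
  proof (rule integral_mono)
    show "integrable cell (\<lambda>y. (cmod (u y + v y))\<^sup>2)" using cell_L2_add[OF assms] by simp
    show "integrable cell (\<lambda>y. (cmod (u y))\<^sup>2 + (cmod (v y))\<^sup>2 + 2 * (cmod (u y) * cmod (v y)))"
      using assms int by simp
    show "(cmod (u y + v y))\<^sup>2 \<le> (cmod (u y))\<^sup>2 + (cmod (v y))\<^sup>2 + 2 * (cmod (u y) * cmod (v y))" for y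
      using power_mono[OF norm_triangle_ineq[of "u y" "v y"], of 2] by (simp add: power2_sum)
  qed
  also have "\<dots> = (L2_norm u)\<^sup>2 + (L2_norm v)\<^sup>2 + 2 * (\<integral>y. cmod (u y) * cmod (v y) \<partial>cell)"
    using assms int by (simp add: L2_norm_def)
  also have "\<dots> \<le> (L2_norm u + L2_norm v)\<^sup>2"
    using Cauchy_Schwarz_cell[OF assms] by (simp add: power2_sum)
  finally show ?thesis unfolding L2_norm_def[of "\<lambda>y. u y + v y"] by (intro real_le_lsqrt) auto
qed

lemma L2_norm_cmult: "L2_norm (\<lambda>y. c * u y) = cmod c * L2_norm u"
  by (simp add: L2_norm_def norm_mult power_mult_distrib real_sqrt_mult)

lemma L2_norm_cong_AE:
  assumes "AE y in cell. u y = v y" and [measurable]: "u \<in> borel_measurable cell" "v \<in> borel_measurable cell"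
  shows "L2_norm u = L2_norm v"
  unfolding L2_norm_def
  by (intro arg_cong[where f=sqrt] integral_cong_AE) (use assms(1) in auto)

lemma AE_zero_if_L2_zero:
  assumes "u \<in> cell_L2" "(\<integral>y. (cmod (u y))\<^sup>2 \<partial>cell) = 0"
  shows "AE y in cell. u y = 0"
  using integral_nonneg_eq_0_iff_AE[of cell "\<lambda>y. (cmod (u y))\<^sup>2"] assms by auto

lemma pairing_AE_zero:
  fixes f g :: "real^'n \<Rightarrow> complex"
  assumes "AE y in cell. f y = 0" "f \<in> cell_L2" "g \<in> cell_L2"
  shows "(\<integral>y. f y * g y \<partial>cell) = 0"
proof -
  have "(\<integral>y. f y * g y \<partial>cell) = integral\<^sup>L cell (\<lambda>_ :: real^'n. 0)"
  proof (rule integral_cong_AE)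
    show "(\<lambda>y. f y * g y) \<in> borel_measurable cell" using assms(2,3)[THEN cell_L2D(1)] by measurable
    show "AE y in cell. f y * g y = 0" using assms(1) by eventually_elim simp
  qed simp
  then show ?thesis by simp
qed

section \<open>Completeness of the trigonometric system\<close>

definition trig :: "('n \<Rightarrow> int) \<Rightarrow> real^'n \<Rightarrow> complex" where
  "trig m y = cis (int_vec m \<bullet> y)"

lemma trig_add:
  fixes y :: "real^'n"
  shows "trig (\<lambda>i. m i + m' i) y = trig m y * trig m' y"
proof -
  have "int_vec (\<lambda>i. m i + m' i) = int_vec m + (int_vec m' :: real^'n)"
    by (simp add: int_vec_def vec_eq_iff)
  then show ?thesis by (simp add: trig_def cis_mult inner_add_left)
qed

lemma trig_0:
  fixes y :: "real^'n"
  shows "trig (\<lambda>_. 0) y = 1"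
proof -
  have "int_vec (\<lambda>_. 0) = (0 :: real^'n)" by (simp add: int_vec_def vec_eq_iff)
  then show ?thesis by (simp add: trig_def)
qed

lemma norm_trig [simp]: "cmod (trig m y) = 1"
  by (simp add: trig_def)

lemma continuous_trig [continuous_intros]: "continuous_on S (trig m)"
  unfolding trig_def by (intro continuous_intros)

lemma borel_measurable_cell_continuous:
  fixes f :: "real^'n \<Rightarrow> 'b::topological_space"
  assumes "continuous_on UNIV f" shows "f \<in> borel_measurable cell"
  by (intro measurable_cell measurable_completion) (use borel_measurable_continuous_onI[OF assms] in simp)

lemma cell_integrable_bounded_mult:
  fixes h b :: "real^'n \<Rightarrow> complex"
  assumes h: "integrable cell h" and [measurable]: "b \<in> borel_measurable cell" and bd: "\<And>y. cmod (b y) \<le> M"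
  shows "integrable cell (\<lambda>y. h y * b y)"
proof (rule Bochner_Integration.integrable_bound)
  have [measurable]: "h \<in> borel_measurable cell" using h by auto
  show "(\<lambda>y. h y * b y) \<in> borel_measurable cell" by simp
  show "integrable cell (\<lambda>y. M * cmod (h y))" using h by simp
  have "0 \<le> M" using bd[of 0] norm_ge_zero order_trans by blast
  then show "AE y in cell. norm (h y * b y) \<le> norm (M * cmod (h y))"
    using bd by (auto simp: norm_mult mult.commute intro!: mult_right_mono)
qed

text \<open>
  Integrable functions all of whose Fourier coefficients vanish. The aim of this section is that they vanish
  almost everywhere.
\<close>

definition trig_null :: "(real^'n \<Rightarrow> complex) set" where
  "trig_null = {h. integrable cell h \<and> (\<forall>m. (\<integral>y. h y * trig m y \<partial>cell) = 0)}"

text \<open>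
  The torus is realised as a compact subset of \<open>\<complex>\<^sup>n\<close>, so that continuous functions on it can be approximated
  by the Stone-Weierstrass theorem and restrict to periodic functions of \<open>y\<close>.
\<close>

definition torus :: "(complex^'n) set" where "torus = {z. \<forall>i. cmod (z $ i) = 1}"

definition torus_map :: "real^'n \<Rightarrow> complex^'n" where "torus_map y = (\<chi> i. cis (y $ i))"

lemma torus_map_in [simp]: "torus_map y \<in> torus"
  by (simp add: torus_map_def torus_def)

lemma continuous_torus_map [continuous_intros]: "continuous_on S torus_map"
  unfolding torus_map_def by (intro continuous_intros)

lemma inj_on_torus_map: "inj_on torus_map period_cell"
proof
  fix x y :: "real^'n" assume xy: "x \<in> period_cell" "y \<in> period_cell" "torus_map x = torus_map y"
  have "x $ i = y $ i" for i
  proof -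
    have "cis (x $ i) = cis (y $ i)" using xy(3) by (simp add: torus_map_def vec_eq_iff)
    then have "sin (x $ i) = sin (y $ i) \<and> cos (x $ i) = cos (y $ i)" by (simp add: complex_eq_iff)
    then obtain n :: int where n: "x $ i = y $ i + 2 * pi * n" by (auto simp: sin_cos_eq_iff)
    have b: "0 \<le> x $ i" "x $ i < 2 * pi" "0 \<le> y $ i" "y $ i < 2 * pi" using xy by (auto simp: period_cell_def)
    then have "2 * pi * n < 2 * pi * 1" "2 * pi * (-1) < 2 * pi * n" using n by linarith+
    then have "real_of_int n < 1" "-1 < real_of_int n" 
      by (simp_all only: mult_less_cancel_left_pos[of "2 * pi"] mult_pos_pos pi_gt_zero zero_less_numeral)
    then have "n = 0" by linarith
    then show ?thesis using n by simp
  qed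
  then show "x = y" by (simp add: vec_eq_iff)
qed

lemma compact_torus: "compact (torus :: (complex^'n) set)"
proof (rule compact_eq_bounded_closed[THEN iffD2], rule conjI)
  show "bounded (torus :: (complex^'n) set)"
  proof (rule boundedI)
    fix z :: "complex^'n" assume "z \<in> torus"
    have "norm z \<le> (\<Sum>i\<in>UNIV. cmod (z $ i))" unfolding norm_vec_def by (rule L2_set_le_sum) simp
    then show "norm z \<le> real CARD('n)" using \<open>z \<in> torus\<close> by (simp add: torus_def)
  qed
  have "(torus :: (complex^'n) set) = (\<Inter>i. {z. cmod (z $ i) = 1})" by (auto simp: torus_def)
  moreover have "closed {z :: complex^'n. cmod (z $ i) = 1}" for i
    by (intro closed_Collect_eq continuous_intros)
  ultimately show "closed (torus :: (complex^'n) set)" by (metis (no_types, lifting) closed_INT)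
qed

lemma trig_null_trig_mult:
  assumes "h \<in> trig_null" shows "(\<lambda>y. h y * trig k y) \<in> trig_null"
proof -
  have "integrable cell (\<lambda>y. h y * trig k y)"
    by (rule cell_integrable_bounded_mult[where M=1])
       (use assms in \<open>auto simp: trig_null_def intro!: borel_measurable_cell_continuous continuous_intros\<close>)
  moreover have "(\<integral>y. h y * trig k y * trig m y \<partial>cell) = 0" for m
    using assms by (simp add: trig_null_def mult.assoc flip: trig_add)
  ultimately show ?thesis by (simp add: trig_null_def)
qed

lemma trig_null_lincomb:
  assumes "h \<in> trig_null" "k \<in> trig_null" shows "(\<lambda>y. a * h y + b * k y) \<in> trig_null"
proof -
  have i: "integrable cell (\<lambda>y. h y * trig m y)" "integrable cell (\<lambda>y. k y * trig m y)" for m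
    using assms[THEN trig_null_trig_mult] by (auto simp: trig_null_def)
  have "(\<lambda>y. (a * h y + b * k y) * trig m y) = (\<lambda>y. a * (h y * trig m y) + b * (k y * trig m y))" for m
    by (auto simp: algebra_simps)
  then show ?thesis using assms i by (simp add: trig_null_def)
qed

definition unit_freq :: "'n \<Rightarrow> 'n \<Rightarrow> int" where "unit_freq i = (\<lambda>j. if j = i then 1 else 0)"

lemma trig_unit_freq:
  fixes y :: "real^'n"
  shows "trig (unit_freq i) y = cis (y $ i)" "trig (\<lambda>j. - unit_freq i j) y = cis (- (y $ i))"
proof -
  have "int_vec (unit_freq i) = (axis i 1 :: real^'n)" "int_vec (\<lambda>j. - unit_freq i j) = (- axis i 1 :: real^'n)"
    by (auto simp: int_vec_def unit_freq_def vec_eq_iff axis_def)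
  then show "trig (unit_freq i) y = cis (y $ i)" "trig (\<lambda>j. - unit_freq i j) y = cis (- (y $ i))"
    by (simp_all add: trig_def inner_axis')
qed

text \<open>
  Instead of writing down trigonometric polynomials as finite sums, one works with all continuous functions
  that multiply \<^term>\<open>trig_null\<close> into itself. This is a ring for trivial reasons, and it contains the
  coordinates of the torus because multiplication by an exponential only permutes the Fourier coefficients.
\<close>

definition null_multipliers :: "(complex^'n \<Rightarrow> real) set" where
  "null_multipliers = {F. continuous_on torus F \<and>
     (\<forall>h\<in>trig_null. (\<lambda>y. h y * complex_of_real (F (torus_map y))) \<in> trig_null)}"

lemma null_multipliers_coordinates:
  fixes i :: "'n::finite"
  shows "(\<lambda>z. Re (z $ i)) \<in> null_multipliers" and "(\<lambda>z. Im (z $ i)) \<in> null_multipliers"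
proof -
  have re: "(\<lambda>y. h y * complex_of_real (Re (torus_map y $ i)))
      = (\<lambda>y. (1/2) * (h y * trig (unit_freq i) y) + (1/2) * (h y * trig (\<lambda>j. - unit_freq i j) y))" for h :: "real^'n \<Rightarrow> complex"
    unfolding trig_unit_freq torus_map_def by (rule ext) (simp add: complex_eq_iff algebra_simps add_divide_distrib diff_divide_distrib)
  have im: "(\<lambda>y. h y * complex_of_real (Im (torus_map y $ i)))
      = (\<lambda>y. (-\<i>/2) * (h y * trig (unit_freq i) y) + (\<i>/2) * (h y * trig (\<lambda>j. - unit_freq i j) y))" for h :: "real^'n \<Rightarrow> complex"
    unfolding trig_unit_freq torus_map_def by (rule ext) (simp add: complex_eq_iff algebra_simps add_divide_distrib diff_divide_distrib)
  show "(\<lambda>z. Re (z $ i)) \<in> null_multipliers" "(\<lambda>z. Im (z $ i)) \<in> null_multipliers"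
    unfolding null_multipliers_def mem_Collect_eq re im
    by (intro conjI ballI continuous_intros trig_null_lincomb trig_null_trig_mult; assumption)+
qed

interpretation null_multipliers: function_ring_on null_multipliers torus
proof
  show "compact (torus :: (complex^'n) set)" by (rule compact_torus)
next
  fix f :: "complex^'n \<Rightarrow> real" assume "f \<in> null_multipliers"
  then show "continuous_on torus f" by (simp add: null_multipliers_def)
next
  fix f g :: "complex^'n \<Rightarrow> real" assume fg: "f \<in> null_multipliers" "g \<in> null_multipliers"
  have "(\<lambda>y. h y * complex_of_real (f (torus_map y) + g (torus_map y))) \<in> trig_null" if "h \<in> trig_null" for h
    using trig_null_lincomb[of "\<lambda>y. h y * complex_of_real (f (torus_map y))" "\<lambda>y. h y * complex_of_real (g (torus_map y))" 1 1]
      fg that by (simp add: null_multipliers_def distrib_left)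
  then show "(\<lambda>x. f x + g x) \<in> null_multipliers"
    using fg by (auto simp: null_multipliers_def intro!: continuous_intros)
  have "(\<lambda>y. h y * complex_of_real (f (torus_map y) * g (torus_map y))) \<in> trig_null" if "h \<in> trig_null" for h
  proof -
    have f': "\<And>k. k \<in> trig_null \<Longrightarrow> (\<lambda>y. k y * complex_of_real (f (torus_map y))) \<in> trig_null"
      and g': "\<And>k. k \<in> trig_null \<Longrightarrow> (\<lambda>y. k y * complex_of_real (g (torus_map y))) \<in> trig_null"
      using fg by (simp_all add: null_multipliers_def)
    show ?thesis using g'[OF f'[OF that]] by (simp add: mult.assoc)
  qed
  then show "(\<lambda>x. f x * g x) \<in> null_multipliers"
    using fg by (auto simp: null_multipliers_def intro!: continuous_intros)
next
  fix c :: real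
  have "(\<lambda>y. h y * complex_of_real c) \<in> trig_null" if "h \<in> trig_null" for h :: "real^'n \<Rightarrow> complex"
    using trig_null_lincomb[OF that that, of c 0] by (simp add: mult.commute)
  then show "(\<lambda>_. c) \<in> (null_multipliers :: (complex^'n \<Rightarrow> real) set)"
    by (auto simp: null_multipliers_def)
next
  fix x y :: "complex^'n" assume "x \<noteq> y"
  then obtain i where "Re (x $ i) \<noteq> Re (y $ i) \<or> Im (x $ i) \<noteq> Im (y $ i)"
    by (auto simp: vec_eq_iff complex_eq_iff)
  then show "\<exists>f\<in>null_multipliers. f x \<noteq> f y"
  proof
    assume "Re (x $ i) \<noteq> Re (y $ i)"
    then show ?thesis using null_multipliers_coordinates(1)[of i] by (rule bexI)
  next
    assume "Im (x $ i) \<noteq> Im (y $ i)"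
    then show ?thesis using null_multipliers_coordinates(2)[of i] by (rule bexI)
  qed
qed

text \<open>
  By Stone-Weierstrass, \<open>F\<close> is a uniform limit of multipliers \<open>g\<close>, and \<open>\<integral> h g = 0\<close> is the vanishing of the zeroth
  Fourier coefficient of \<open>h g\<close>.
\<close>

lemma trig_null_continuous:
  assumes h: "h \<in> trig_null" and F: "continuous_on UNIV (F :: complex^'n \<Rightarrow> real)"
  shows "(\<integral>y. h y * complex_of_real (F (torus_map y)) \<partial>cell) = 0"
proof -
  have hi: "integrable cell h" using h by (simp add: trig_null_def)
  have cont: "continuous_on torus F" using F continuous_on_subset by blast
  then have "bounded (F ` torus)" by (intro compact_imp_bounded compact_continuous_image compact_torus)
  then obtain M where M: "\<And>z. z \<in> torus \<Longrightarrow> \<bar>F z\<bar> \<le> M" by (auto simp: bounded_iff)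
  have FE: "continuous_on UNIV (\<lambda>y. complex_of_real (F (torus_map y)))"
    by (intro continuous_intros continuous_on_compose2[OF F]) auto
  have Fi: "integrable cell (\<lambda>y. h y * complex_of_real (F (torus_map y)))"
    by (rule cell_integrable_bounded_mult[OF hi borel_measurable_cell_continuous[OF FE], of M]) (simp add: M)
  have small: "cmod (\<integral>y. h y * complex_of_real (F (torus_map y)) \<partial>cell) \<le> e * (\<integral>y. cmod (h y) \<partial>cell)" if "e > 0" for e
  proof -
    obtain g where g: "g \<in> null_multipliers" "\<And>z. z \<in> torus \<Longrightarrow> \<bar>F z - g z\<bar> < e"
      using null_multipliers.Stone_Weierstrass_basic[OF cont \<open>e > 0\<close>] by blast
    have G: "(\<lambda>y. h y * complex_of_real (g (torus_map y))) \<in> trig_null" using g h by (simp add: null_multipliers_def)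
    then have Gi: "integrable cell (\<lambda>y. h y * complex_of_real (g (torus_map y)))" by (simp add: trig_null_def)
    have "(\<integral>y. h y * complex_of_real (g (torus_map y)) * trig (\<lambda>_. 0) y \<partial>cell) = 0"
      using G unfolding trig_null_def by blast
    then have "(\<integral>y. h y * complex_of_real (F (torus_map y)) \<partial>cell)
      = (\<integral>y. h y * complex_of_real (F (torus_map y)) - h y * complex_of_real (g (torus_map y)) \<partial>cell)"
      using Fi Gi by (simp add: trig_0)
    also have "cmod \<dots> \<le> (\<integral>y. cmod (h y * complex_of_real (F (torus_map y)) - h y * complex_of_real (g (torus_map y))) \<partial>cell)"
      by (rule integral_norm_bound)
    also have "\<dots> \<le> (\<integral>y. e * cmod (h y) \<partial>cell)"
    proof (rule integral_mono)
      show "cmod (h y * complex_of_real (F (torus_map y)) - h y * complex_of_real (g (torus_map y))) \<le> e * cmod (h y)" for y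
      proof -
        have "h y * complex_of_real (F (torus_map y)) - h y * complex_of_real (g (torus_map y))
          = complex_of_real (F (torus_map y) - g (torus_map y)) * h y" by (simp add: algebra_simps)
        also have "cmod \<dots> \<le> e * cmod (h y)"
          unfolding norm_mult norm_of_real using g(2)[OF torus_map_in[of y]] by (intro mult_right_mono) auto
        finally show ?thesis .
      qed
    qed (use hi Fi Gi in auto)
    finally show ?thesis by simp
  qed
  define I where "I = (\<integral>y. cmod (h y) \<partial>cell)"
  have "I \<ge> 0" by (simp add: I_def)
  have "cmod (\<integral>y. h y * complex_of_real (F (torus_map y)) \<partial>cell) \<le> 0"
  proof (rule field_le_epsilon)
    fix e :: real assume "e > 0"
    have "e / (I + 1) * I \<le> e" using \<open>e > 0\<close> \<open>I \<ge> 0\<close> by (simp add: field_simps)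
    then show "cmod (\<integral>y. h y * complex_of_real (F (torus_map y)) \<partial>cell) \<le> 0 + e"
      using small[of "e / (I + 1)"] \<open>e > 0\<close> \<open>I \<ge> 0\<close> unfolding I_def[symmetric] by fastforce
  qed
  then show ?thesis by simp
qed

text \<open>
  The indicator of \<open>C\<close> is the bounded pointwise limit on the cell of the continuous functions
  \<open>max 0 (1 - n dist (z, E C))\<close> on the torus, where \<open>E\<close> is \<^const>\<open>torus_map\<close>. The limit is correct because
  \<open>E\<close> is injective on the cell.
\<close>

lemma trig_null_compact:
  fixes C :: "(real^'n) set"
  assumes h: "h \<in> trig_null" and C: "compact C" "C \<subseteq> period_cell"
  shows "set_lebesgue_integral cell C h = 0"
proof (cases "C = {}")
  case True then show ?thesis by (simp add: set_lebesgue_integral_def)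
next
  case False
  have hi [measurable]: "integrable cell h" using h by (simp add: trig_null_def)
  have [measurable]: "h \<in> borel_measurable cell" using hi by auto
  define F where "F n z = max 0 (1 - real n * infdist z (torus_map ` C))" for n z
  have Fc: "continuous_on UNIV (F n)" for n unfolding F_def by (intro continuous_intros)
  have closed: "closed (torus_map ` C)"
    by (intro compact_imp_closed compact_continuous_image C continuous_intros)
  have Fb: "0 \<le> F n z" "F n z \<le> 1" for n z by (auto simp: F_def infdist_nonneg)
  have FE: "continuous_on UNIV (\<lambda>y. complex_of_real (F n (torus_map y)))" for n
    by (intro continuous_intros continuous_on_compose2[OF Fc]) auto
  note [measurable] = borel_measurable_cell_continuous[OF FE]
  have Csets: "C \<in> sets lebesgue" using C by (simp add: borel_compact)
  then have [measurable]: "C \<in> sets cell" using C by (simp add: sets_restrict_space_iff)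
  have lim: "(\<lambda>n. F n (torus_map y)) \<longlonglongrightarrow> indicator C y" if y: "y \<in> period_cell" for y
  proof (cases "y \<in> C")
    case True
    then show ?thesis by (simp add: F_def)
  next
    case nC: False
    then have "torus_map y \<notin> torus_map ` C"
      using inj_on_torus_map y C(2) by (auto simp: inj_on_def subset_iff)
    then have p: "infdist (torus_map y) (torus_map ` C) > 0"
      using infdist_pos_not_in_closed[OF closed] False by auto
    then obtain N where N: "1 < real N * infdist (torus_map y) (torus_map ` C)" using ex_less_of_nat_mult by blast
    have "F n (torus_map y) = 0" if "n \<ge> N" for n
    proof -
      have "real N * infdist (torus_map y) (torus_map ` C) \<le> real n * infdist (torus_map y) (torus_map ` C)"
        using that p by (intro mult_right_mono) auto
      then show ?thesis using N by (simp add: F_def)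
    qed
    then show ?thesis using nC by (auto intro!: tendsto_eventually eventually_sequentiallyI)
  qed
  have "(\<lambda>n. \<integral>y. h y * complex_of_real (F n (torus_map y)) \<partial>cell) \<longlonglongrightarrow> (\<integral>y. h y * complex_of_real (indicator C y) \<partial>cell)"
  proof (rule integral_dominated_convergence[where w="\<lambda>y. cmod (h y)"])
    show "AE y in cell. (\<lambda>n. h y * complex_of_real (F n (torus_map y))) \<longlonglongrightarrow> h y * complex_of_real (indicator C y)"
      by (rule AE_I2) (auto intro!: tendsto_intros lim simp: space_restrict_space)
    show "AE y in cell. cmod (h y * complex_of_real (F n (torus_map y))) \<le> cmod (h y)" for n
      using Fb by (auto simp: norm_mult intro!: mult_left_le)
    show "(\<lambda>y. h y * complex_of_real (indicator C y)) \<in> borel_measurable cell" by measurable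
  qed (use hi in auto)
  then have "(\<integral>y. h y * complex_of_real (indicator C y) \<partial>cell) = 0"
    using trig_null_continuous[OF h Fc] by (simp add: LIMSEQ_const_iff)
  moreover have "(\<lambda>y. h y * complex_of_real (indicator C y)) = (\<lambda>y. indicator C y *\<^sub>R h y)"
    by (auto simp: scaleR_conv_of_real)
  ultimately show ?thesis by (simp add: set_lebesgue_integral_def)
qed

text \<open>
  Every measurable subset of the cell is, up to a null set, an increasing union of compact sets, so the integral of
  \<open>h\<close> over every measurable set is zero.
\<close>

lemma trig_null_AE_zero:
  fixes h :: "real^'n \<Rightarrow> complex"
  assumes h: "h \<in> trig_null"
  shows "AE y in cell. h y = 0"
proof (rule sigma_finite_measure.density_zero[OF finite_measure.axioms(1)[OF finite_measure_cell]])
  show hi: "integrable cell h" using h by (simp add: trig_null_def)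
  have [measurable]: "h \<in> borel_measurable cell" using hi by auto
  fix A :: "(real^'n) set" assume A[measurable]: "A \<in> sets cell"
  then have AY: "A \<subseteq> period_cell" "A \<in> sets lebesgue" by (simp_all add: sets_restrict_space_iff)
  obtain C T where CT: "fsigma C" "T \<in> null_sets lebesgue" "C \<union> T = A" "disjnt C T"
    using lebesgue_set_almost_fsigma[OF AY(2)] .
  from CT(1) obtain G :: "nat \<Rightarrow> _" where G: "\<And>n. closed (G n)" "C = (\<Union>n. G n)" by (auto elim!: fsigma.cases)
  define H where "H n = (\<Union>i\<le>n. G i)" for n
  have HC: "(\<Union>n. H n) = C" by (auto simp: H_def G(2))
  have cpt: "compact (H n)" "H n \<subseteq> period_cell" for n
  proof -
    show sub: "H n \<subseteq> period_cell" using HC CT(3) AY(1) by blast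
    have "closed (H n)" unfolding H_def by (intro closed_UN) (auto simp: G)
    moreover have "bounded (H n)" using sub period_cell_bounds(2) bounded_cbox bounded_subset by blast
    ultimately show "compact (H n)" by (simp add: compact_eq_bounded_closed)
  qed
  then have [measurable]: "H n \<in> sets cell" for n
    by (simp add: sets_restrict_space_iff borel_compact)
  have [measurable]: "C \<in> sets cell" unfolding HC[symmetric] by measurable
  have "(\<lambda>n. set_lebesgue_integral cell (H n) h) \<longlonglongrightarrow> set_lebesgue_integral cell (\<Union>n. H n) h"
  proof (rule set_integral_cont_up)
    show "incseq H" by (auto simp: incseq_def H_def intro: order_trans)
    show "set_integrable cell (\<Union>n. H n) h"
      unfolding HC set_integrable_def using hi by (intro integrable_mult_indicator) auto
  qed simp
  then have "set_lebesgue_integral cell C h = 0"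
    using trig_null_compact[OF h cpt] by (simp add: HC LIMSEQ_const_iff)
  moreover have "set_lebesgue_integral cell A h = set_lebesgue_integral cell C h"
    unfolding set_lebesgue_integral_def
  proof (rule integral_cong_AE)
    have "AE y in lebesgue. y \<notin> T" using CT(2) by (rule AE_not_in)
    then show "AE y in cell. indicat_real A y *\<^sub>R h y = indicat_real C y *\<^sub>R h y"
      using CT(3) by (intro AE_cell) (auto elim!: eventually_mono simp: indicator_def)
  qed measurable
  ultimately show "set_lebesgue_integral cell A h = 0" by simp
qed

text \<open>
  Differentiation preserves the multiples of an exponential; this makes the exponentials smooth test functions and
  turns weak derivatives into multiplication of Fourier coefficients.
\<close>

lemma partial_deriv_trig:
  fixes m :: "'n::finite \<Rightarrow> int"
  shows "partial_deriv j (\<lambda>y. c * trig m y) = (\<lambda>y. (c * (\<i> * of_int (m j))) * trig m y)"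
proof
  fix x :: "real^'n"
  define a where "a = int_vec m \<bullet> x"
  have "((\<lambda>z. c * exp (\<i> * (of_real a + z * of_int (m j)))) has_field_derivative
      c * (\<i> * of_int (m j)) * exp (\<i> * of_real a)) (at (of_real 0))"
    by (auto intro!: derivative_eq_intros)
  then have "((\<lambda>t. c * exp (\<i> * (of_real a + of_real t * of_int (m j)))) has_vector_derivative
      c * (\<i> * of_int (m j)) * exp (\<i> * of_real a)) (at 0)"
    by (rule has_vector_derivative_real_field)
  moreover have "(\<lambda>t. c * trig m (x + t *\<^sub>R axis j 1)) = (\<lambda>t. c * exp (\<i> * (of_real a + of_real t * of_int (m j))))"
    by (rule ext) (simp add: trig_def cis_conv_exp a_def inner_add_right inner_axis int_vec_def)
  ultimately show "partial_deriv j (\<lambda>y. c * trig m y) x = (c * (\<i> * of_int (m j))) * trig m x"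
    unfolding partial_deriv_def by (simp add: vector_derivative_at trig_def cis_conv_exp a_def)
qed

lemma smooth_trig:
  fixes m :: "'n::finite \<Rightarrow> int"
  shows "smooth (\<lambda>y. c * trig m y)"
proof -
  have diff: "(\<lambda>y. c * trig m y) differentiable_on UNIV" for c
  proof -
    have "((\<lambda>y. c * trig m y) has_derivative (\<lambda>h. c * (\<i> * of_real (int_vec m \<bullet> h) * exp (\<i> * of_real (int_vec m \<bullet> y))))) (at y)" for y
    proof -
      have "((\<lambda>y. \<i> * complex_of_real (int_vec m \<bullet> y)) has_derivative (\<lambda>h. \<i> * of_real (int_vec m \<bullet> h))) (at y)"
        by (auto intro!: derivative_eq_intros)
      from has_derivative_compose[OF this DERIV_exp[unfolded has_field_derivative_def]]
      have "((\<lambda>y. exp (\<i> * of_real (int_vec m \<bullet> y))) has_derivative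
          (\<lambda>h. exp (\<i> * of_real (int_vec m \<bullet> y)) * (\<i> * of_real (int_vec m \<bullet> h)))) (at y)" .
      from has_derivative_mult_right[OF this, of c] show ?thesis
        unfolding trig_def cis_conv_exp by (simp add: mult_ac)
    qed
    then show ?thesis by (auto simp: differentiable_on_def differentiable_def intro: has_derivative_at_withinI)
  qed
  have "\<exists>c'. iter_partial_deriv js (\<lambda>y. c * trig m y) = (\<lambda>y. c' * trig m y)" for js
  proof (induction js)
    case Nil then show ?case by auto
  next
    case (Cons j js)
    then obtain c' where "iter_partial_deriv js (\<lambda>y. c * trig m y) = (\<lambda>y. c' * trig m y)" by blast
    then show ?case by (auto simp: partial_deriv_trig)
  qed
  then show ?thesis unfolding smooth_def using diff by metis
qed

lemma periodic_trig:
  fixes m :: "'n::finite \<Rightarrow> int"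
  shows "periodic (\<lambda>y. c * trig m y)"
proof -
  have "trig m (y + (2 * pi) *\<^sub>R p) = trig m y" if "p \<in> int_vectors" for p y :: "real^'n"
  proof -
    have "int_vec m \<bullet> p \<in> \<int>"
      unfolding inner_vec_def using that
      by (intro Ints_sum) (auto simp: int_vec_def int_vectors_def)
    then have "cis (2 * pi * (int_vec m \<bullet> p)) = 1" by (rule cis_multiple_2pi)
    then show ?thesis
      by (simp add: trig_def inner_add_right flip: cis_mult)
  qed
  then show ?thesis by (simp add: periodic_def)
qed

lemma L2_zero_if_trig_coefficients_zero:
  assumes h: "h \<in> cell_L2" and z: "\<And>m. (\<integral>y. h y * trig m y \<partial>cell) = 0"
  shows "AE y in cell. h y = 0"
  by (rule trig_null_AE_zero) (use assms in \<open>auto simp: trig_null_def\<close>)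

section \<open>Weak derivatives\<close>

lemma integral_lborel_shift:
  fixes g :: "real^'n \<Rightarrow> complex"
  assumes "g \<in> borel_measurable borel"
  shows "integral\<^sup>L lborel (\<lambda>y. g (a + y)) = integral\<^sup>L lborel g"
  using integral_distr[of "(+) a" lborel borel g] assms by (simp add: lborel_distr_plus)

lemma cell_integral_lborel:
  fixes g :: "real^'n \<Rightarrow> complex"
  assumes [measurable]: "g \<in> borel_measurable borel"
  shows "integral\<^sup>L cell g = (\<integral>y. indicator period_cell y * g y \<partial>lborel)"
proof -
  have "integral\<^sup>L cell g = integral\<^sup>L lebesgue (\<lambda>y. indicator period_cell y *\<^sub>R g y)"
    by (simp add: integral_restrict_space)
  also have "\<dots> = (\<integral>y. indicator period_cell y *\<^sub>R g y \<partial>lborel)"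
    by (rule integral_completion) measurable
  also have "(\<lambda>y. indicator period_cell y *\<^sub>R g y) = (\<lambda>y. indicator period_cell y * g y)"
    by (auto simp: indicator_def)
  finally show ?thesis .
qed

lemma integrable_bounded_indicator:
  fixes f :: "real^'n \<Rightarrow> complex"
  assumes f: "continuous_on UNIV f" and [measurable]: "B \<in> sets borel" and "bounded B"
  shows "integrable lborel (\<lambda>y. indicator B y * f y)"
proof -
  have c: "compact (closure B)" using assms(3) by simp
  have "integrable lborel (\<lambda>y. indicator (closure B) y *\<^sub>R f y)"
    by (rule borel_integrable_compact[OF c]) (use f continuous_on_subset in auto)
  then have "integrable lborel (\<lambda>y. indicator B y *\<^sub>R (indicator (closure B) y *\<^sub>R f y))"
    by (rule integrable_mult_indicator[rotated]) simp
  moreover have "(\<lambda>y. indicator B y *\<^sub>R (indicator (closure B) y *\<^sub>R f y)) = (\<lambda>y. indicator B y * f y)"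
    using closure_subset[of B] by (auto simp: indicator_def fun_eq_iff)
  ultimately show ?thesis by simp
qed

text \<open>
  The translated cell is the part \<open>y\<^sub>j \<ge> t\<close> of the cell together with the part \<open>y\<^sub>j < t\<close> moved by one period.
\<close>

lemma cell_integral_shift:
  fixes f :: "real^'n \<Rightarrow> complex"
  assumes f: "continuous_on UNIV f" "periodic f" and t: "0 \<le> t" "t \<le> 2 * pi"
  shows "(\<integral>y. f (y + t *\<^sub>R axis j 1) \<partial>cell) = (\<integral>y. f y \<partial>cell)"
proof -
  let ?e = "axis j 1 :: real^'n"
  define A where "A = period_cell \<inter> {y :: real^'n. t \<le> y $ j}"
  define B where "B = period_cell \<inter> {y :: real^'n. y $ j < t}"
  have [measurable]: "A \<in> sets borel" "B \<in> sets borel" unfolding A_def B_def by measurable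
  have bY: "bounded (period_cell :: (real^'n) set)" using period_cell_bounds(2) bounded_cbox bounded_subset by blast
  then have bd: "bounded A" "bounded B" unfolding A_def B_def by (auto intro: bounded_subset)
  have [measurable]: "f \<in> borel_measurable borel" using f(1) by (rule borel_measurable_continuous_onI)
  have per: "f (y + (2*pi) *\<^sub>R ?e) = f y" for y
    using f(2) by (auto simp: periodic_def int_vectors_def axis_def)
  have ind: "indicator period_cell (y - t *\<^sub>R ?e) = (indicator A y + indicator B (y - (2*pi) *\<^sub>R ?e) :: complex)" for y
  proof -
    have 1: "y - t *\<^sub>R ?e \<in> period_cell \<longleftrightarrow> (\<forall>i. i \<noteq> j \<longrightarrow> 0 \<le> y $ i \<and> y $ i < 2*pi) \<and> t \<le> y $ j \<and> y $ j < t + 2*pi"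
      by (auto simp: period_cell_def axis_def algebra_simps)
    have 2: "y \<in> A \<longleftrightarrow> (\<forall>i. i \<noteq> j \<longrightarrow> 0 \<le> y $ i \<and> y $ i < 2*pi) \<and> t \<le> y $ j \<and> y $ j < 2*pi"
      using t by (auto simp: A_def period_cell_def) (metis order_trans)
    have 3: "y - (2*pi) *\<^sub>R ?e \<in> B \<longleftrightarrow> (\<forall>i. i \<noteq> j \<longrightarrow> 0 \<le> y $ i \<and> y $ i < 2*pi) \<and> 2*pi \<le> y $ j \<and> y $ j < t + 2*pi"
      using t by (auto simp: B_def period_cell_def axis_def algebra_simps)
    show ?thesis
      using t unfolding indicator_def of_bool_def 1 2 3 by auto
  qed
  have int: "integrable lborel (\<lambda>y. indicator A y * f y)" "integrable lborel (\<lambda>y. indicator B y * f y)"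
    by (intro integrable_bounded_indicator f bd; simp)+
  have shiftB: "integrable lborel (\<lambda>y. indicator B (y - (2*pi) *\<^sub>R ?e) * f y)"
  proof -
    have "integrable lborel (\<lambda>y. indicator B (- ((2*pi) *\<^sub>R ?e) + y) * f (- ((2*pi) *\<^sub>R ?e) + y))"
      using integrable_distr_eq[of "(+) (- ((2*pi) *\<^sub>R ?e))" lborel borel "\<lambda>y. indicator B y * f y"] int(2)
      by (simp add: lborel_distr_plus)
    moreover have "f (- ((2*pi) *\<^sub>R ?e) + y) = f y" for y using per[of "- ((2*pi) *\<^sub>R ?e) + y"] by simp
    ultimately show ?thesis by simp
  qed
  have "(\<integral>y. f (y + t *\<^sub>R ?e) \<partial>cell) = (\<integral>y. indicator period_cell y * f (y + t *\<^sub>R ?e) \<partial>lborel)"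
    by (rule cell_integral_lborel) measurable
  also have "\<dots> = (\<integral>y. indicator period_cell (y - t *\<^sub>R ?e) * f y \<partial>lborel)"
    using integral_lborel_shift[of "\<lambda>y. indicator period_cell (y - t *\<^sub>R ?e) * f y" "t *\<^sub>R ?e"]
    by (simp add: add.commute)
  also have "\<dots> = (\<integral>y. indicator A y * f y + indicator B (y - (2*pi) *\<^sub>R ?e) * f y \<partial>lborel)"
    unfolding ind by (simp add: distrib_right)
  also have "\<dots> = (\<integral>y. indicator A y * f y \<partial>lborel) + (\<integral>y. indicator B (y - (2*pi) *\<^sub>R ?e) * f y \<partial>lborel)"
    by (rule Bochner_Integration.integral_add[OF int(1) shiftB])
  also have "(\<integral>y. indicator B (y - (2*pi) *\<^sub>R ?e) * f y \<partial>lborel) = (\<integral>y. indicator B y * f y \<partial>lborel)"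
    using integral_lborel_shift[of "\<lambda>y. indicator B (y - (2*pi) *\<^sub>R ?e) * f y" "(2*pi) *\<^sub>R ?e"]
    using per by (simp add: add.commute)
  also have "(\<integral>y. indicator A y * f y \<partial>lborel) + \<dots> = (\<integral>y. indicator A y * f y + indicator B y * f y \<partial>lborel)"
    by (rule Bochner_Integration.integral_add[OF int, symmetric])
  also have "(\<lambda>y. indicator A y * f y + indicator B y * f y) = (\<lambda>y. indicator period_cell y * f y)"
    by (auto simp: A_def B_def indicator_def fun_eq_iff)
  also have "(\<integral>y. indicator period_cell y * f y \<partial>lborel) = (\<integral>y. f y \<partial>cell)"
    by (rule cell_integral_lborel[symmetric]) measurable
  finally show ?thesis .
qed

lemma smooth_continuous:
  assumes "smooth f" shows "continuous_on UNIV f" "continuous_on UNIV (partial_deriv j f)"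
  using assms[unfolded smooth_def, rule_format, of "[]"] assms[unfolded smooth_def, rule_format, of "[j]"]
  by (auto intro: differentiable_imp_continuous_on)

lemma partial_deriv_has_derivative:
  fixes f :: "real^'n \<Rightarrow> 'a::real_normed_vector"
  assumes "(f has_derivative f') (at x)"
  shows "partial_deriv l f x = f' (axis l 1)"
proof -
  have lin: "f' (t *\<^sub>R axis l 1) = t *\<^sub>R f' (axis l 1)" for t using has_derivative_linear[OF assms] by (rule linear_scale)
  have "((\<lambda>t. f (x + t *\<^sub>R axis l 1)) has_vector_derivative f' (axis l 1)) (at 0)"
    unfolding has_vector_derivative_def
    by (rule has_derivative_eq_rhs[OF has_derivative_compose[where g=f and g'=f']])
       (auto intro!: derivative_eq_intros assms simp: lin)
  then show ?thesis unfolding partial_deriv_def by (rule vector_derivative_at)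
qed

lemma has_partial_deriv:
  fixes f :: "real^'n \<Rightarrow> 'a::real_normed_vector"
  assumes "f differentiable (at (x + s *\<^sub>R axis j 1))"
  shows "((\<lambda>t. f (x + t *\<^sub>R axis j 1)) has_vector_derivative partial_deriv j f (x + s *\<^sub>R axis j 1)) (at s within T)"
proof -
  let ?e = "axis j 1 :: real^'n"
  obtain f' where f': "(f has_derivative f') (at (x + s *\<^sub>R ?e))" using assms by (auto simp: differentiable_def)
  have lin: "f' (t *\<^sub>R ?e) = t *\<^sub>R f' ?e" for t using has_derivative_linear[OF f'] by (rule linear_scale)
  have "((\<lambda>t. f (x + t *\<^sub>R ?e)) has_vector_derivative f' ?e) (at s within T)"
    unfolding has_vector_derivative_def
    by (rule has_derivative_eq_rhs[OF has_derivative_compose[where g=f and g'=f']])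
       (auto intro!: derivative_eq_intros f' simp: lin)
  then show ?thesis unfolding partial_deriv_has_derivative[OF f'] .
qed

lemma continuous_cell_L2:
  fixes f :: "real^'n \<Rightarrow> complex"
  assumes "continuous_on UNIV f" shows "f \<in> cell_L2"
proof -
  have "bounded (f ` cbox 0 (\<chi> i. 2*pi))"
    by (intro compact_imp_bounded compact_continuous_image compact_cbox continuous_on_subset[OF assms]) auto
  then obtain B where B: "\<And>x. x \<in> cbox 0 (\<chi> i. 2*pi) \<Longrightarrow> cmod (f x) \<le> B" by (auto simp: bounded_iff)
  have "(\<lambda>y. f y * 1) \<in> cell_L2"
    by (rule cell_L2_bounded_mult[where M=B])
       (use B period_cell_bounds(2) borel_measurable_cell_continuous[OF assms] in \<open>auto simp: space_restrict_space intro!: AE_I2\<close>)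
  then show ?thesis by simp
qed

text \<open>
  The difference quotients of \<open>f\<close> have mean zero by translation invariance, and they converge boundedly to the
  partial derivative. This is the integration by parts behind the fact that constants have weak derivative zero.
\<close>

lemma cell_integral_partial_deriv:
  fixes f :: "real^'n \<Rightarrow> complex"
  assumes f: "smooth f" "periodic f"
  shows "(\<integral>y. partial_deriv j f y \<partial>cell) = 0"
proof -
  let ?e = "axis j 1 :: real^'n"
  have diff: "f differentiable (at x)" for x
    using f(1)[unfolded smooth_def, rule_format, of "[]"] by (simp add: differentiable_on_def)
  note cont = smooth_continuous[OF f(1)]
  \<comment> \<open>The box is one unit larger than the cell, so that it contains the segments used by difference quotients of step at most one.\<close>
  define K where "K = (cbox 0 (\<chi> i. 2 * pi + 1) :: (real^'n) set)"
  have "bounded (partial_deriv j f ` K)"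
    unfolding K_def by (intro compact_imp_bounded compact_continuous_image compact_cbox continuous_on_subset[OF cont(2)]) auto
  then obtain M where M: "\<And>x. x \<in> K \<Longrightarrow> cmod (partial_deriv j f x) \<le> M" by (auto simp: bounded_iff)
  define t where "t n = inverse (real (Suc n))" for n
  have t: "0 < t n" "t n \<le> 1" for n by (auto simp: t_def field_simps)
  have t0: "t \<longlonglongrightarrow> 0" unfolding t_def by (rule LIMSEQ_inverse_real_of_nat)
  define q where "q n y = (f (y + t n *\<^sub>R ?e) - f y) /\<^sub>R t n" for n y
  have cq: "continuous_on UNIV (\<lambda>y. f (y + s *\<^sub>R ?e))" for s
    by (intro continuous_on_compose2[OF cont(1)] continuous_intros) auto
  note Lc = cell_L2_integrable[OF continuous_cell_L2]
  have z: "(\<integral>y. q n y \<partial>cell) = 0" for n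
  proof -
    have "(\<integral>y. f (y + t n *\<^sub>R ?e) - f y \<partial>cell) = 0"
      using Bochner_Integration.integral_diff[OF Lc[OF cq] Lc[OF cont(1)]] cell_integral_shift[OF cont(1) f(2), of "t n" j]
        t[of n] pi_ge_two by simp
    then show ?thesis unfolding q_def by simp
  qed
  have "(\<lambda>n. \<integral>y. q n y \<partial>cell) \<longlonglongrightarrow> (\<integral>y. partial_deriv j f y \<partial>cell)"
  proof (rule integral_dominated_convergence[where w="\<lambda>_. M"])
    show "partial_deriv j f \<in> borel_measurable cell" by (rule borel_measurable_cell_continuous[OF cont(2)])
    show "q n \<in> borel_measurable cell" for n
      unfolding q_def by (intro borel_measurable_cell_continuous continuous_intros cq cont(1))
    show "integrable cell (\<lambda>_. M)" by (simp add: finite_measure.integrable_const)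
    have "(\<lambda>n. q n y) \<longlonglongrightarrow> partial_deriv j f y" for y
    proof -
      have "((\<lambda>s. f (y + s *\<^sub>R ?e)) has_vector_derivative partial_deriv j f (y + 0 *\<^sub>R ?e)) (at 0)"
        by (rule has_partial_deriv) (simp add: diff)
      then have "((\<lambda>s. (f (y + s *\<^sub>R ?e) - f y) /\<^sub>R s) \<longlongrightarrow> partial_deriv j f y) (at 0)"
      proof -
        assume "((\<lambda>s. f (y + s *\<^sub>R ?e)) has_vector_derivative partial_deriv j f (y + 0 *\<^sub>R ?e)) (at 0)"
        then have "((\<lambda>s. norm (f (y + s *\<^sub>R ?e) - f y - s *\<^sub>R partial_deriv j f y) / norm s) \<longlongrightarrow> 0) (at 0)"
          by (simp add: has_vector_derivative_def has_derivative_at)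
        also have "(\<lambda>s. norm (f (y + s *\<^sub>R ?e) - f y - s *\<^sub>R partial_deriv j f y) / norm s)
            = (\<lambda>s. norm ((f (y + s *\<^sub>R ?e) - f y - s *\<^sub>R partial_deriv j f y) /\<^sub>R s))"
          by (auto simp: divide_inverse mult.commute)
        finally have "((\<lambda>s. (f (y + s *\<^sub>R ?e) - f y - s *\<^sub>R partial_deriv j f y) /\<^sub>R s) \<longlongrightarrow> 0) (at 0)"
          by (rule tendsto_norm_zero_cancel)
        moreover have "\<forall>\<^sub>F s in at (0::real). (f (y + s *\<^sub>R ?e) - f y - s *\<^sub>R partial_deriv j f y) /\<^sub>R s
            = (f (y + s *\<^sub>R ?e) - f y) /\<^sub>R s - partial_deriv j f y"
          by (auto simp: eventually_at scaleR_diff_right intro!: exI[of _ 1])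
        ultimately show ?thesis
          using LIM_zero_cancel tendsto_cong by fastforce
      qed
      moreover have "filterlim t (at 0) sequentially"
        unfolding filterlim_at using t t0 by (auto simp: less_imp_neq[symmetric] dest: less_imp_neq)
      ultimately show ?thesis unfolding q_def by (rule filterlim_compose)
    qed
    then show "AE y in cell. (\<lambda>n. q n y) \<longlonglongrightarrow> partial_deriv j f y" by simp
    have "cmod (q n y) \<le> M" if y: "y \<in> period_cell" for n y
    proof -
      have "norm (f (y + t n *\<^sub>R ?e) - f (y + 0 *\<^sub>R ?e)) \<le> M * norm (t n - 0)"
      proof (rule differentiable_bound[where S="{0..1}" and f'="\<lambda>s h. h *\<^sub>R partial_deriv j f (y + s *\<^sub>R ?e)"])
        show "((\<lambda>s. f (y + s *\<^sub>R ?e)) has_derivative (\<lambda>h. h *\<^sub>R partial_deriv j f (y + s *\<^sub>R ?e))) (at s within {0..1})" for s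
          using has_partial_deriv[OF diff] by (simp add: has_vector_derivative_def)
        fix s :: real assume s: "s \<in> {0..1}"
        have "y + s *\<^sub>R ?e \<in> K"
          using y s by (auto simp: K_def mem_box_cart period_cell_def axis_def add_mono less_imp_le add_increasing2)
        then have "cmod (partial_deriv j f (y + s *\<^sub>R ?e)) \<le> M" by (rule M)
        then show "onorm (\<lambda>h. h *\<^sub>R partial_deriv j f (y + s *\<^sub>R ?e)) \<le> M"
          by (intro onorm_le) (simp add: mult_right_mono mult.commute[of M] mult_left_mono)
      qed (use t[of n] in auto)
      then show ?thesis using t[of n] by (simp add: q_def divide_simps)
    qed
    then show "AE y in cell. cmod (q n y) \<le> M" for n by (intro AE_I2) (simp add: space_restrict_space)
  qed
  then show ?thesis using z by (simp add: LIMSEQ_const_iff)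
qed

lemma L2_per_intro:
  assumes "u \<in> borel_measurable lebesgue" "ae_periodic u" "u \<in> cell_L2"
  shows "u \<in> L2_per"
  using assms by (simp add: L2_per_def cell_integrable_eq)

lemma L2_perD:
  assumes "u \<in> L2_per" shows "u \<in> borel_measurable lebesgue" "ae_periodic u" "u \<in> cell_L2"
  using assms L2_per_imp_cell_L2[OF assms] by (auto simp: L2_per_def)

lemma ae_periodic_comp2:
  assumes "ae_periodic u" "ae_periodic v" shows "ae_periodic (\<lambda>y. F (u y) (v y))"
  unfolding ae_periodic_def
proof
  fix p :: "real^'a" assume "p \<in> int_vectors"
  then have "AE y in lebesgue. u (y + (2 * pi) *\<^sub>R p) = u y" "AE y in lebesgue. v (y + (2 * pi) *\<^sub>R p) = v y"
    using assms by (auto simp: ae_periodic_def)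
  then show "AE y in lebesgue. F (u (y + (2 * pi) *\<^sub>R p)) (v (y + (2 * pi) *\<^sub>R p)) = F (u y) (v y)"
    by eventually_elim simp
qed

lemma L2_per_lincomb: 
  assumes "u \<in> L2_per" "v \<in> L2_per" shows "(\<lambda>y. a * u y + b * v y) \<in> L2_per"
proof (rule L2_per_intro)
  show "(\<lambda>y. a * u y + b * v y) \<in> borel_measurable lebesgue" using assms[THEN L2_perD(1)] by measurable
  show "ae_periodic (\<lambda>y. a * u y + b * v y)" using ae_periodic_comp2[OF assms[THEN L2_perD(2)], where F="\<lambda>x z. a * x + b * z"] .
  show "(\<lambda>y. a * u y + b * v y) \<in> cell_L2" using assms[THEN L2_perD(3)] by (intro cell_L2_add cell_L2_cmult)
qed

lemma L2_per_cnj: 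
  assumes "u \<in> L2_per" shows "(\<lambda>y. cnj (u y)) \<in> L2_per"
proof (rule L2_per_intro)
  show "(\<lambda>y. cnj (u y)) \<in> borel_measurable lebesgue" using assms[THEN L2_perD(1)]
    by (rule measurable_compose[OF _ borel_measurable_continuous_onI[OF continuous_on_cnj[OF continuous_on_id]]])
  show "ae_periodic (\<lambda>y. cnj (u y))" using ae_periodic_comp2[of u u "\<lambda>x _. cnj x"] assms[THEN L2_perD(2)] by simp
  show "(\<lambda>y. cnj (u y)) \<in> cell_L2" using assms[THEN L2_perD(3)] by (rule cell_L2_cnj)
qed

lemma L2_per_const [simp]: "(\<lambda>_. c) \<in> L2_per"
  by (rule L2_per_intro) (auto simp: ae_periodic_def)

lemma is_weak_partial_cell:
  "is_weak_partial j u g \<longleftrightarrow> u \<in> L2_per \<and> g \<in> L2_per \<and>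
     (\<forall>f. smooth f \<and> periodic f \<longrightarrow> (\<integral>y. g y * f y \<partial>cell) = - (\<integral>y. u y * partial_deriv j f y \<partial>cell))"
  by (simp add: is_weak_partial_def cell_integral_eq)

lemma is_weak_partial_lincomb:
  assumes "is_weak_partial j u g" "is_weak_partial j v h"
  shows "is_weak_partial j (\<lambda>y. a * u y + b * v y) (\<lambda>y. a * g y + b * h y)"
  unfolding is_weak_partial_cell
proof (intro conjI allI impI L2_per_lincomb)
  have L: "u \<in> L2_per" "v \<in> L2_per" "g \<in> L2_per" "h \<in> L2_per" using assms by (auto simp: is_weak_partial_def)
  then show "u \<in> L2_per" "v \<in> L2_per" "g \<in> L2_per" "h \<in> L2_per" by auto
  note L2 = L[THEN L2_perD(3)]
  fix f :: "real^'a \<Rightarrow> complex" assume f: "smooth f \<and> periodic f"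
  have fL: "f \<in> cell_L2" "partial_deriv j f \<in> cell_L2" using f by (auto intro: continuous_cell_L2 smooth_continuous)
  have e: "(\<integral>y. (a * p y + b * q y) * k y \<partial>cell) = a * (\<integral>y. p y * k y \<partial>cell) + b * (\<integral>y. q y * k y \<partial>cell)"
    if "p \<in> cell_L2" "q \<in> cell_L2" "k \<in> cell_L2" for p q k :: "real^'a \<Rightarrow> complex"
    using that by (simp add: distrib_right mult.assoc cell_L2_mult_integrable)
  show "(\<integral>y. (a * g y + b * h y) * f y \<partial>cell) = - (\<integral>y. (a * u y + b * v y) * partial_deriv j f y \<partial>cell)"
    using assms f L2 fL by (simp add: e is_weak_partial_cell)
qed

lemma iter_partial_deriv_cnj:
  assumes "smooth f" 
  shows "iter_partial_deriv js (\<lambda>y. cnj (f y)) = (\<lambda>y. cnj (iter_partial_deriv js f y))"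
proof (induction js)
  case Nil show ?case by simp
next
  case (Cons j js)
  have "partial_deriv j (\<lambda>y. cnj (iter_partial_deriv js f y)) x = cnj (partial_deriv j (iter_partial_deriv js f) x)" for x
  proof -
    have "iter_partial_deriv js f differentiable (at (x + 0 *\<^sub>R axis j 1))"
      using assms[unfolded smooth_def, rule_format, of js] by (simp add: differentiable_on_def)
    from has_partial_deriv[OF this, of UNIV]
    have "((\<lambda>t. iter_partial_deriv js f (x + t *\<^sub>R axis j 1)) has_vector_derivative partial_deriv j (iter_partial_deriv js f) x) (at 0)"
      by simp
    then have "((\<lambda>t. cnj (iter_partial_deriv js f (x + t *\<^sub>R axis j 1))) has_vector_derivative cnj (partial_deriv j (iter_partial_deriv js f) x)) (at 0)"
      by (rule has_vector_derivative_cnj)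
    then show ?thesis unfolding partial_deriv_def[of j "\<lambda>y. cnj (iter_partial_deriv js f y)"] by (rule vector_derivative_at)
  qed
  then show ?case using Cons by auto
qed

lemma smooth_cnj: assumes "smooth f" shows "smooth (\<lambda>y. cnj (f y))"
  unfolding smooth_def iter_partial_deriv_cnj[OF assms]
proof
  fix js
  have "iter_partial_deriv js f differentiable_on UNIV" using assms by (simp add: smooth_def)
  then show "(\<lambda>y. cnj (iter_partial_deriv js f y)) differentiable_on UNIV"
    unfolding differentiable_on_def differentiable_def using bounded_linear.has_derivative[OF bounded_linear_cnj] by blast
qed

lemma is_weak_partial_cnj:
  assumes "is_weak_partial j u g" shows "is_weak_partial j (\<lambda>y. cnj (u y)) (\<lambda>y. cnj (g y))"
  unfolding is_weak_partial_cell
proof (intro conjI allI impI L2_per_cnj)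
  show "u \<in> L2_per" "g \<in> L2_per" using assms by (auto simp: is_weak_partial_def)
  fix f :: "real^'a \<Rightarrow> complex" assume f: "smooth f \<and> periodic f"
  then have "smooth (\<lambda>y. cnj (f y)) \<and> periodic (\<lambda>y. cnj (f y))" by (auto simp: smooth_cnj periodic_def)
  then have "(\<integral>y. g y * cnj (f y) \<partial>cell) = - (\<integral>y. u y * partial_deriv j (\<lambda>y. cnj (f y)) y \<partial>cell)"
    using assms by (simp add: is_weak_partial_cell)
  also have "partial_deriv j (\<lambda>y. cnj (f y)) = (\<lambda>y. cnj (partial_deriv j f y))"
    using iter_partial_deriv_cnj[of f "[j]"] f by simp
  finally have "cnj (\<integral>y. g y * cnj (f y) \<partial>cell) = - cnj (\<integral>y. u y * cnj (partial_deriv j f y) \<partial>cell)" by simp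
  then show "(\<integral>y. cnj (g y) * f y \<partial>cell) = - (\<integral>y. cnj (u y) * partial_deriv j f y \<partial>cell)"
    using Bochner_Integration.integral_cnj[of cell "\<lambda>y. g y * cnj (f y)"] Bochner_Integration.integral_cnj[of cell "\<lambda>y. u y * cnj (partial_deriv j f y)"]
    by (simp del: Bochner_Integration.integral_cnj)
qed

lemma is_weak_partial_const: "is_weak_partial j (\<lambda>_. c) (\<lambda>_. 0)"
  by (simp add: is_weak_partial_cell cell_integral_partial_deriv)

text \<open>
  Weak derivatives see a function only through integrals over the cell. This lets the chosen derivative
  \<^const>\<open>weak_partial\<close> be replaced by an explicit one before it is differentiated again.
\<close>

lemma is_weak_partial_cong:
  assumes "is_weak_partial j u g" "u' \<in> L2_per" "AE y in cell. u' y = u y"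
  shows "is_weak_partial j u' g"
proof -
  have u: "u \<in> L2_per" using assms by (simp add: is_weak_partial_def)
  have [measurable]: "u \<in> borel_measurable cell" "u' \<in> borel_measurable cell"
    using u assms(2) by (auto dest: L2_perD)
  have "(\<integral>y. u y * partial_deriv j f y \<partial>cell) = (\<integral>y. u' y * partial_deriv j f y \<partial>cell)" if "smooth f" for f
  proof (rule integral_cong_AE)
    have [measurable]: "partial_deriv j f \<in> borel_measurable cell"
      using smooth_continuous(2)[OF that] by (rule borel_measurable_cell_continuous)
    show "(\<lambda>y. u y * partial_deriv j f y) \<in> borel_measurable cell" "(\<lambda>y. u' y * partial_deriv j f y) \<in> borel_measurable cell"
      by measurable
    show "AE y in cell. u y * partial_deriv j f y = u' y * partial_deriv j f y"
      using assms(3) by eventually_elim simp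
  qed
  then show ?thesis using assms by (auto simp: is_weak_partial_cell)
qed

text \<open>
  Exponentials are admissible test functions, so two weak derivatives have the same Fourier coefficients.
\<close>

lemma is_weak_partial_unique:
  fixes u :: "real^'n \<Rightarrow> complex"
  assumes "is_weak_partial j u g" "is_weak_partial j u h"
  shows "AE y in lebesgue. g y = h y"
proof -
  have L: "g \<in> L2_per" "h \<in> L2_per" using assms by (auto simp: is_weak_partial_def)
  have "AE y in cell. g y - h y = 0"
  proof (rule L2_zero_if_trig_coefficients_zero)
    show "(\<lambda>y. g y - h y) \<in> cell_L2" using L2_per_lincomb[OF L, of 1 "-1"] L2_perD(3) by simp
    fix m :: "'n \<Rightarrow> int"
    have t: "smooth (trig m)" "periodic (trig m)" using smooth_trig[of 1 m] periodic_trig[of 1 m] by simp_all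
    have tL: "trig m \<in> cell_L2" by (intro continuous_cell_L2 continuous_intros)
    have "(\<integral>y. (g y - h y) * trig m y \<partial>cell) = (\<integral>y. g y * trig m y \<partial>cell) - (\<integral>y. h y * trig m y \<partial>cell)"
      using L[THEN L2_perD(3)] tL by (simp add: left_diff_distrib cell_L2_mult_integrable)
    also have "\<dots> = 0" using assms t by (simp add: is_weak_partial_cell)
    finally show "(\<integral>y. (g y - h y) * trig m y \<partial>cell) = 0" .
  qed
  then have "AE y in lebesgue. g y - h y = 0"
    by (rule AE_cell_imp_AE[where u="\<lambda>y. g y - h y" and P="\<lambda>z. z = 0", rotated])
       (rule ae_periodic_comp2[OF L2_perD(2)[OF L(1)] L2_perD(2)[OF L(2)], where F="(-)"])
  then show ?thesis by simp
qed

lemma weak_partial_works: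
  assumes "is_weak_partial j u g" shows "is_weak_partial j u (weak_partial j u)"
  unfolding weak_partial_def by (rule someI[where P="is_weak_partial j u", OF assms])

lemma weak_partial_AE: "is_weak_partial j u g \<Longrightarrow> AE y in lebesgue. weak_partial j u y = g y"
  using is_weak_partial_unique weak_partial_works by blast

text \<open>
  Testing with \<open>exp (i m \<sqdot> y)\<close> gives \<open>i m\<^sub>j u\<^sub>m = 0\<close> for the Fourier coefficients, hence \<open>u\<^sub>m = 0\<close> for
  \<open>m \<noteq> 0\<close>; the function differs from its mean by a function with no Fourier coefficients.
\<close>

lemma weak_gradient_zero_imp_const:
  fixes u :: "real^'n \<Rightarrow> complex"
  assumes "\<And>j. is_weak_partial j u (\<lambda>_. 0)"
  shows "\<exists>K. AE y in lebesgue. u y = K"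
proof -
  have uL: "u \<in> L2_per" using assms by (simp add: is_weak_partial_def)
  define V where "V = complex_of_real (measure cell (space (cell :: (real^'n) measure)))"
  have V: "V \<noteq> 0" using measure_period_cell_pos measure_cell unfolding V_def by (metis less_irrefl of_real_eq_0_iff)
  define K where "K = (\<integral>y. u y \<partial>cell) / V"
  have van: "(\<integral>y. w y * trig m y \<partial>cell) = 0" if w: "\<And>j. is_weak_partial j w (\<lambda>_. 0)" and m: "m j \<noteq> 0" for w m j
  proof -
    have t: "smooth (trig m)" "periodic (trig m)" using smooth_trig[of 1 m] periodic_trig[of 1 m] by simp_all
    have pd: "partial_deriv j (trig m) = (\<lambda>y. (\<i> * of_int (m j)) * trig m y)" using partial_deriv_trig[of j 1 m] by simp
    have "(\<integral>y. 0 * trig m y \<partial>cell) = - (\<integral>y. w y * partial_deriv j (trig m) y \<partial>cell)"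
      using w[of j] t unfolding is_weak_partial_cell by blast
    then have "(\<integral>y. w y * ((\<i> * of_int (m j)) * trig m y) \<partial>cell) = 0"
      unfolding pd by simp
    moreover have "(\<lambda>y. w y * ((\<i> * of_int (m j)) * trig m y)) = (\<lambda>y. (\<i> * of_int (m j)) * (w y * trig m y))"
      by (auto simp: algebra_simps)
    ultimately show ?thesis using m by simp
  qed
  have "AE y in cell. u y - K = 0"
  proof (rule L2_zero_if_trig_coefficients_zero)
    show "(\<lambda>y. u y - K) \<in> cell_L2" using L2_per_lincomb[OF uL L2_per_const[of K], of 1 "-1"] L2_perD(3) by simp
    fix m :: "'n \<Rightarrow> int"
    have tL: "trig m \<in> cell_L2" by (intro continuous_cell_L2 continuous_intros)
    have e: "(\<integral>y. (u y - K) * trig m y \<partial>cell) = (\<integral>y. u y * trig m y \<partial>cell) - (\<integral>y. K * trig m y \<partial>cell)"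
      using L2_perD(3)[OF uL] tL by (simp add: left_diff_distrib cell_L2_mult_integrable cell_L2_integrable)
    show "(\<integral>y. (u y - K) * trig m y \<partial>cell) = 0"
    proof (cases "\<exists>j. m j \<noteq> 0")
      case True
      then obtain j where "m j \<noteq> 0" by blast
      then show ?thesis unfolding e using van[OF assms] van[OF is_weak_partial_const, of m j K] by simp
    next
      case False
      then have "m = (\<lambda>_. 0)" by auto
      then show ?thesis unfolding e using V by (simp add: trig_0 K_def V_def scaleR_conv_of_real)
    qed
  qed
  then have "AE y in lebesgue. u y - K = 0"
    by (rule AE_cell_imp_AE[where u="\<lambda>y. u y - K" and P="\<lambda>z. z = 0", rotated])
       (rule ae_periodic_comp2[OF L2_perD(2)[OF uL] L2_perD(2)[OF L2_per_const[of K]], where F="(-)"])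
  then show ?thesis by auto
qed

section \<open>The space of twice weakly differentiable functions\<close>

lemma H1_perD: "u \<in> H1_per \<Longrightarrow> is_weak_partial j u (weak_partial j u)"
  by (auto simp: H1_per_def intro: weak_partial_works)

lemma H1_perI: "(\<And>j. is_weak_partial j u (g j)) \<Longrightarrow> u \<in> H1_per"
  by (auto simp: H1_per_def is_weak_partial_def)

lemma H2_perD:
  assumes "u \<in> H2_per"
  shows "is_weak_partial j u (weak_partial j u)"
    and "is_weak_partial k (weak_partial j u) (weak_partial k (weak_partial j u))"
  using assms by (auto simp: H2_per_def intro: H1_perD)

text \<open>
  The tool for computing in \<open>H\<^sup>2\<close>: an explicit family of first and second weak derivatives shows membership and
  identifies the chosen derivatives almost everywhere.
\<close>

lemma H2_perI:
  assumes "\<And>j. is_weak_partial j u (g j)" "\<And>j k. is_weak_partial k (g j) (h k j)"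
  shows "u \<in> H2_per" and "AE y in cell. weak_partial j u y = g j y"
    and "AE y in cell. weak_partial k (weak_partial j u) y = h k j y"
proof -
  have 1: "AE y in cell. weak_partial j u y = g j y" for j
    using AE_cell[OF weak_partial_AE[OF assms(1)]] .
  have 2: "weak_partial j u \<in> L2_per" for j
    using weak_partial_works[OF assms(1)] by (simp add: is_weak_partial_def)
  have 3: "is_weak_partial k (weak_partial j u) (h k j)" for j k
    by (rule is_weak_partial_cong[OF assms(2) 2 1])
  show "u \<in> H2_per" unfolding H2_per_def using H1_perI[OF assms(1)] H1_perI[OF 3] by auto
  show "AE y in cell. weak_partial j u y = g j y" by (rule 1)
  show "AE y in cell. weak_partial k (weak_partial j u) y = h k j y"
    using AE_cell[OF weak_partial_AE[OF 3]] .
qed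

lemma H2_per_cell_L2 [simp, intro]:
  assumes "u \<in> H2_per"
  shows "u \<in> cell_L2" "weak_partial j u \<in> cell_L2" "weak_partial k (weak_partial j u) \<in> cell_L2"
  using H2_perD(1)[OF assms, of j] H2_perD(2)[OF assms, of k j]
  by (simp_all add: is_weak_partial_def L2_per_imp_cell_L2)

lemma H2_per_laplacian_cell_L2 [simp, intro]: "u \<in> H2_per \<Longrightarrow> weak_laplacian u \<in> cell_L2"
  unfolding weak_laplacian_def[abs_def] by auto

lemma H2_per_lincomb:
  assumes "u \<in> H2_per" "v \<in> H2_per"
  shows "(\<lambda>y. a * u y + b * v y) \<in> H2_per"
    and "AE y in cell. weak_partial j (\<lambda>y. a * u y + b * v y) y = a * weak_partial j u y + b * weak_partial j v y"
    and "AE y in cell. weak_partial k (weak_partial j (\<lambda>y. a * u y + b * v y)) y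
       = a * weak_partial k (weak_partial j u) y + b * weak_partial k (weak_partial j v) y"
  using H2_perI[of "\<lambda>y. a * u y + b * v y" "\<lambda>j y. a * weak_partial j u y + b * weak_partial j v y"
      "\<lambda>k j y. a * weak_partial k (weak_partial j u) y + b * weak_partial k (weak_partial j v) y",
      OF is_weak_partial_lincomb[OF H2_perD(1)[OF assms(1)] H2_perD(1)[OF assms(2)]]
      is_weak_partial_lincomb[OF H2_perD(2)[OF assms(1)] H2_perD(2)[OF assms(2)]]] .

lemma H2_per_cnj:
  assumes "u \<in> H2_per"
  shows "(\<lambda>y. cnj (u y)) \<in> H2_per"
    and "AE y in cell. weak_partial j (\<lambda>y. cnj (u y)) y = cnj (weak_partial j u y)"
    and "AE y in cell. weak_partial k (weak_partial j (\<lambda>y. cnj (u y))) y = cnj (weak_partial k (weak_partial j u) y)"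
  using H2_perI[of "\<lambda>y. cnj (u y)" "\<lambda>j y. cnj (weak_partial j u y)"
      "\<lambda>k j y. cnj (weak_partial k (weak_partial j u) y)",
      OF is_weak_partial_cnj[OF H2_perD(1)[OF assms]] is_weak_partial_cnj[OF H2_perD(2)[OF assms]]] .

lemma H2_per_const:
  shows "(\<lambda>_. c) \<in> H2_per"
    and "AE y in cell. weak_partial j (\<lambda>_. c) y = 0"
    and "AE y in cell. weak_partial k (weak_partial j (\<lambda>_. c)) y = 0"
  using H2_perI[of "\<lambda>_. c" "\<lambda>j _. 0" "\<lambda>k j _. 0", OF is_weak_partial_const is_weak_partial_const] .

lemma H2_per_diff: 
  assumes "u \<in> H2_per" "v \<in> H2_per" shows "(\<lambda>y. u y - v y) \<in> H2_per"
  using H2_per_lincomb(1)[OF assms, of 1 "-1"] by simp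

lemma H2_per_sum:
  assumes "\<And>i. i \<in> I \<Longrightarrow> f i \<in> H2_per" shows "(\<lambda>y. \<Sum>i\<in>I. k i * f i y) \<in> H2_per"
  using assms
proof (induction I rule: infinite_finite_induct)
  case (insert i I)
  then show ?case using H2_per_lincomb(1)[of "f i" "\<lambda>y. \<Sum>i\<in>I. k i * f i y" "k i" 1] by simp
qed (simp_all add: H2_per_const)

lemma weak_laplacian_AE:
  assumes "\<And>j. AE y in cell. weak_partial j (weak_partial j u) y = h j y"
  shows "AE y in cell. weak_laplacian u y = (\<Sum>j\<in>UNIV. h j y)"
proof -
  have "AE y in cell. \<forall>j\<in>UNIV. weak_partial j (weak_partial j u) y = h j y"
    by (rule AE_finite_allI) (use assms in auto)
  then show ?thesis by eventually_elim (simp add: weak_laplacian_def)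
qed

lemma H2_per_AE_const:
  assumes u: "u \<in> H2_per" and K: "AE y in cell. u y = K"
  shows "AE y in cell. weak_partial j u y = 0" "AE y in cell. weak_laplacian u y = 0"
proof -
  have L: "u \<in> L2_per" using H2_perD(1)[OF u, of undefined] by (simp add: is_weak_partial_def)
  have w: "is_weak_partial j u (\<lambda>_. 0)" for j
    by (rule is_weak_partial_cong[OF is_weak_partial_const[of _ K] L K])
  note H = H2_perI[of u "\<lambda>j _. 0" "\<lambda>k j _. 0", OF w is_weak_partial_const]
  show "AE y in cell. weak_partial j u y = 0" by (rule H(2))
  show "AE y in cell. weak_laplacian u y = 0"
    using weak_laplacian_AE[of u "\<lambda>_ _. 0", OF H(3)] by simp
qed

lemma integral_weak_partial_zero:
  assumes "u \<in> H2_per" shows "(\<integral>y. weak_partial j u y \<partial>cell) = 0" "(\<integral>y. weak_laplacian u y \<partial>cell) = 0"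
proof -
  have s: "smooth (\<lambda>_ :: real^'a. 1 :: complex)" and p: "periodic (\<lambda>_ :: real^'a. 1 :: complex)"
    and d: "partial_deriv j (\<lambda>_ :: real^'a. 1 :: complex) = (\<lambda>_. 0)" for j
  proof -
    have one: "(\<lambda>_ :: real^'a. 1 :: complex) = (\<lambda>y. 1 * trig (\<lambda>_. 0) y)" by (simp add: trig_0)
    show "smooth (\<lambda>_ :: real^'a. 1 :: complex)" unfolding one by (rule smooth_trig)
    show "periodic (\<lambda>_ :: real^'a. 1 :: complex)" by (simp add: periodic_def)
    show "partial_deriv j (\<lambda>_ :: real^'a. 1 :: complex) = (\<lambda>_. 0)" unfolding one partial_deriv_trig by simp
  qed
  have z: "(\<integral>y. g y \<partial>cell) = 0" if w: "is_weak_partial j w g" for j w and g :: "real^'a \<Rightarrow> complex"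
  proof -
    have "(\<integral>y. g y * 1 \<partial>cell) = - (\<integral>y. w y * partial_deriv j (\<lambda>_. 1) y \<partial>cell)"
      using w s p unfolding is_weak_partial_cell by blast
    then show ?thesis by (simp add: d)
  qed
  show "(\<integral>y. weak_partial j u y \<partial>cell) = 0" by (rule z[OF H2_perD(1)[OF assms]])
  have "(\<integral>y. weak_laplacian u y \<partial>cell) = (\<Sum>j\<in>UNIV. \<integral>y. weak_partial j (weak_partial j u) y \<partial>cell)"
    unfolding weak_laplacian_def by (rule Bochner_Integration.integral_sum) (use assms in auto)
  then show "(\<integral>y. weak_laplacian u y \<partial>cell) = 0" using z[OF H2_perD(2)[OF assms]] by simp
qed

lemma H2_norm_cell:
  "H2_norm u = sqrt ((L2_norm u)\<^sup>2 + (\<Sum>j\<in>UNIV. (L2_norm (weak_partial j u))\<^sup>2)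
     + (\<Sum>j\<in>UNIV. \<Sum>k\<in>UNIV. (L2_norm (weak_partial j (weak_partial k u)))\<^sup>2))"
  by (simp add: H2_norm_def cell_integral_eq L2_norm_def)

lemma H2_norm_nonneg [simp]: "0 \<le> H2_norm u"
  unfolding H2_norm_cell by (intro real_sqrt_ge_zero add_nonneg_nonneg sum_nonneg) auto

lemma L2_norm_le_H2_norm:
  shows "L2_norm u \<le> H2_norm u" and "L2_norm (weak_partial j u) \<le> H2_norm u"
    and "L2_norm (weak_partial j (weak_partial k u)) \<le> H2_norm u"
proof -
  have nn: "0 \<le> (\<Sum>j\<in>UNIV. (L2_norm (weak_partial j u))\<^sup>2)"
    "0 \<le> (\<Sum>j\<in>UNIV. \<Sum>k\<in>UNIV. (L2_norm (weak_partial j (weak_partial k u)))\<^sup>2)"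
    by (intro sum_nonneg zero_le_power2)+
  show "L2_norm u \<le> H2_norm u"
    unfolding H2_norm_cell using nn by (intro real_le_rsqrt) simp
  have "(L2_norm (weak_partial j u))\<^sup>2 \<le> (\<Sum>j\<in>UNIV. (L2_norm (weak_partial j u))\<^sup>2)"
    by (rule member_le_sum) auto
  then show "L2_norm (weak_partial j u) \<le> H2_norm u"
    unfolding H2_norm_cell using nn by (intro real_le_rsqrt) (simp add: add_increasing add_increasing2)
  have "(L2_norm (weak_partial j (weak_partial k u)))\<^sup>2 \<le> (\<Sum>k\<in>UNIV. (L2_norm (weak_partial j (weak_partial k u)))\<^sup>2)"
    by (rule member_le_sum) auto
  also have "\<dots> \<le> (\<Sum>j\<in>UNIV. \<Sum>k\<in>UNIV. (L2_norm (weak_partial j (weak_partial k u)))\<^sup>2)"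
    by (rule member_le_sum[of j UNIV "\<lambda>j. \<Sum>k\<in>UNIV. (L2_norm (weak_partial j (weak_partial k u)))\<^sup>2"]) (auto intro: sum_nonneg)
  finally show "L2_norm (weak_partial j (weak_partial k u)) \<le> H2_norm u"
    unfolding H2_norm_cell using nn by (intro real_le_rsqrt) (simp add: add_increasing)
qed

text \<open>
  The norm is the Euclidean norm of the vector \<open>T w\<close> of the \<open>L\<^sup>2\<close> norms of \<open>w\<close> and of its first and second derivatives,
  so the triangle inequality follows from those in \<open>L\<^sup>2\<close> and in a finite-dimensional Euclidean space.
\<close>

lemma H2_norm_lincomb:
  fixes u v :: "real^'n \<Rightarrow> complex"
  assumes "u \<in> H2_per" "v \<in> H2_per"
  shows "H2_norm (\<lambda>y. a * u y + b * v y) \<le> cmod a * H2_norm u + cmod b * H2_norm v"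
proof -
  define T :: "(real^'n \<Rightarrow> complex) \<Rightarrow> real \<times> (real^'n) \<times> (real^'n^'n)" where
    "T w = (L2_norm w, (\<chi> j. L2_norm (weak_partial j w)), (\<chi> j. \<chi> k. L2_norm (weak_partial j (weak_partial k w))))" for w
  have normT: "norm (p, q, r) = sqrt (p\<^sup>2 + (\<Sum>j\<in>UNIV. (q $ j)\<^sup>2) + (\<Sum>j\<in>UNIV. \<Sum>k\<in>UNIV. (r $ j $ k)\<^sup>2))"
    for p :: real and q :: "real^'n" and r :: "real^'n^'n"
    by (simp add: norm_Pair norm_vec_def L2_set_def sum_nonneg)
  have HT: "H2_norm w = norm (T w)" for w by (simp add: T_def normT H2_norm_cell)
  have L: "L2_norm w \<le> cmod a * L2_norm p + cmod b * L2_norm q"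
    if w: "AE y in cell. w y = a * p y + b * q y" and L2: "w \<in> cell_L2" "p \<in> cell_L2" "q \<in> cell_L2" for w p q :: "real^'n \<Rightarrow> complex"
  proof -
    have "L2_norm w = L2_norm (\<lambda>y. a * p y + b * q y)"
      by (rule L2_norm_cong_AE[OF w]) (use L2 in \<open>auto intro!: cell_L2D(1) cell_L2_add cell_L2_cmult\<close>)
    also have "\<dots> \<le> L2_norm (\<lambda>y. a * p y) + L2_norm (\<lambda>y. b * q y)"
      by (rule L2_norm_triangle) (use L2 in auto)
    finally show ?thesis by (simp add: L2_norm_cmult)
  qed
  let ?w = "\<lambda>y. a * u y + b * v y"
  note w = H2_per_lincomb[OF assms, where a=a and b=b]
  have "H2_norm ?w \<le> norm (cmod a *\<^sub>R T u + cmod b *\<^sub>R T v)"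
    unfolding H2_norm_cell T_def scaleR_Pair add_Pair normT
    by (intro real_sqrt_le_mono add_mono sum_mono power_mono)
       (auto intro!: L w H2_per_cell_L2 assms)
  also have "\<dots> \<le> norm (cmod a *\<^sub>R T u) + norm (cmod b *\<^sub>R T v)" by (rule norm_triangle_ineq)
  finally show ?thesis by (simp add: HT)
qed

lemma H2_norm_sum_le:
  assumes f: "\<And>i. i \<in> I \<Longrightarrow> f i \<in> H2_per" and "finite I"
  shows "H2_norm (\<lambda>y. \<Sum>i\<in>I. k i * f i y) \<le> (\<Sum>i\<in>I. cmod (k i) * H2_norm (f i))"
  using \<open>finite I\<close> f
proof (induction I rule: finite_induct)
  case (insert i I)
  then show ?case
    using H2_norm_lincomb[of "f i" "\<lambda>y. \<Sum>i\<in>I. k i * f i y" "k i" 1] H2_per_sum[of I f k] by simp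
next
  case empty
  then show ?case using H2_norm_lincomb[OF H2_per_const(1) H2_per_const(1), of 0 0 0 0] by simp
qed

text \<open>
  Bounded linear functionals. The elements of \<open>H\<^sup>2\<close> are functions modulo null sets and do not form a normed space as a
  type, so linearity and boundedness are required on the carrier.
\<close>

definition H2_functional :: "((real^'n \<Rightarrow> complex) \<Rightarrow> complex) \<Rightarrow> bool" where
  "H2_functional L \<longleftrightarrow>
     (\<forall>u\<in>H2_per. \<forall>v\<in>H2_per. \<forall>a b. L (\<lambda>y. a * u y + b * v y) = a * L u + b * L v) \<and>
     (\<exists>C. \<forall>u\<in>H2_per. cmod (L u) \<le> C * H2_norm u)"

lemma H2_functional_lincomb:
  "H2_functional L \<Longrightarrow> u \<in> H2_per \<Longrightarrow> v \<in> H2_per \<Longrightarrow> L (\<lambda>y. a * u y + b * v y) = a * L u + b * L v"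
  by (simp add: H2_functional_def)

lemma H2_functionalI:
  assumes "\<And>u v a b. u \<in> H2_per \<Longrightarrow> v \<in> H2_per \<Longrightarrow> L (\<lambda>y. a * u y + b * v y) = a * L u + b * L v"
    and "\<And>u. u \<in> H2_per \<Longrightarrow> cmod (L u) \<le> C * H2_norm u"
  shows "H2_functional L"
  unfolding H2_functional_def using assms by blast

lemma H2_functional_bound:
  assumes "H2_functional L" obtains C where "0 \<le> C" "\<And>u. u \<in> H2_per \<Longrightarrow> cmod (L u) \<le> C * H2_norm u"
proof -
  obtain C where C: "\<And>u. u \<in> H2_per \<Longrightarrow> cmod (L u) \<le> C * H2_norm u" using assms unfolding H2_functional_def by blast
  have "cmod (L u) \<le> max 0 C * H2_norm u" if "u \<in> H2_per" for u
    by (rule order_trans[OF C[OF that]]) (auto intro: mult_right_mono)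
  then show ?thesis using that[of "max 0 C"] by auto
qed

lemma H2_functional_sum_arg:
  assumes L: "H2_functional L" and f: "\<And>i. i \<in> I \<Longrightarrow> f i \<in> H2_per"
  shows "L (\<lambda>y. \<Sum>i\<in>I. k i * f i y) = (\<Sum>i\<in>I. k i * L (f i))"
  using f
proof (induction I rule: infinite_finite_induct)
  case (insert i I)
  then show ?case
    using H2_functional_lincomb[OF L, of "f i" "\<lambda>y. \<Sum>i\<in>I. k i * f i y" "k i" 1] H2_per_sum[of I f k] by simp
next
  case empty
  then show ?case using H2_functional_lincomb[OF L H2_per_const(1) H2_per_const(1), of 0 0 0 0] by simp
next
  case infinite
  then show ?case using H2_functional_lincomb[OF L H2_per_const(1) H2_per_const(1), of 0 0 0 0] by simp
qed

lemma H2_functional_pairing: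
  fixes P :: "(real^'n \<Rightarrow> complex) \<Rightarrow> real^'n \<Rightarrow> complex"
  assumes g: "g \<in> cell_L2" and P: "\<And>u. u \<in> H2_per \<Longrightarrow> P u \<in> cell_L2"
    and lin: "\<And>u v a b. u \<in> H2_per \<Longrightarrow> v \<in> H2_per \<Longrightarrow> AE y in cell. P (\<lambda>y. a * u y + b * v y) y = a * P u y + b * P v y"
    and bd: "\<And>u. u \<in> H2_per \<Longrightarrow> L2_norm (P u) \<le> H2_norm u"
  shows "H2_functional (\<lambda>u. \<integral>y. P u y * g y \<partial>cell)"
  unfolding H2_functional_def
proof (intro conjI ballI allI)
  fix u v :: "real^'n \<Rightarrow> complex" and a b assume uv: "u \<in> H2_per" "v \<in> H2_per"
  have [measurable]: "g \<in> borel_measurable cell" "P u \<in> borel_measurable cell" "P v \<in> borel_measurable cell"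
      "P (\<lambda>y. a * u y + b * v y) \<in> borel_measurable cell"
    using uv g by (auto intro!: cell_L2D P H2_per_lincomb)
  have "(\<integral>y. P (\<lambda>y. a * u y + b * v y) y * g y \<partial>cell) = (\<integral>y. a * (P u y * g y) + b * (P v y * g y) \<partial>cell)"
  proof (rule integral_cong_AE)
    show "AE y in cell. P (\<lambda>y. a * u y + b * v y) y * g y = a * (P u y * g y) + b * (P v y * g y)"
      using lin[OF uv, of a b] by eventually_elim (simp add: algebra_simps)
  qed measurable
  also have "\<dots> = a * (\<integral>y. P u y * g y \<partial>cell) + b * (\<integral>y. P v y * g y \<partial>cell)"
    using P[OF uv(1)] P[OF uv(2)] g by (simp add: cell_L2_mult_integrable)
  finally show "(\<integral>y. P (\<lambda>y. a * u y + b * v y) y * g y \<partial>cell) = a * (\<integral>y. P u y * g y \<partial>cell) + b * (\<integral>y. P v y * g y \<partial>cell)" .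
next
  have "cmod (\<integral>y. P u y * g y \<partial>cell) \<le> L2_norm g * H2_norm u" if "u \<in> H2_per" for u
    using cell_pairing_bound[OF P[OF that] g] mult_left_mono[OF bd[OF that], of "L2_norm g"] by simp
  then show "\<exists>C. \<forall>u\<in>H2_per. cmod (\<integral>y. P u y * g y \<partial>cell) \<le> C * H2_norm u" by blast
qed

lemma H2_functional_basic:
  assumes "g \<in> cell_L2"
  shows "H2_functional (\<lambda>u. \<integral>y. u y * g y \<partial>cell)"
    and "H2_functional (\<lambda>u. \<integral>y. weak_partial j u y * g y \<partial>cell)"
    and "H2_functional (\<lambda>u. \<integral>y. weak_partial k (weak_partial j u) y * g y \<partial>cell)"
  by (rule H2_functional_pairing[OF assms]; auto intro!: H2_per_lincomb L2_norm_le_H2_norm)+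

lemma H2_functional_add:
  assumes "H2_functional L" "H2_functional M" shows "H2_functional (\<lambda>u. L u + M u)"
proof -
  obtain C where C: "\<And>u. u \<in> H2_per \<Longrightarrow> cmod (L u) \<le> C * H2_norm u"
    using H2_functional_bound[OF assms(1)] by blast
  obtain D where D: "\<And>u. u \<in> H2_per \<Longrightarrow> cmod (M u) \<le> D * H2_norm u"
    using H2_functional_bound[OF assms(2)] by blast
  show ?thesis
  proof (rule H2_functionalI)
    show "cmod (L u + M u) \<le> (C + D) * H2_norm u" if "u \<in> H2_per" for u
      using C[OF that] D[OF that] norm_triangle_ineq[of "L u" "M u"] by (simp add: distrib_right)
  qed (simp add: assms[THEN H2_functional_lincomb] algebra_simps)
qed

lemma H2_functional_cmult:
  assumes "H2_functional L" shows "H2_functional (\<lambda>u. c * L u)"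
proof -
  obtain C where C: "\<And>u. u \<in> H2_per \<Longrightarrow> cmod (L u) \<le> C * H2_norm u"
    using H2_functional_bound[OF assms] by blast
  show ?thesis
  proof (rule H2_functionalI)
    show "cmod (c * L u) \<le> (cmod c * C) * H2_norm u" if "u \<in> H2_per" for u
      using C[OF that] by (simp add: norm_mult mult.assoc mult_left_mono)
  qed (simp add: assms[THEN H2_functional_lincomb] algebra_simps)
qed

lemma H2_functional_sum:
  "(\<And>i. i \<in> I \<Longrightarrow> H2_functional (L i)) \<Longrightarrow> H2_functional (\<lambda>u. \<Sum>i\<in>I. L i u)"
proof (induction I rule: infinite_finite_induct)
  case (insert i I) then show ?case by (simp add: H2_functional_add)
qed (auto simp: H2_functional_def intro!: exI[of _ 0])

lemma cell_integral_sum_mult: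
  assumes "\<And>i. i \<in> I \<Longrightarrow> f i \<in> cell_L2" "g \<in> cell_L2"
  shows "(\<integral>y. (\<Sum>i\<in>I. f i y) * g y \<partial>cell) = (\<Sum>i\<in>I. \<integral>y. f i y * g y \<partial>cell)"
  unfolding sum_distrib_right by (rule Bochner_Integration.integral_sum) (use assms in auto)

lemma H2_functional_cong:
  assumes "\<And>u. u \<in> H2_per \<Longrightarrow> L u = M u" "H2_functional M" shows "H2_functional L"
proof -
  obtain C where C: "\<And>u. u \<in> H2_per \<Longrightarrow> cmod (M u) \<le> C * H2_norm u"
    using H2_functional_bound[OF assms(2)] by blast
  show ?thesis
    by (rule H2_functionalI[of _ C])
       (simp_all add: assms(1) C H2_per_lincomb(1) H2_functional_lincomb[OF assms(2)])
qed

lemma H2_functional_laplacian: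
  assumes "g \<in> cell_L2" shows "H2_functional (\<lambda>u. \<integral>y. weak_laplacian u y * g y \<partial>cell)"
proof (rule H2_functional_cong)
  show "(\<integral>y. weak_laplacian u y * g y \<partial>cell) = (\<Sum>j\<in>UNIV. \<integral>y. weak_partial j (weak_partial j u) y * g y \<partial>cell)"
    if "u \<in> H2_per" for u unfolding weak_laplacian_def by (rule cell_integral_sum_mult) (use that assms in auto)
  show "H2_functional (\<lambda>u. \<Sum>j\<in>UNIV. \<integral>y. weak_partial j (weak_partial j u) y * g y \<partial>cell)"
    by (intro H2_functional_sum H2_functional_basic assms)
qed

text \<open>
  A bounded functional commutes with the limit of difference quotients that defines the partial derivative in \<open>H\<^sup>2\<close>.
\<close>

lemma H2_functional_has_vector_derivative:
  fixes \<Phi> :: "real^'n \<Rightarrow> real^'n \<Rightarrow> complex"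
  assumes L: "H2_functional L" and D: "has_H2_partial l \<Phi> \<eta> D" and H: "\<forall>\<^sub>F \<zeta> in nhds \<eta>. \<Phi> \<zeta> \<in> H2_per"
  shows "((\<lambda>t. L (\<Phi> (\<eta> + t *\<^sub>R axis l 1))) has_vector_derivative L D) (at 0)"
proof -
  let ?p = "\<lambda>t. \<Phi> (\<eta> + t *\<^sub>R axis l 1)"
  let ?q = "\<lambda>t y. (?p t y - \<Phi> \<eta> y) / complex_of_real t - D y"
  obtain C where C: "0 \<le> C" "\<And>u. u \<in> H2_per \<Longrightarrow> cmod (L u) \<le> C * H2_norm u" using H2_functional_bound[OF L] by blast
  have DH: "D \<in> H2_per" and lim: "((\<lambda>t. H2_norm (?q t)) \<longlongrightarrow> 0) (at 0)" using D by (auto simp: has_H2_partial_def)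
  have e0: "\<Phi> \<eta> \<in> H2_per" using H by (rule eventually_nhds_x_imp_x)
  have "((\<lambda>t. \<eta> + t *\<^sub>R axis l 1) \<longlongrightarrow> \<eta>) (at (0::real))" by (auto intro!: tendsto_eq_intros)
  then have eH: "\<forall>\<^sub>F t in at 0. ?p t \<in> H2_per" using H by (rule eventually_compose_filterlim[rotated])
  have "((\<lambda>h. norm (L (?p (0 + h)) - L (?p 0) - h *\<^sub>R L D) / norm h) \<longlongrightarrow> 0) (at 0)"
  proof (rule tendsto_sandwich[where f="\<lambda>_. 0" and h="\<lambda>t. C * H2_norm (?q t)"])
    show "((\<lambda>t. C * H2_norm (?q t)) \<longlongrightarrow> 0) (at 0)" using lim by (auto intro!: tendsto_eq_intros)
    have "norm (L (?p (0 + t)) - L (?p 0) - t *\<^sub>R L D) / norm t \<le> C * H2_norm (?q t)"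
      if p: "?p t \<in> H2_per" and t: "t \<noteq> 0" for t
    proof -
      have q1: "(\<lambda>y. 1 * ?p t y + (-1) * \<Phi> \<eta> y) \<in> H2_per" by (rule H2_per_lincomb[OF p e0])
      have q: "?q t = (\<lambda>y. (1 / complex_of_real t) * (1 * ?p t y + (-1) * \<Phi> \<eta> y) + (-1) * D y)" by auto
      have "L (?q t) = (1 / complex_of_real t) * L (\<lambda>y. 1 * ?p t y + (-1) * \<Phi> \<eta> y) + (-1) * L D"
        unfolding q by (rule H2_functional_lincomb[OF L q1 DH])
      also have "L (\<lambda>y. 1 * ?p t y + (-1) * \<Phi> \<eta> y) = 1 * L (?p t) + (-1) * L (\<Phi> \<eta>)"
        by (rule H2_functional_lincomb[OF L p e0])
      finally have "L (?p t) - L (\<Phi> \<eta>) - t *\<^sub>R L D = complex_of_real t * L (?q t)"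
        using t by (simp add: scaleR_conv_of_real field_simps)
      then have "norm (L (?p (0 + t)) - L (?p 0) - t *\<^sub>R L D) / norm t = cmod (L (?q t))"
        using t by (simp add: norm_mult)
      also have "\<dots> \<le> C * H2_norm (?q t)"
        by (rule C(2)) (unfold q, rule H2_per_lincomb[OF q1 DH])
      finally show ?thesis .
    qed
    then show "\<forall>\<^sub>F t in at 0. norm (L (?p (0 + t)) - L (?p 0) - t *\<^sub>R L D) / norm t \<le> C * H2_norm (?q t)"
      using eH eventually_neq_at_within[of "0::real" 0 UNIV] by (auto elim: eventually_elim2)
  qed auto
  then show ?thesis unfolding has_vector_derivative_def has_derivative_at
    by (auto intro: bounded_linear_scaleR_left)
qed

section \<open>Analytic families\<close>

definition multi_monomial :: "('n::finite \<Rightarrow> nat) \<Rightarrow> real^'n \<Rightarrow> real" where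
  "multi_monomial \<alpha> \<eta> = (\<Prod>i\<in>UNIV. (\<eta> $ i) ^ \<alpha> i)"

definition multi_degree :: "('n::finite \<Rightarrow> nat) \<Rightarrow> nat" where
  "multi_degree \<alpha> = (\<Sum>i\<in>UNIV. \<alpha> i)"

text \<open>
  The partial derivative of a monomial; for \<open>\<alpha> j = 0\<close> the truncated exponent is harmless because of the factor
  \<open>\<alpha> j\<close>.
\<close>

definition monomial_partial :: "'n::finite \<Rightarrow> ('n \<Rightarrow> nat) \<Rightarrow> real^'n \<Rightarrow> real" where
  "monomial_partial j \<alpha> \<eta> = real (\<alpha> j) * (\<eta> $ j) ^ (\<alpha> j - 1) * (\<Prod>i\<in>UNIV - {j}. (\<eta> $ i) ^ \<alpha> i)"

definition sup_box :: "real \<Rightarrow> (real^'n) set" where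
  "sup_box s = {\<eta>. \<forall>i. \<bar>\<eta> $ i\<bar> < s}"

lemma sup_box_eq: "sup_box s = box (\<chi> i. - s) (\<chi> i. s)"
  by (auto simp: sup_box_def mem_box_cart abs_less_iff) (metis minus_less_iff)+

lemma open_sup_box [simp]: "open (sup_box s)" and convex_sup_box [simp]: "convex (sup_box s)"
  by (auto simp: sup_box_eq)

lemma zero_in_sup_box [simp]: "0 < s \<Longrightarrow> 0 \<in> sup_box s"
  by (simp add: sup_box_def)

lemma has_derivative_monomial:
  "(multi_monomial \<alpha> has_derivative (\<lambda>h. \<Sum>j\<in>UNIV. h $ j * monomial_partial j \<alpha> \<eta>)) (at \<eta>)"
proof -
  have "((\<lambda>\<eta>. \<Prod>i\<in>UNIV. (\<eta> $ i) ^ \<alpha> i) has_derivative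
     (\<lambda>h. \<Sum>j\<in>UNIV. (of_nat (\<alpha> j) * (h $ j) * (\<eta> $ j) ^ (\<alpha> j - 1)) * (\<Prod>i\<in>UNIV - {j}. (\<eta> $ i) ^ \<alpha> i))) (at \<eta>)"
    by (intro has_derivative_prod has_derivative_power bounded_linear.has_derivative[OF bounded_linear_vec_nth]
          has_derivative_ident)
  then show ?thesis
    unfolding multi_monomial_def[abs_def] monomial_partial_def by (simp add: mult_ac)
qed

text \<open>
  Halving the radius pays for the factor \<open>\<alpha>\<^sub>j\<close> that differentiation produces, since \<open>n \<le> 2\<^sup>n\<^sup>-\<^sup>1\<close>.
\<close>

lemma monomial_partial_bound:
  assumes r: "0 < r" and \<eta>: "\<eta> \<in> sup_box (r/2)"
  shows "\<bar>monomial_partial j \<alpha> \<eta>\<bar> \<le> r ^ multi_degree \<alpha> / r"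
proof -
  have b: "\<bar>\<eta> $ i\<bar> \<le> r/2" "\<bar>\<eta> $ i\<bar> \<le> r" for i
  proof -
    have "\<bar>\<eta> $ i\<bar> < r/2" using \<eta> unfolding sup_box_def by blast
    then show "\<bar>\<eta> $ i\<bar> \<le> r/2" "\<bar>\<eta> $ i\<bar> \<le> r" using r by linarith+
  qed
  have n2: "real n * (r/2) ^ (n - 1) \<le> r ^ n / r" for n
  proof (cases n)
    case (Suc k)
    have "real (Suc k) \<le> 2 ^ k" by (induction k) auto
    then have "real n * (r/2) ^ k \<le> 2 ^ k * (r/2)^k" using Suc r by (intro mult_right_mono) auto
    also have "\<dots> = r ^ k" by (simp add: power_divide)
    finally show ?thesis using Suc r by simp
  qed (use r in simp)
  have "\<bar>monomial_partial j \<alpha> \<eta>\<bar> = real (\<alpha> j) * \<bar>\<eta> $ j\<bar> ^ (\<alpha> j - 1) * (\<Prod>i\<in>UNIV - {j}. \<bar>\<eta> $ i\<bar> ^ \<alpha> i)"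
    by (simp add: monomial_partial_def abs_mult power_abs abs_prod)
  also have "\<dots> \<le> real (\<alpha> j) * (r/2) ^ (\<alpha> j - 1) * (\<Prod>i\<in>UNIV - {j}. r ^ \<alpha> i)"
    using b r by (intro mult_mono prod_mono power_mono conjI prod_nonneg mult_nonneg_nonneg) auto
  also have "\<dots> \<le> (r ^ \<alpha> j / r) * (\<Prod>i\<in>UNIV - {j}. r ^ \<alpha> i)"
    using n2 r by (intro mult_right_mono prod_nonneg) auto
  also have "\<dots> = (\<Prod>i\<in>UNIV. r ^ \<alpha> i) / r"
    by (simp add: prod.remove[of UNIV j])
  also have "(\<Prod>i\<in>UNIV. r ^ \<alpha> i) = r ^ multi_degree \<alpha>" by (simp add: multi_degree_def power_sum)
  finally show ?thesis .
qed

lemma continuous_monomial_partial: "continuous_on S (monomial_partial j \<alpha>)"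
  unfolding monomial_partial_def[abs_def] by (intro continuous_intros)

definition has_C1_partials :: "(real^'n \<Rightarrow> complex) \<Rightarrow> ('n \<Rightarrow> real^'n \<Rightarrow> complex) \<Rightarrow> (real^'n) set \<Rightarrow> bool" where
  "has_C1_partials F G S \<longleftrightarrow>
     (\<forall>\<eta>\<in>S. (F has_derivative (\<lambda>h. \<Sum>j\<in>UNIV. h $ j *\<^sub>R G j \<eta>)) (at \<eta>)) \<and> (\<forall>j. continuous_on S (G j))"

text \<open>
  The multi-indices are countable, so the series becomes an ordinary one. The bound on differentiated monomials and
  the Weierstrass test make the differentiated series converge uniformly, which justifies termwise
  differentiation and gives continuity of the derivative.
\<close>

lemma multi_power_series_C1:
  fixes a :: "('n::finite \<Rightarrow> nat) \<Rightarrow> complex" and F :: "real^'n \<Rightarrow> complex"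
  assumes r: "0 < r"
    and sm: "(\<lambda>\<alpha>. cmod (a \<alpha>) * r ^ multi_degree \<alpha>) summable_on UNIV"
    and F: "\<And>\<eta>. \<eta> \<in> sup_box (r/2) \<Longrightarrow> ((\<lambda>\<alpha>. complex_of_real (multi_monomial \<alpha> \<eta>) * a \<alpha>) has_sum F \<eta>) UNIV"
  shows "\<exists>G. has_C1_partials F G (sup_box (r/2))"
proof -
  let ?S = "sup_box (r/2) :: (real^'n) set"
  have "infinite (UNIV :: ('n \<Rightarrow> nat) set)"
  proof
    assume "finite (UNIV :: ('n \<Rightarrow> nat) set)"
    then have "finite (range (\<lambda>k::nat. (\<lambda>_::'n. k)))" by (rule finite_subset[rotated]) auto
    moreover have "inj (\<lambda>k::nat. (\<lambda>_::'n. k))" by (auto simp: inj_on_def fun_eq_iff)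
    ultimately show False using finite_imageD infinite_UNIV_nat by blast
  qed
  then obtain e :: "nat \<Rightarrow> ('n \<Rightarrow> nat)" where e: "bij e"
    using bij_betw_from_nat_into[of "UNIV :: ('n \<Rightarrow> nat) set"] by auto
  define M where "M n = cmod (a (e n)) * r ^ multi_degree (e n) / r" for n
  have "((\<lambda>\<alpha>. cmod (a \<alpha>) * r ^ multi_degree \<alpha>) \<circ> e) summable_on UNIV"
    using summable_on_reindex_bij_betw[OF e, of "\<lambda>\<alpha>. cmod (a \<alpha>) * r ^ multi_degree \<alpha>"] sm by (simp add: o_def)
  then have "summable (\<lambda>n. cmod (a (e n)) * r ^ multi_degree (e n))"
    by (simp add: o_def summable_on_imp_summable)
  then have Ms: "summable M" unfolding M_def by (rule summable_divide)
  define g where "g j n \<eta> = complex_of_real (monomial_partial j (e n) \<eta>) * a (e n)" for j n \<eta>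
  have gM: "norm (g j n \<eta>) \<le> M n" if "\<eta> \<in> ?S" for j n \<eta>
  proof -
    have "cmod (g j n \<eta>) = \<bar>monomial_partial j (e n) \<eta>\<bar> * cmod (a (e n))" by (simp add: g_def norm_mult)
    also have "\<dots> \<le> (r ^ multi_degree (e n) / r) * cmod (a (e n))"
      by (intro mult_right_mono monomial_partial_bound r that) auto
    finally show ?thesis by (simp add: M_def mult_ac)
  qed
  define G where "G j \<eta> = suminf (\<lambda>n. g j n \<eta>)" for j \<eta>
  have ul: "uniform_limit ?S (\<lambda>n \<eta>. \<Sum>i<n. g j i \<eta>) (G j) sequentially" for j
    unfolding G_def by (rule Weierstrass_m_test[OF gM Ms])
  have Gc: "continuous_on ?S (G j)" for j
    by (rule uniform_limit_theorem[OF _ ul])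
       (auto simp: g_def intro!: always_eventually continuous_intros continuous_monomial_partial)
  have Fs: "(\<lambda>n. complex_of_real (multi_monomial (e n) \<eta>) * a (e n)) sums F \<eta>" if "\<eta> \<in> ?S" for \<eta>
  proof -
    have "((\<lambda>n. complex_of_real (multi_monomial (e n) \<eta>) * a (e n)) has_sum F \<eta>) UNIV"
      using has_sum_reindex_bij_betw[OF e, of "\<lambda>\<alpha>. complex_of_real (multi_monomial \<alpha> \<eta>) * a \<alpha>" "F \<eta>"] F[OF that] by simp
    then show ?thesis by (rule has_sum_imp_sums)
  qed
  have "\<exists>H. \<forall>\<eta>\<in>?S. (\<lambda>n. complex_of_real (multi_monomial (e n) \<eta>) * a (e n)) sums H \<eta>
       \<and> (H has_derivative (\<lambda>h. \<Sum>j\<in>UNIV. h $ j *\<^sub>R G j \<eta>)) (at \<eta> within ?S)"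
  proof (rule has_derivative_series[where f'="\<lambda>n \<eta> h. \<Sum>j\<in>UNIV. h $ j *\<^sub>R g j n \<eta>" and x=0])
    fix n \<eta> assume "\<eta> \<in> ?S"
    have "((\<lambda>\<eta>. complex_of_real (multi_monomial (e n) \<eta>) * a (e n)) has_derivative
        (\<lambda>h. complex_of_real (\<Sum>j\<in>UNIV. h $ j * monomial_partial j (e n) \<eta>) * a (e n))) (at \<eta> within ?S)"
      by (rule has_derivative_mult_left[OF has_derivative_of_real[OF has_derivative_at_withinI[OF has_derivative_monomial]]])
    then show "((\<lambda>\<eta>. complex_of_real (multi_monomial (e n) \<eta>) * a (e n)) has_derivative
        (\<lambda>h. \<Sum>j\<in>UNIV. h $ j *\<^sub>R g j n \<eta>)) (at \<eta> within ?S)"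
      by (simp add: g_def scaleR_conv_of_real sum_distrib_right mult.assoc)
  next
    fix \<epsilon> :: real assume "\<epsilon> > 0"
    define d where "d = \<epsilon> / real CARD('n)"
    have "d > 0" using \<open>\<epsilon> > 0\<close> by (simp add: d_def)
    have "\<forall>\<^sub>F n in sequentially. \<forall>j. \<forall>\<eta>\<in>?S. dist (\<Sum>i<n. g j i \<eta>) (G j \<eta>) < d"
      using ul \<open>d > 0\<close> by (auto simp: uniform_limit_iff intro!: eventually_all_finite)
    then show "\<forall>\<^sub>F n in sequentially. \<forall>\<eta>\<in>?S. \<forall>h. norm ((\<Sum>i<n. \<Sum>j\<in>UNIV. h $ j *\<^sub>R g j i \<eta>) - (\<Sum>j\<in>UNIV. h $ j *\<^sub>R G j \<eta>)) \<le> \<epsilon> * norm h"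
    proof (rule eventually_mono, intro ballI allI)
      fix n \<eta> and h :: "real^'n"
      assume H: "\<forall>j. \<forall>\<eta>\<in>?S. dist (\<Sum>i<n. g j i \<eta>) (G j \<eta>) < d" and \<eta>: "\<eta> \<in> ?S"
      have "(\<Sum>i<n. \<Sum>j\<in>UNIV. h $ j *\<^sub>R g j i \<eta>) - (\<Sum>j\<in>UNIV. h $ j *\<^sub>R G j \<eta>)
         = (\<Sum>j\<in>UNIV. h $ j *\<^sub>R ((\<Sum>i<n. g j i \<eta>) - G j \<eta>))"
        by (subst sum.swap) (simp add: scaleR_diff_right scaleR_sum_right sum_subtractf)
      also have "norm \<dots> \<le> (\<Sum>j\<in>(UNIV :: 'n set). norm h * d)"
      proof (rule sum_norm_le)
        fix j
        have "norm ((\<Sum>i<n. g j i \<eta>) - G j \<eta>) \<le> d" using H \<eta> by (auto simp: dist_norm less_imp_le)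
        then show "norm (h $ j *\<^sub>R ((\<Sum>i<n. g j i \<eta>) - G j \<eta>)) \<le> norm h * d"
          using component_le_norm_cart[of h j] \<open>d > 0\<close> by (simp add: mult_mono)
      qed
      also have "\<dots> = \<epsilon> * norm h" by (simp add: d_def)
      finally show "norm ((\<Sum>i<n. \<Sum>j\<in>UNIV. h $ j *\<^sub>R g j i \<eta>) - (\<Sum>j\<in>UNIV. h $ j *\<^sub>R G j \<eta>)) \<le> \<epsilon> * norm h" .
    qed
  next
    show "(\<lambda>n. complex_of_real (multi_monomial (e n) 0) * a (e n)) sums F 0" by (rule Fs) (use r in simp)
  qed (use r in auto)
  then obtain H where H: "\<And>\<eta>. \<eta> \<in> ?S \<Longrightarrow> (\<lambda>n. complex_of_real (multi_monomial (e n) \<eta>) * a (e n)) sums H \<eta>"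
    "\<And>\<eta>. \<eta> \<in> ?S \<Longrightarrow> (H has_derivative (\<lambda>h. \<Sum>j\<in>UNIV. h $ j *\<^sub>R G j \<eta>)) (at \<eta> within ?S)" by blast
  have HF: "H \<eta> = F \<eta>" if "\<eta> \<in> ?S" for \<eta> using sums_unique2[OF H(1)[OF that] Fs[OF that]] .
  have "(F has_derivative (\<lambda>h. \<Sum>j\<in>UNIV. h $ j *\<^sub>R G j \<eta>)) (at \<eta>)" if "\<eta> \<in> ?S" for \<eta>
  proof -
    have "(F has_derivative (\<lambda>h. \<Sum>j\<in>UNIV. h $ j *\<^sub>R G j \<eta>)) (at \<eta> within ?S)"
      using has_derivative_transform[OF that _ H(2)[OF that], of F] HF by simp
    then show ?thesis using at_within_open[OF that open_sup_box] by simp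
  qed
  then show ?thesis using Gc unfolding has_C1_partials_def by blast
qed

definition has_H2_power_series ::
  "(real^'n \<Rightarrow> real^'n \<Rightarrow> complex) \<Rightarrow> real \<Rightarrow> (('n \<Rightarrow> nat) \<Rightarrow> real^'n \<Rightarrow> complex) \<Rightarrow> bool" where
  "has_H2_power_series \<Phi> r c \<longleftrightarrow> 0 < r \<and> (\<forall>\<alpha>. c \<alpha> \<in> H2_per) \<and>
     (\<lambda>\<alpha>. H2_norm (c \<alpha>) * r ^ multi_degree \<alpha>) summable_on UNIV \<and>
     (\<forall>\<eta>\<in>sup_box r. \<Phi> \<eta> \<in> H2_per \<and>
        ((\<lambda>F. H2_norm (\<lambda>y. \<Phi> \<eta> y - (\<Sum>\<alpha>\<in>F. complex_of_real (multi_monomial \<alpha> \<eta>) * c \<alpha> y)))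
           \<longlongrightarrow> 0) (finite_subsets_at_top UNIV))"

lemma H2_analytic_at_0_iff: "H2_analytic_at \<Phi> 0 \<longleftrightarrow> (\<exists>r c. has_H2_power_series \<Phi> r c)"
  by (auto simp: H2_analytic_at_def has_H2_power_series_def multi_degree_def multi_monomial_def sup_box_def)

lemma has_H2_power_seriesD:
  assumes "has_H2_power_series \<Phi> r c"
  shows "0 < r" "c \<alpha> \<in> H2_per" "(\<lambda>\<alpha>. H2_norm (c \<alpha>) * r ^ multi_degree \<alpha>) summable_on UNIV"
    and "\<eta> \<in> sup_box r \<Longrightarrow> \<Phi> \<eta> \<in> H2_per"
    and "\<eta> \<in> sup_box r \<Longrightarrow>
      ((\<lambda>F. H2_norm (\<lambda>y. \<Phi> \<eta> y - (\<Sum>\<alpha>\<in>F. complex_of_real (multi_monomial \<alpha> \<eta>) * c \<alpha> y)))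
         \<longlongrightarrow> 0) (finite_subsets_at_top UNIV)"
  using assms by (auto simp: has_H2_power_series_def)

text \<open>
  Boundedness of \<open>L\<close> turns the \<open>H\<^sup>2\<close>-convergent expansion of \<open>\<Phi>\<close> into the scalar power series with coefficients
  \<open>L (c \<alpha>)\<close>, on a radius that does not depend on \<open>L\<close>.
\<close>

lemma H2_analytic_functional_C1:
  fixes \<Phi> :: "real^'n \<Rightarrow> real^'n \<Rightarrow> complex"
  assumes "H2_analytic_at \<Phi> 0"
  shows "\<exists>s>0. \<forall>L. H2_functional L \<longrightarrow> (\<exists>G. has_C1_partials (\<lambda>\<eta>. L (\<Phi> \<eta>)) G (sup_box s))"
proof -
  obtain r c where series: "has_H2_power_series \<Phi> r c" using assms unfolding H2_analytic_at_0_iff by blast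
  note r = has_H2_power_seriesD(1)[OF series] and c = has_H2_power_seriesD(2)[OF series]
    and sm = has_H2_power_seriesD(3)[OF series] and PH = has_H2_power_seriesD(4)[OF series]
    and lim = has_H2_power_seriesD(5)[OF series]
  have sub: "\<eta> \<in> sup_box (r/2) \<Longrightarrow> \<eta> \<in> sup_box r" for \<eta> :: "real^'n"
  proof -
    assume "\<eta> \<in> sup_box (r/2)"
    then have half: "\<bar>\<eta> $ i\<bar> < r/2" for i unfolding sup_box_def by blast
    have "\<bar>\<eta> $ i\<bar> < r" for i using r half[of i] by linarith
    then show "\<eta> \<in> sup_box r" unfolding sup_box_def by blast
  qed
  show ?thesis
  proof (intro exI[of _ "r/2"] conjI allI impI)
    fix L :: "(real^'n \<Rightarrow> complex) \<Rightarrow> complex" assume L: "H2_functional L"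
    obtain C where C: "0 \<le> C" "\<And>u. u \<in> H2_per \<Longrightarrow> cmod (L u) \<le> C * H2_norm u" using H2_functional_bound[OF L] by blast
    show "\<exists>G. has_C1_partials (\<lambda>\<eta>. L (\<Phi> \<eta>)) G (sup_box (r/2))"
    proof (rule multi_power_series_C1[OF r, where a="\<lambda>\<alpha>. L (c \<alpha>)"])
      have "(\<lambda>\<alpha>. C * (H2_norm (c \<alpha>) * r ^ multi_degree \<alpha>)) summable_on UNIV"
        by (intro summable_on_cmult_right sm)
      then show "(\<lambda>\<alpha>. cmod (L (c \<alpha>)) * r ^ multi_degree \<alpha>) summable_on UNIV"
        by (rule summable_on_comparison_test)
           (use C(2)[OF c] r in \<open>auto simp: mult.assoc[symmetric] intro!: mult_right_mono\<close>)
      fix \<eta> :: "real^'n" assume "\<eta> \<in> sup_box (r/2)"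
      then have \<eta>: "\<eta> \<in> sup_box r" by (rule sub)
      let ?S = "\<lambda>F y. \<Sum>\<alpha>\<in>F. complex_of_real (multi_monomial \<alpha> \<eta>) * c \<alpha> y"
      have "((\<lambda>F. L (\<lambda>y. \<Phi> \<eta> y - ?S F y)) \<longlongrightarrow> 0) (finite_subsets_at_top UNIV)"
      proof (rule Lim_null_comparison)
        show "((\<lambda>F. C * H2_norm (\<lambda>y. \<Phi> \<eta> y - ?S F y)) \<longlongrightarrow> 0) (finite_subsets_at_top UNIV)"
          using tendsto_mult_left[OF lim[OF \<eta>], of C] by simp
        show "\<forall>\<^sub>F F in finite_subsets_at_top UNIV. norm (L (\<lambda>y. \<Phi> \<eta> y - ?S F y)) \<le> C * H2_norm (\<lambda>y. \<Phi> \<eta> y - ?S F y)"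
          by (intro always_eventually allI C(2) H2_per_diff PH \<eta> H2_per_sum c)
      qed
      moreover have "L (\<lambda>y. \<Phi> \<eta> y - ?S F y) = L (\<Phi> \<eta>) - (\<Sum>\<alpha>\<in>F. complex_of_real (multi_monomial \<alpha> \<eta>) * L (c \<alpha>))" for F
        using H2_functional_lincomb[OF L PH[OF \<eta>], of "?S F" 1 "-1"]
          H2_per_sum[of F c "\<lambda>\<alpha>. complex_of_real (multi_monomial \<alpha> \<eta>)"]
          H2_functional_sum_arg[OF L, of F c "\<lambda>\<alpha>. complex_of_real (multi_monomial \<alpha> \<eta>)"] c by simp
      ultimately have "((\<lambda>F. L (\<Phi> \<eta>) - (\<Sum>\<alpha>\<in>F. complex_of_real (multi_monomial \<alpha> \<eta>) * L (c \<alpha>))) \<longlongrightarrow> 0) (finite_subsets_at_top UNIV)"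
        by simp
      from tendsto_diff[OF tendsto_const[of "L (\<Phi> \<eta>)"] this]
      show "((\<lambda>\<alpha>. complex_of_real (multi_monomial \<alpha> \<eta>) * L (c \<alpha>)) has_sum L (\<Phi> \<eta>)) UNIV"
        by (simp add: has_sum_def)
    qed
  qed (use r in auto)
qed

text \<open>
  On the axis \<open>\<eta> = t e\<^sub>l\<close> only the multi-indices supported at \<open>l\<close> survive. The derivative is the coefficient of index
  \<open>e\<^sub>l\<close>; the terms of degree at least two add up to \<open>O(t\<^sup>2)\<close> in norm.
\<close>

lemma H2_analytic_has_H2_partial:
  fixes \<Phi> :: "real^'n \<Rightarrow> real^'n \<Rightarrow> complex"
  assumes "H2_analytic_at \<Phi> 0"
  shows "\<exists>D. has_H2_partial l \<Phi> 0 D"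
proof -
  obtain r c where series: "has_H2_power_series \<Phi> r c" using assms unfolding H2_analytic_at_0_iff by blast
  note r = has_H2_power_seriesD(1)[OF series] and c = has_H2_power_seriesD(2)[OF series]
    and sm = has_H2_power_seriesD(3)[OF series] and PH = has_H2_power_seriesD(4)[OF series]
    and lim = has_H2_power_seriesD(5)[OF series]
  define z where "z = (\<lambda>_::'n. 0::nat)"
  define e where "e = (\<lambda>i::'n. if i = l then 1 else 0 :: nat)"
  have ze: "z \<noteq> e" by (auto simp: z_def e_def fun_eq_iff)
  define S where "S = infsum (\<lambda>\<alpha>. H2_norm (c \<alpha>) * r ^ multi_degree \<alpha>) UNIV"
  have mono_z: "multi_monomial z \<eta> = 1" for \<eta> by (simp add: multi_monomial_def z_def)
  have mono_e: "multi_monomial e (t *\<^sub>R axis l 1) = t" for t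
    by (simp add: multi_monomial_def e_def if_distrib[of "\<lambda>k. _ ^ k"] prod.delta cong: if_cong)
  have mono_bound: "\<bar>multi_monomial \<alpha> (t *\<^sub>R axis l 1)\<bar> \<le> t\<^sup>2 / r\<^sup>2 * r ^ multi_degree \<alpha>"
    if t: "\<bar>t\<bar> < r" and \<alpha>: "\<alpha> \<noteq> z" "\<alpha> \<noteq> e" for \<alpha> t
  proof (cases "\<exists>i. i \<noteq> l \<and> \<alpha> i \<noteq> 0")
    case True
    then obtain i where i: "i \<noteq> l" "\<alpha> i \<noteq> 0" by blast
    have "multi_monomial \<alpha> (t *\<^sub>R axis l 1) = 0"
      unfolding multi_monomial_def by (rule prod_zero) (use i in \<open>auto intro!: bexI[of _ i] simp: axis_def\<close>)
    then show ?thesis using r by simp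
  next
    case False
    then have a0: "\<alpha> i = 0" if "i \<noteq> l" for i using that by blast
    have "\<alpha> l \<noteq> 0" using \<alpha>(1) a0 by (metis z_def ext)
    moreover have "\<alpha> l \<noteq> 1"
    proof
      assume "\<alpha> l = 1"
      then have "\<alpha> = e" by (auto simp: e_def fun_eq_iff a0)
      then show False using \<alpha>(2) by simp
    qed
    ultimately obtain k where k: "\<alpha> l = k + 2" by (metis One_nat_def Suc_pred add_2_eq_Suc' neq0_conv)
    have "multi_monomial \<alpha> (t *\<^sub>R axis l 1) = t ^ \<alpha> l"
      unfolding multi_monomial_def by (subst prod.remove[of UNIV l]) (auto simp: a0 intro!: prod.neutral)
    moreover have "multi_degree \<alpha> = \<alpha> l"
      unfolding multi_degree_def by (subst sum.remove[of UNIV l]) (auto simp: a0)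
    moreover have "\<bar>t ^ (k + 2)\<bar> \<le> t\<^sup>2 / r\<^sup>2 * r ^ (k + 2)"
    proof -
      have "\<bar>t\<bar> ^ k \<le> r ^ k" using t by (intro power_mono) auto
      then have "\<bar>t\<bar> ^ k * t\<^sup>2 \<le> r ^ k * t\<^sup>2" by (intro mult_right_mono) auto
      then show ?thesis using r by (simp add: power_add power_abs[symmetric] abs_mult power2_eq_square mult_ac)
    qed
    ultimately show ?thesis using k by simp
  qed
  have key: "H2_norm (\<lambda>y. \<Phi> (t *\<^sub>R axis l 1) y - (c z y + complex_of_real t * c e y)) \<le> t\<^sup>2 / r\<^sup>2 * S"
    if t: "\<bar>t\<bar> < r" for t
  proof -
    let ?\<eta> = "t *\<^sub>R axis l 1 :: real^'n"
    have \<eta>: "?\<eta> \<in> sup_box r" using t r by (auto simp: sup_box_def axis_def)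
    let ?k = "\<lambda>\<alpha>. complex_of_real (multi_monomial \<alpha> ?\<eta>)"
    let ?u = "\<lambda>y. \<Phi> ?\<eta> y - (c z y + complex_of_real t * c e y)"
    let ?E = "\<lambda>F. H2_norm (\<lambda>y. \<Phi> ?\<eta> y - (\<Sum>\<alpha>\<in>F. ?k \<alpha> * c \<alpha> y))"
    have "\<forall>\<^sub>F F in finite_subsets_at_top UNIV. finite F \<and> {z, e} \<subseteq> F"
      using eventually_finite_subsets_at_top_weakI[of "UNIV :: ('n \<Rightarrow> nat) set"]
      by (auto simp: eventually_finite_subsets_at_top intro!: exI[of _ "{z, e}"])
    then have "\<forall>\<^sub>F F in finite_subsets_at_top UNIV. H2_norm ?u \<le> ?E F + t\<^sup>2 / r\<^sup>2 * S"
    proof (rule eventually_mono)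
      fix F assume F: "finite F \<and> {z, e} \<subseteq> F"
      define w where "w = (\<lambda>y. \<Sum>\<alpha>\<in>F - {z, e}. ?k \<alpha> * c \<alpha> y)"
      have sumF: "(\<Sum>\<alpha>\<in>F. ?k \<alpha> * c \<alpha> y) = c z y + complex_of_real t * c e y + w y" for y
      proof -
        have "(\<Sum>\<alpha>\<in>F. ?k \<alpha> * c \<alpha> y) = (\<Sum>\<alpha>\<in>{z, e}. ?k \<alpha> * c \<alpha> y) + w y"
          unfolding w_def using F sum.subset_diff[of "{z, e}" F "\<lambda>\<alpha>. ?k \<alpha> * c \<alpha> y"] by (simp add: add.commute)
        then show ?thesis using ze by (simp add: mono_z mono_e)
      qed
      have wH: "w \<in> H2_per" unfolding w_def by (intro H2_per_sum c)
      have vH: "(\<lambda>y. \<Phi> ?\<eta> y - (\<Sum>\<alpha>\<in>F. ?k \<alpha> * c \<alpha> y)) \<in> H2_per" by (intro H2_per_diff PH \<eta> H2_per_sum c)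
      have "?u = (\<lambda>y. 1 * (\<Phi> ?\<eta> y - (\<Sum>\<alpha>\<in>F. ?k \<alpha> * c \<alpha> y)) + 1 * w y)" by (auto simp: sumF)
      then have "H2_norm ?u \<le> ?E F + H2_norm w" using H2_norm_lincomb[OF vH wH, of 1 1] by simp
      also have "H2_norm w \<le> (\<Sum>\<alpha>\<in>F - {z, e}. cmod (?k \<alpha>) * H2_norm (c \<alpha>))"
        unfolding w_def by (rule H2_norm_sum_le) (use c F in auto)
      also have "\<dots> \<le> (\<Sum>\<alpha>\<in>F - {z, e}. t\<^sup>2 / r\<^sup>2 * (H2_norm (c \<alpha>) * r ^ multi_degree \<alpha>))"
      proof (rule sum_mono)
        fix \<alpha> assume "\<alpha> \<in> F - {z, e}"
        then have "cmod (?k \<alpha>) \<le> t\<^sup>2 / r\<^sup>2 * r ^ multi_degree \<alpha>" using mono_bound[OF t, of \<alpha>] by simp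
        from mult_right_mono[OF this H2_norm_nonneg[of "c \<alpha>"]]
        show "cmod (?k \<alpha>) * H2_norm (c \<alpha>) \<le> t\<^sup>2 / r\<^sup>2 * (H2_norm (c \<alpha>) * r ^ multi_degree \<alpha>)" by (simp add: mult_ac)
      qed
      also have "\<dots> = t\<^sup>2 / r\<^sup>2 * (\<Sum>\<alpha>\<in>F - {z, e}. H2_norm (c \<alpha>) * r ^ multi_degree \<alpha>)" by (simp add: sum_distrib_left)
      also have "\<dots> \<le> t\<^sup>2 / r\<^sup>2 * S"
        unfolding S_def using F r by (intro mult_left_mono finite_sum_le_infsum sm) auto
      finally show "H2_norm ?u \<le> ?E F + t\<^sup>2 / r\<^sup>2 * S" by simp
    qed
    moreover have "((\<lambda>F. ?E F + t\<^sup>2 / r\<^sup>2 * S) \<longlongrightarrow> 0 + t\<^sup>2 / r\<^sup>2 * S) (finite_subsets_at_top UNIV)"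
      by (intro tendsto_intros lim \<eta>)
    ultimately show ?thesis
      using tendsto_lowerbound[of "\<lambda>F. ?E F + t\<^sup>2 / r\<^sup>2 * S" "0 + t\<^sup>2 / r\<^sup>2 * S" "finite_subsets_at_top UNIV" "H2_norm ?u"] by simp
  qed
  have "has_H2_partial l \<Phi> 0 (c e)"
    unfolding has_H2_partial_def
  proof (rule conjI[OF c], rule tendsto_sandwich[where f="\<lambda>_. 0" and h="\<lambda>t. \<bar>t\<bar> / r\<^sup>2 * S"])
    have z0: "H2_norm (\<lambda>y. \<Phi> (0 *\<^sub>R axis l 1) y - (c z y + complex_of_real 0 * c e y)) = 0"
      using key[of 0] r H2_norm_nonneg by (simp add: order_antisym)
    have "H2_norm (\<lambda>y. (\<Phi> (0 + t *\<^sub>R axis l 1) y - \<Phi> 0 y) / complex_of_real t - c e y) \<le> \<bar>t\<bar> / r\<^sup>2 * S"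
      if t: "t \<noteq> 0" "\<bar>t\<bar> < r" for t
    proof -
      let ?p = "\<lambda>y. \<Phi> (t *\<^sub>R axis l 1) y - (c z y + complex_of_real t * c e y)"
      let ?q = "\<lambda>y. \<Phi> (0 *\<^sub>R axis l 1) y - (c z y + complex_of_real 0 * c e y)"
      have "s *\<^sub>R axis l 1 \<in> sup_box r" if "\<bar>s\<bar> < r" for s :: real
        using that r by (auto simp: sup_box_def axis_def)
      moreover have "(\<lambda>y. c z y + complex_of_real s * c e y) \<in> H2_per" for s
        using H2_per_lincomb(1)[OF c[of z] c[of e], of 1 "complex_of_real s"] by simp
      ultimately have pq: "?p \<in> H2_per" "?q \<in> H2_per"
        using t r by (intro H2_per_diff PH; simp del: scaleR_zero_left of_real_0)+
      have "H2_norm (\<lambda>y. (\<Phi> (0 + t *\<^sub>R axis l 1) y - \<Phi> 0 y) / complex_of_real t - c e y)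
         = H2_norm (\<lambda>y. (1 / complex_of_real t) * ?p y + (- (1 / complex_of_real t)) * ?q y)"
        by (rule arg_cong[where f=H2_norm], rule ext)
           (use t in \<open>simp add: right_diff_distrib distrib_left diff_divide_distrib add_divide_distrib\<close>)
      also have "\<dots> \<le> cmod (1 / complex_of_real t) * H2_norm ?p + cmod (- (1 / complex_of_real t)) * H2_norm ?q"
        by (rule H2_norm_lincomb[OF pq])
      also have "\<dots> \<le> 1 / \<bar>t\<bar> * (t\<^sup>2 / r\<^sup>2 * S)"
        unfolding z0 using mult_left_mono[OF key[OF t(2)], of "1 / \<bar>t\<bar>"] by (simp add: norm_divide)
      also have "\<dots> = \<bar>t\<bar> / r\<^sup>2 * S" using t by (simp add: power2_eq_square abs_if field_simps)
      finally show ?thesis .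
    qed
    then show "\<forall>\<^sub>F t in at 0. H2_norm (\<lambda>y. (\<Phi> (0 + t *\<^sub>R axis l 1) y - \<Phi> 0 y) / complex_of_real t - c e y) \<le> \<bar>t\<bar> / r\<^sup>2 * S"
      unfolding eventually_at using r by (intro exI[of _ r]) (auto simp: dist_real_def)
    show "((\<lambda>t. \<bar>t\<bar> / r\<^sup>2 * S) \<longlongrightarrow> 0) (at 0)" using r by (auto intro!: tendsto_eq_intros)
  qed auto
  then show ?thesis by blast
qed

section \<open>Hessians of functions with vanishing gradient\<close>

text \<open>
  Multiplication by a coordinate, which vanishes at \<open>0\<close>, makes a merely continuous function differentiable there.
  This is why first derivatives of the fluxes suffice for the Hessian of the eigenvalue.
\<close>

lemma has_derivative_coordinate_mult:
  fixes q :: "real^'n \<Rightarrow> real"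
  assumes "isCont q 0"
  shows "((\<lambda>\<eta>. \<eta> $ k * q \<eta>) has_derivative (\<lambda>v. v $ k * q 0)) (at 0)"
  unfolding has_derivative_at
proof
  show "bounded_linear (\<lambda>v::real^'n. v $ k * q 0)"
    by (intro bounded_linear_mult_const bounded_linear_vec_nth)
  have "((\<lambda>h. \<bar>q h - q 0\<bar>) \<longlongrightarrow> \<bar>q 0 - q 0\<bar>) (at 0)"
    using assms unfolding isCont_def by (intro tendsto_intros)
  then show "((\<lambda>h. norm ((0 + h) $ k * q (0 + h) - 0 $ k * q 0 - h $ k * q 0) / norm h) \<longlongrightarrow> 0) (at 0)"
  proof (rule Lim_null_comparison[rotated, OF tendsto_eq_rhs])
    have "norm (norm ((0 + h) $ k * q (0 + h) - 0 $ k * q 0 - h $ k * q 0) / norm h) \<le> \<bar>q h - q 0\<bar>" for h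
    proof -
      have "norm ((0 + h) $ k * q (0 + h) - 0 $ k * q 0 - h $ k * q 0) = \<bar>h $ k\<bar> * \<bar>q h - q 0\<bar>"
        by (simp add: abs_mult[symmetric] right_diff_distrib)
      also have "\<dots> \<le> norm h * \<bar>q h - q 0\<bar>" by (intro mult_right_mono component_le_norm_cart) auto
      finally show ?thesis by (cases "h = 0") (simp_all add: divide_le_eq mult.commute)
    qed
    then show "\<forall>\<^sub>F h in at 0. norm (norm ((0 + h) $ k * q (0 + h) - 0 $ k * q 0 - h $ k * q 0) / norm h) \<le> \<bar>q h - q 0\<bar>"
      by simp
  qed simp
qed

text \<open>
  The product rule gives \<open>\<partial>\<^sub>lf = h\<^sub>l + \<Sum>\<^sub>k \<eta>\<^sub>k \<partial>\<^sub>lh\<^sub>k + 4b|\<eta>|\<^sup>2\<eta>\<^sub>l\<close> near \<open>0\<close>. The middle terms are differentiable at \<open>0\<close>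
  because the \<open>\<partial>\<^sub>lh\<^sub>k\<close> are continuous, and the last one has derivative zero.
\<close>

lemma coordinate_sum_derivatives:
  fixes f :: "real^'n \<Rightarrow> real" and h :: "'n \<Rightarrow> real^'n \<Rightarrow> real" and H :: "'n \<Rightarrow> 'n \<Rightarrow> real^'n \<Rightarrow> real"
  assumes U: "open U" "0 \<in> U"
    and f: "\<And>\<eta>. \<eta> \<in> U \<Longrightarrow> f \<eta> = (\<Sum>k\<in>UNIV. \<eta> $ k * h k \<eta>) + b * (\<eta> \<bullet> \<eta>)\<^sup>2"
    and h: "\<And>k \<eta>. \<eta> \<in> U \<Longrightarrow> (h k has_derivative (\<lambda>v. \<Sum>j\<in>UNIV. v $ j * H k j \<eta>)) (at \<eta>)"
    and H: "\<And>k j. continuous_on U (H k j)"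
    and h0: "\<And>k. h k 0 = 0"
  shows "\<And>\<eta>. \<eta> \<in> U \<Longrightarrow> f differentiable (at \<eta>)"
    and "partial_deriv l f 0 = 0"
    and "partial_deriv l f differentiable (at 0)"
    and "partial_deriv k (partial_deriv l f) 0 = H l k 0 + H k l 0"
proof -
  let ?f' = "\<lambda>\<eta> v. (\<Sum>k\<in>UNIV. \<eta> $ k * (\<Sum>j\<in>UNIV. v $ j * H k j \<eta>) + v $ k * h k \<eta>) + b * (4 * (\<eta> \<bullet> \<eta>) * (\<eta> \<bullet> v))"
  have f': "(f has_derivative ?f' \<eta>) (at \<eta>)" if "\<eta> \<in> U" for \<eta>
  proof -
    have "((\<lambda>\<eta>. (\<Sum>k\<in>UNIV. \<eta> $ k * h k \<eta>) + b * (\<eta> \<bullet> \<eta>)\<^sup>2) has_derivative ?f' \<eta>) (at \<eta>)"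
    proof (rule has_derivative_add)
      show "((\<lambda>\<eta>. \<Sum>k\<in>UNIV. \<eta> $ k * h k \<eta>) has_derivative
         (\<lambda>v. \<Sum>k\<in>UNIV. \<eta> $ k * (\<Sum>j\<in>UNIV. v $ j * H k j \<eta>) + v $ k * h k \<eta>)) (at \<eta>)"
        by (intro has_derivative_sum has_derivative_mult h that bounded_linear.has_derivative[OF bounded_linear_vec_nth] has_derivative_ident)
      have "((\<lambda>\<eta>. (\<eta> \<bullet> \<eta>)\<^sup>2) has_derivative (\<lambda>v. 4 * (\<eta> \<bullet> \<eta>) * (\<eta> \<bullet> v))) (at \<eta>)"
        by (auto intro!: derivative_eq_intros simp: inner_commute fun_eq_iff algebra_simps)
      then show "((\<lambda>\<eta>. b * (\<eta> \<bullet> \<eta>)\<^sup>2) has_derivative (\<lambda>v. b * (4 * (\<eta> \<bullet> \<eta>) * (\<eta> \<bullet> v)))) (at \<eta>)"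
        by (rule has_derivative_mult_right)
    qed
    then show ?thesis
      by (rule has_derivative_transform_within_open[OF _ U(1) that]) (simp add: f)
  qed
  then show "\<And>\<eta>. \<eta> \<in> U \<Longrightarrow> f differentiable (at \<eta>)" by (auto simp: differentiable_def)
  have pd: "partial_deriv l f \<eta> = h l \<eta> + (\<Sum>k\<in>UNIV. \<eta> $ k * H k l \<eta>) + 4 * b * (\<eta> \<bullet> \<eta>) * \<eta> $ l" if "\<eta> \<in> U" for \<eta> l
    unfolding partial_deriv_has_derivative[OF f'[OF that]]
    by (simp add: axis_def sum.distrib if_distrib[of "\<lambda>x. x * _"] sum.delta inner_axis' inner_axis[unfolded axis_def] cong: if_cong)
  show "partial_deriv l f 0 = 0" using pd[OF U(2)] h0 by simp
  have "((\<lambda>\<eta>. h l \<eta> + (\<Sum>k\<in>UNIV. \<eta> $ k * H k l \<eta>) + 4 * b * (\<eta> \<bullet> \<eta>) * \<eta> $ l) has_derivative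
     (\<lambda>v. (\<Sum>j\<in>UNIV. v $ j * H l j 0) + (\<Sum>k\<in>UNIV. v $ k * H k l 0) + 0)) (at 0)" for l
  proof (intro has_derivative_add has_derivative_sum h U has_derivative_coordinate_mult)
    show "isCont (H k l) 0" for k using H U by (simp add: continuous_on_eq_continuous_at)
    show "((\<lambda>\<eta>::real^'n. 4 * b * (\<eta> \<bullet> \<eta>) * \<eta> $ l) has_derivative (\<lambda>v. 0)) (at 0)"
      by (rule has_derivative_eq_rhs[OF has_derivative_mult[OF has_derivative_mult_right[OF has_derivative_inner[OF has_derivative_ident has_derivative_ident]]
           bounded_linear.has_derivative[OF bounded_linear_vec_nth has_derivative_ident]]]) (simp add: fun_eq_iff)
  qed
  then have d2: "(partial_deriv l f has_derivative
     (\<lambda>v. (\<Sum>j\<in>UNIV. v $ j * H l j 0) + (\<Sum>k\<in>UNIV. v $ k * H k l 0) + 0)) (at 0)" for l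
    by (rule has_derivative_transform_within_open[OF _ U]) (simp add: pd)
  then show "partial_deriv l f differentiable (at 0)" by (auto simp: differentiable_def)
  show "partial_deriv k (partial_deriv l f) 0 = H l k 0 + H k l 0"
    unfolding partial_deriv_has_derivative[OF d2]
    by (simp add: axis_def if_distrib[of "\<lambda>x. x * _"] sum.delta cong: if_cong)
qed

text \<open>
  The product rule for the shape that the flux has as a function of the parameter; the last term comes from the explicit
  factor \<open>i\<eta>\<^sub>m\<close>.
\<close>

lemma flux_has_derivative:
  fixes L M :: "'n \<Rightarrow> real^'n \<Rightarrow> complex" and gL gM :: "'n \<Rightarrow> 'n \<Rightarrow> real^'n \<Rightarrow> complex"
  assumes L: "\<And>m. (L m has_derivative (\<lambda>v. \<Sum>j\<in>UNIV. v $ j *\<^sub>R gL m j \<eta>)) (at \<eta>)"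
    and M: "\<And>m. (M m has_derivative (\<lambda>v. \<Sum>j\<in>UNIV. v $ j *\<^sub>R gM m j \<eta>)) (at \<eta>)"
  shows "((\<lambda>\<eta>. \<Sum>m\<in>UNIV. L m \<eta> + \<i> * complex_of_real (\<eta> $ m) * M m \<eta>) has_derivative
     (\<lambda>v. \<Sum>j\<in>UNIV. v $ j *\<^sub>R ((\<Sum>m\<in>UNIV. gL m j \<eta> + \<i> * complex_of_real (\<eta> $ m) * gM m j \<eta>) + \<i> * M j \<eta>))) (at \<eta>)"
proof -
  have "((\<lambda>\<eta>. \<Sum>m\<in>UNIV. L m \<eta> + \<i> * complex_of_real (\<eta> $ m) * M m \<eta>) has_derivative
     (\<lambda>v. \<Sum>m\<in>UNIV. (\<Sum>j\<in>UNIV. v $ j *\<^sub>R gL m j \<eta>) +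
        (\<i> * complex_of_real (\<eta> $ m) * (\<Sum>j\<in>UNIV. v $ j *\<^sub>R gM m j \<eta>) + \<i> * complex_of_real (v $ m) * M m \<eta>))) (at \<eta>)"
    by (intro has_derivative_sum has_derivative_add has_derivative_mult has_derivative_mult_right has_derivative_of_real
          L M bounded_linear.has_derivative[OF bounded_linear_vec_nth] has_derivative_ident)
  moreover have "(\<Sum>m\<in>UNIV. (\<Sum>j\<in>UNIV. v $ j *\<^sub>R gL m j \<eta>) +
        (\<i> * complex_of_real (\<eta> $ m) * (\<Sum>j\<in>UNIV. v $ j *\<^sub>R gM m j \<eta>) + \<i> * complex_of_real (v $ m) * M m \<eta>))
     = (\<Sum>j\<in>UNIV. v $ j *\<^sub>R ((\<Sum>m\<in>UNIV. gL m j \<eta> + \<i> * complex_of_real (\<eta> $ m) * gM m j \<eta>) + \<i> * M j \<eta>))" for v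
  proof -
    define P where "P j = (\<Sum>m\<in>UNIV. gL m j \<eta> + \<i> * complex_of_real (\<eta> $ m) * gM m j \<eta>)" for j
    have "(\<Sum>m\<in>UNIV. (\<Sum>j\<in>UNIV. v $ j *\<^sub>R gL m j \<eta>) + \<i> * complex_of_real (\<eta> $ m) * (\<Sum>j\<in>UNIV. v $ j *\<^sub>R gM m j \<eta>))
      = (\<Sum>m\<in>UNIV. \<Sum>j\<in>UNIV. v $ j *\<^sub>R (gL m j \<eta> + \<i> * complex_of_real (\<eta> $ m) * gM m j \<eta>))"
      by (simp add: sum_distrib_left sum.distrib scaleR_add_right)
    also have "\<dots> = (\<Sum>j\<in>UNIV. v $ j *\<^sub>R P j)"
      unfolding P_def by (subst sum.swap) (simp add: scaleR_sum_right)
    finally have 1: "(\<Sum>m\<in>UNIV. (\<Sum>j\<in>UNIV. v $ j *\<^sub>R gL m j \<eta>) + \<i> * complex_of_real (\<eta> $ m) * (\<Sum>j\<in>UNIV. v $ j *\<^sub>R gM m j \<eta>))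
      = (\<Sum>j\<in>UNIV. v $ j *\<^sub>R P j)" .
    have 2: "(\<Sum>m\<in>UNIV. \<i> * complex_of_real (v $ m) * M m \<eta>) = (\<Sum>j\<in>UNIV. v $ j *\<^sub>R (\<i> * M j \<eta>))"
      by (simp add: scaleR_conv_of_real mult_ac)
    show ?thesis
      unfolding P_def[symmetric] scaleR_add_right sum.distrib[of "\<lambda>j. v $ j *\<^sub>R P j"] add.assoc[symmetric]
        sum.distrib[of _ "\<lambda>m. \<i> * complex_of_real (v $ m) * M m \<eta>"] 1 2 ..
  qed
  ultimately show ?thesis by simp
qed

section \<open>The form at zero quasimomentum\<close>

locale elliptic_coefficients =
  fixes A :: "real^'n \<Rightarrow> real^'n^'n" and \<rho> :: real
  assumes A_measurable: "\<And>k l. (\<lambda>y. A y $ k $ l) \<in> borel_measurable lebesgue"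
    and A_bounded: "\<exists>M. AE y in lebesgue. \<forall>k l. \<bar>A y $ k $ l\<bar> \<le> M"
    and A_symmetric: "AE y in lebesgue. transpose (A y) = A y"
    and A_elliptic: "\<exists>\<alpha>>0. AE y in lebesgue. \<forall>\<xi>. (A y *v \<xi>) \<bullet> \<xi> \<ge> \<alpha> * (norm \<xi>)\<^sup>2"
    and rho_pos: "\<rho> > 0"
begin

definition coeff :: "'n \<Rightarrow> 'n \<Rightarrow> real^'n \<Rightarrow> complex" where
  "coeff k m y = complex_of_real (A y $ k $ m)"

lemma coeff_measurable [measurable]: "coeff k m \<in> borel_measurable cell"
  unfolding coeff_def[abs_def] using measurable_cell[OF A_measurable[of k m]] by measurable

lemma coeff_mult_cell_L2 [intro]:
  assumes "u \<in> cell_L2" shows "(\<lambda>y. coeff k m y * u y) \<in> cell_L2"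
proof -
  obtain M where "AE y in lebesgue. \<forall>k l. \<bar>A y $ k $ l\<bar> \<le> M" using A_bounded by blast
  then have "AE y in cell. cmod (coeff k m y) \<le> M"
    by (rule AE_cell[THEN eventually_mono]) (simp add: coeff_def)
  then show ?thesis by (rule cell_L2_bounded_mult[OF assms coeff_measurable])
qed

lemma coeff_cell_L2 [intro]: "coeff k m \<in> cell_L2"
  using coeff_mult_cell_L2[of "\<lambda>_. 1" k m] by simp

lemma coeff_symmetric: "AE y in cell. \<forall>k m. coeff k m y = coeff m k y"
proof (rule eventually_mono[OF AE_cell[OF A_symmetric]], intro allI)
  fix y k m assume "transpose (A y) = A y"
  then have "A y $ k $ m = transpose (A y) $ k $ m" by simp
  then show "coeff k m y = coeff m k y" by (simp add: coeff_def transpose_def)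
qed

lemma cdot_matrix:
  "cdot (complex_matrix (A y) *v \<xi>) \<zeta> = (\<Sum>k\<in>UNIV. (\<Sum>m\<in>UNIV. coeff k m y * \<xi> $ m) * cnj (\<zeta> $ k))"
  by (simp add: cdot_def complex_matrix_def matrix_vector_mult_def coeff_def)

text \<open>
  For a real matrix the real part of the Hermitian expression is the sum of the quadratic forms at the real and
  imaginary parts of \<open>\<xi>\<close>.
\<close>

lemma cdot_coercive:
  assumes "\<forall>\<xi>. (A y *v \<xi>) \<bullet> \<xi> \<ge> \<alpha> * (norm \<xi>)\<^sup>2"
  shows "Re (cdot (complex_matrix (A y) *v \<xi>) \<xi>) \<ge> \<alpha> * (\<Sum>k\<in>UNIV. (cmod (\<xi> $ k))\<^sup>2)"
proof -
  define p :: "real^'n" where "p = (\<chi> k. Re (\<xi> $ k))"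
  define q :: "real^'n" where "q = (\<chi> k. Im (\<xi> $ k))"
  have "Re (cdot (complex_matrix (A y) *v \<xi>) \<xi>) = (A y *v p) \<bullet> p + (A y *v q) \<bullet> q"
    unfolding cdot_matrix
    by (simp add: coeff_def inner_vec_def matrix_vector_mult_def p_def q_def sum.distrib[symmetric])
  moreover have "(norm p)\<^sup>2 + (norm q)\<^sup>2 = (\<Sum>k\<in>UNIV. (cmod (\<xi> $ k))\<^sup>2)"
    by (simp add: norm_vec_def L2_set_def sum_nonneg p_def q_def cmod_power2 sum.distrib)
  ultimately show ?thesis using assms[rule_format, of p] assms[rule_format, of q]
    by (simp add: distrib_left[symmetric]) (smt (verit) distrib_left)
qed

lemma cdot_integrable:
  assumes "\<And>m. (\<lambda>y. \<xi> y $ m) \<in> cell_L2" "\<And>k. (\<lambda>y. \<zeta> y $ k) \<in> cell_L2"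
  shows "integrable cell (\<lambda>y. cdot (complex_matrix (A y) *v \<xi> y) (\<zeta> y))"
  unfolding cdot_matrix
  by (intro Bochner_Integration.integrable_sum cell_L2_mult_integrable cell_L2_sum coeff_mult_cell_L2 cell_L2_cnj assms)

lemma bloch_form_cell:
  "bloch_form A \<rho> \<eta> u v =
     (\<integral>y. cdot (complex_matrix (A y) *v shifted_grad \<eta> u y) (shifted_grad \<eta> v y) \<partial>cell)
     + complex_of_real (\<rho>\<^sup>2) * (\<integral>y. shifted_laplacian \<eta> u y * cnj (shifted_laplacian \<eta> v y) \<partial>cell)"
  by (simp add: bloch_form_def cell_integral_eq)

lemma shifted_0: "shifted_grad 0 u = weak_grad u" "shifted_laplacian 0 u = weak_laplacian u"
  by (auto simp: shifted_grad_def weak_grad_def shifted_laplacian_def fun_eq_iff vec_eq_iff)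

lemma weak_grad_cell_L2 [intro]: "u \<in> H2_per \<Longrightarrow> (\<lambda>y. weak_grad u y $ m) \<in> cell_L2"
  by (simp add: weak_grad_def)

lemma bloch_form_0_coercive:
  obtains \<alpha> where "\<alpha> > 0" "\<And>u j. u \<in> H2_per \<Longrightarrow>
     \<alpha> * (\<integral>y. (cmod (weak_partial j u y))\<^sup>2 \<partial>cell) \<le> Re (bloch_form A \<rho> 0 u u)"
proof -
  obtain \<alpha> where \<alpha>: "\<alpha> > 0" "AE y in lebesgue. \<forall>\<xi>. (A y *v \<xi>) \<bullet> \<xi> \<ge> \<alpha> * (norm \<xi>)\<^sup>2" using A_elliptic by blast
  have "\<alpha> * (\<integral>y. (cmod (weak_partial j u y))\<^sup>2 \<partial>cell) \<le> Re (bloch_form A \<rho> 0 u u)" if u: "u \<in> H2_per" for u j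
  proof -
    have int: "integrable cell (\<lambda>y. cdot (complex_matrix (A y) *v weak_grad u y) (weak_grad u y))"
      using u by (intro cdot_integrable weak_grad_cell_L2)
    have "\<alpha> * (\<integral>y. (cmod (weak_partial j u y))\<^sup>2 \<partial>cell) = (\<integral>y. \<alpha> * (cmod (weak_partial j u y))\<^sup>2 \<partial>cell)"
      by simp
    also have "\<dots> \<le> (\<integral>y. Re (cdot (complex_matrix (A y) *v weak_grad u y) (weak_grad u y)) \<partial>cell)"
    proof (rule integral_mono_AE)
      show "integrable cell (\<lambda>y. \<alpha> * (cmod (weak_partial j u y))\<^sup>2)" using u by simp
      show "integrable cell (\<lambda>y. Re (cdot (complex_matrix (A y) *v weak_grad u y) (weak_grad u y)))" using int by simp
      show "AE y in cell. \<alpha> * (cmod (weak_partial j u y))\<^sup>2 \<le> Re (cdot (complex_matrix (A y) *v weak_grad u y) (weak_grad u y))"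
      proof (rule eventually_mono[OF AE_cell[OF \<alpha>(2)]])
        fix y assume "\<forall>\<xi>. (A y *v \<xi>) \<bullet> \<xi> \<ge> \<alpha> * (norm \<xi>)\<^sup>2"
        from cdot_coercive[OF this, of "weak_grad u y"]
        have "\<alpha> * (\<Sum>k\<in>UNIV. (cmod (weak_partial k u y))\<^sup>2) \<le> Re (cdot (complex_matrix (A y) *v weak_grad u y) (weak_grad u y))"
          by (simp add: weak_grad_def)
        moreover have "(cmod (weak_partial j u y))\<^sup>2 \<le> (\<Sum>k\<in>UNIV. (cmod (weak_partial k u y))\<^sup>2)"
          by (rule member_le_sum) auto
        ultimately show "\<alpha> * (cmod (weak_partial j u y))\<^sup>2 \<le> Re (cdot (complex_matrix (A y) *v weak_grad u y) (weak_grad u y))"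
          using \<alpha>(1) by (meson mult_left_mono order_trans less_imp_le)
      qed
    qed
    also have "\<dots> = Re (\<integral>y. cdot (complex_matrix (A y) *v weak_grad u y) (weak_grad u y) \<partial>cell)"
      using int by simp
    also have "\<dots> \<le> Re (bloch_form A \<rho> 0 u u)"
      unfolding bloch_form_cell shifted_0 complex_norm_square[symmetric]
      by (simp flip: of_real_power add: integral_complex_of_real)
    finally show ?thesis .
  qed
  then show ?thesis using that \<alpha>(1) by blast
qed

lemma bloch_form_0_nonneg: "u \<in> H2_per \<Longrightarrow> 0 \<le> Re (bloch_form A \<rho> 0 u u)"
proof -
  assume u: "u \<in> H2_per"
  obtain \<alpha> where "\<alpha> > 0" "\<alpha> * (\<integral>y. (cmod (weak_partial undefined u y))\<^sup>2 \<partial>cell) \<le> Re (bloch_form A \<rho> 0 u u)"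
    using bloch_form_0_coercive u by metis
  moreover have "0 \<le> \<alpha> * (\<integral>y. (cmod (weak_partial undefined u y))\<^sup>2 \<partial>cell)" using \<open>\<alpha> > 0\<close> by simp
  ultimately show ?thesis by linarith
qed

text \<open>
  The fourth-order part of the form is nonnegative, so ellipticity alone makes the gradient vanish.
\<close>

lemma bloch_form_0_kernel:
  assumes u: "u \<in> H2_per" and z: "bloch_form A \<rho> 0 u u = 0"
  shows "\<exists>K. AE y in lebesgue. u y = K"
proof (rule weak_gradient_zero_imp_const)
  fix j
  obtain \<alpha> where \<alpha>: "\<alpha> > 0" "\<alpha> * (\<integral>y. (cmod (weak_partial j u y))\<^sup>2 \<partial>cell) \<le> Re (bloch_form A \<rho> 0 u u)"
    using bloch_form_0_coercive u by metis
  then have "(\<integral>y. (cmod (weak_partial j u y))\<^sup>2 \<partial>cell) \<le> 0" using z by (simp add: mult_le_0_iff)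
  moreover have "0 \<le> (\<integral>y. (cmod (weak_partial j u y))\<^sup>2 \<partial>cell)" by simp
  ultimately have "AE y in cell. weak_partial j u y = 0" by (intro AE_zero_if_L2_zero) (use u in auto)
  then have *: "(\<integral>y. weak_partial j u y * f y \<partial>cell) = 0" if "f \<in> cell_L2" for f
    by (rule pairing_AE_zero) (use u that in auto)
  show "is_weak_partial j u (\<lambda>_. 0)"
    using H2_perD(1)[OF u, of j] * unfolding is_weak_partial_cell
    by (auto simp: continuous_cell_L2 smooth_continuous)
qed

section \<open>Testing with a constant\<close>

lemma weak_grad_const: "AE y in cell. weak_grad (\<lambda>_. c) y = 0"
proof -
  have "AE y in cell. \<forall>j\<in>UNIV. weak_partial j (\<lambda>_. c) y = 0"
    by (rule AE_finite_allI) (use H2_per_const(2) in auto)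
  then show ?thesis by eventually_elim (simp add: weak_grad_def vec_eq_iff)
qed

lemma weak_laplacian_const: "AE y in cell. weak_laplacian (\<lambda>_. c) y = 0"
  using H2_per_AE_const(2)[OF H2_per_const(1)[of c], of c] by simp

lemma shifted_const:
  "AE y in cell. shifted_grad \<eta> (\<lambda>_. 1) y = (\<chi> k. \<i> * complex_of_real (\<eta> $ k))"
  "AE y in cell. shifted_laplacian \<eta> (\<lambda>_. 1) y = - complex_of_real ((norm \<eta>)\<^sup>2)"
proof -
  show "AE y in cell. shifted_grad \<eta> (\<lambda>_. 1) y = (\<chi> k. \<i> * complex_of_real (\<eta> $ k))"
    using weak_grad_const[of 1] by eventually_elim (simp add: shifted_grad_def weak_grad_def vec_eq_iff)
  show "AE y in cell. shifted_laplacian \<eta> (\<lambda>_. 1) y = - complex_of_real ((norm \<eta>)\<^sup>2)"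
    using weak_grad_const[of 1] weak_laplacian_const[of 1]
    by eventually_elim (simp add: shifted_laplacian_def weak_grad_def vec_eq_iff)
qed

lemma shifted_grad_cell_L2 [intro]: "u \<in> H2_per \<Longrightarrow> (\<lambda>y. shifted_grad \<eta> u y $ m) \<in> cell_L2"
  by (auto simp: shifted_grad_def intro!: cell_L2_add cell_L2_cmult)

lemma shifted_laplacian_eq: "shifted_laplacian \<eta> u = (\<lambda>y. weak_laplacian u y
     + ((2 * \<i>) * (\<Sum>j\<in>UNIV. complex_of_real (\<eta> $ j) * weak_partial j u y)
     + (- complex_of_real ((norm \<eta>)\<^sup>2)) * u y))"
  by (auto simp: shifted_laplacian_def)

lemma shifted_laplacian_cell_L2 [intro]: "u \<in> H2_per \<Longrightarrow> shifted_laplacian \<eta> u \<in> cell_L2"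
  unfolding shifted_laplacian_eq
  by (intro cell_L2_add cell_L2_cmult cell_L2_sum H2_per_laplacian_cell_L2 H2_per_cell_L2)

text \<open>
  The integral over the cell of the \<open>k\<close>-th component of \<open>A(\<nabla> + i\<eta>)u\<close>, expanded into functionals of \<open>u\<close> that do not
  depend on \<open>\<eta>\<close> (lemma \<open>flux_eq\<close>).
\<close>

definition flux :: "'n \<Rightarrow> real^'n \<Rightarrow> (real^'n \<Rightarrow> complex) \<Rightarrow> complex" where
  "flux k \<eta> u = (\<Sum>m\<in>UNIV. (\<integral>y. weak_partial m u y * coeff k m y \<partial>cell)
     + \<i> * complex_of_real (\<eta> $ m) * (\<integral>y. u y * coeff k m y \<partial>cell))"

lemma flux_eq:
  assumes u: "u \<in> H2_per"
  shows "(\<integral>y. (\<Sum>m\<in>UNIV. coeff k m y * shifted_grad \<eta> u y $ m) \<partial>cell) = flux k \<eta> u"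
    and "integrable cell (\<lambda>y. \<Sum>m\<in>UNIV. coeff k m y * shifted_grad \<eta> u y $ m)"
proof -
  have i: "integrable cell (\<lambda>y. weak_partial m u y * coeff k m y)" "integrable cell (\<lambda>y. u y * coeff k m y)" for m
    using u by auto
  have e: "(\<lambda>y. \<Sum>m\<in>UNIV. coeff k m y * shifted_grad \<eta> u y $ m)
     = (\<lambda>y. \<Sum>m\<in>UNIV. weak_partial m u y * coeff k m y + (\<i> * complex_of_real (\<eta> $ m)) * (u y * coeff k m y))"
    by (auto simp: shifted_grad_def algebra_simps)
  show "(\<integral>y. (\<Sum>m\<in>UNIV. coeff k m y * shifted_grad \<eta> u y $ m) \<partial>cell) = flux k \<eta> u"
    unfolding e flux_def using i by simp
  show "integrable cell (\<lambda>y. \<Sum>m\<in>UNIV. coeff k m y * shifted_grad \<eta> u y $ m)"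
    unfolding e using i by simp
qed

text \<open>
  The second-order part contracts the flux with \<open>-i\<eta>\<close>, the conjugate of \<open>(\<nabla> + i\<eta>)1\<close>. In the fourth-order part \<open>(\<nabla> + i\<eta>)\<^sup>2 1 = -|\<eta>|\<^sup>2\<close>, and the
  integral of \<open>(\<nabla> + i\<eta>)\<^sup>2u\<close> is \<open>-|\<eta>|\<^sup>2 \<integral> u\<close>, which gives the term of order four.
\<close>

lemma bloch_form_const_right:
  assumes u: "u \<in> H2_per"
  shows "bloch_form A \<rho> \<eta> u (\<lambda>_. 1) = (\<Sum>k\<in>UNIV. complex_of_real (\<eta> $ k) * (- \<i> * flux k \<eta> u))
      + complex_of_real (\<rho>\<^sup>2 * (\<eta> \<bullet> \<eta>)\<^sup>2) * (\<integral>y. u y \<partial>cell)"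
proof -
  have m: "(\<lambda>y. cdot (complex_matrix (A y) *v shifted_grad \<eta> u y) (shifted_grad \<eta> (\<lambda>_. 1) y)) \<in> borel_measurable cell"
    using cdot_integrable[of "shifted_grad \<eta> u" "shifted_grad \<eta> (\<lambda>_. 1)"] u H2_per_const(1)[of 1] by (auto dest: borel_measurable_integrable)
  have "(\<integral>y. cdot (complex_matrix (A y) *v shifted_grad \<eta> u y) (shifted_grad \<eta> (\<lambda>_. 1) y) \<partial>cell)
     = (\<integral>y. (\<Sum>k\<in>UNIV. (\<Sum>m\<in>UNIV. coeff k m y * shifted_grad \<eta> u y $ m) * (- \<i> * complex_of_real (\<eta> $ k))) \<partial>cell)"
  proof (rule integral_cong_AE[OF m])
    show "(\<lambda>y. \<Sum>k\<in>UNIV. (\<Sum>m\<in>UNIV. coeff k m y * shifted_grad \<eta> u y $ m) * (- \<i> * complex_of_real (\<eta> $ k))) \<in> borel_measurable cell"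
      using flux_eq(2)[OF u, THEN borel_measurable_integrable] by measurable
    show "AE y in cell. cdot (complex_matrix (A y) *v shifted_grad \<eta> u y) (shifted_grad \<eta> (\<lambda>_. 1) y)
       = (\<Sum>k\<in>UNIV. (\<Sum>m\<in>UNIV. coeff k m y * shifted_grad \<eta> u y $ m) * (- \<i> * complex_of_real (\<eta> $ k)))"
      using shifted_const(1)[of \<eta>] by eventually_elim (simp add: cdot_matrix)
  qed
  also have "\<dots> = (\<Sum>k\<in>UNIV. flux k \<eta> u * (- \<i> * complex_of_real (\<eta> $ k)))"
    using flux_eq[OF u] by simp
  finally have 1: "(\<integral>y. cdot (complex_matrix (A y) *v shifted_grad \<eta> u y) (shifted_grad \<eta> (\<lambda>_. 1) y) \<partial>cell)
     = (\<Sum>k\<in>UNIV. complex_of_real (\<eta> $ k) * (- \<i> * flux k \<eta> u))" by (simp add: mult_ac)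
  have sl: "(\<integral>y. shifted_laplacian \<eta> u y \<partial>cell) = - complex_of_real ((norm \<eta>)\<^sup>2) * (\<integral>y. u y \<partial>cell)"
  proof -
    have i: "integrable cell (weak_laplacian u)" "integrable cell (weak_partial j u)" "integrable cell u" for j
      using u by auto
    show ?thesis unfolding shifted_laplacian_eq using i integral_weak_partial_zero[OF u] by simp
  qed
  have "(\<integral>y. shifted_laplacian \<eta> u y * cnj (shifted_laplacian \<eta> (\<lambda>_. 1) y) \<partial>cell)
      = (\<integral>y. shifted_laplacian \<eta> u y * (- complex_of_real ((norm \<eta>)\<^sup>2)) \<partial>cell)"
  proof (rule integral_cong_AE)
    have m2: "shifted_laplacian \<eta> u \<in> cell_L2" "(\<lambda>y. cnj (shifted_laplacian \<eta> (\<lambda>_. 1) y)) \<in> cell_L2"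
      using u H2_per_const(1)[of 1] by auto
    then show "(\<lambda>y. shifted_laplacian \<eta> u y * cnj (shifted_laplacian \<eta> (\<lambda>_. 1) y)) \<in> borel_measurable cell"
       "(\<lambda>y. shifted_laplacian \<eta> u y * (- complex_of_real ((norm \<eta>)\<^sup>2))) \<in> borel_measurable cell"
      using m2[THEN cell_L2D(1)] by measurable
    show "AE y in cell. shifted_laplacian \<eta> u y * cnj (shifted_laplacian \<eta> (\<lambda>_. 1) y)
       = shifted_laplacian \<eta> u y * (- complex_of_real ((norm \<eta>)\<^sup>2))"
      using shifted_const(2)[of \<eta>] by eventually_elim simp
  qed
  also have "\<dots> = complex_of_real ((\<eta> \<bullet> \<eta>)\<^sup>2) * (\<integral>y. u y \<partial>cell)"
  proof -
    have n: "complex_of_real ((norm \<eta>)\<^sup>2) = complex_of_real (\<eta> \<bullet> \<eta>)" by (simp only: power2_norm_eq_inner)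
    show ?thesis using sl unfolding n by (simp add: power2_eq_square)
  qed
  finally show ?thesis unfolding bloch_form_cell 1 by simp
qed

lemma bloch_form_0_const_left:
  assumes v: "v \<in> H2_per" shows "bloch_form A \<rho> 0 (\<lambda>_. c) v = 0"
proof -
  have "(\<integral>y. cdot (complex_matrix (A y) *v weak_grad (\<lambda>_. c) y) (weak_grad v y) \<partial>cell) = integral\<^sup>L cell (\<lambda>_ :: real^'n. 0)"
  proof (rule integral_cong_AE)
    show "(\<lambda>y. cdot (complex_matrix (A y) *v weak_grad (\<lambda>_. c) y) (weak_grad v y)) \<in> borel_measurable cell"
      using cdot_integrable[of "weak_grad (\<lambda>_. c)" "weak_grad v"] v H2_per_const(1)[of c] by (auto dest: borel_measurable_integrable)
    show "AE y in cell. cdot (complex_matrix (A y) *v weak_grad (\<lambda>_. c) y) (weak_grad v y) = 0"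
      using weak_grad_const[of c] by eventually_elim (simp add: cdot_def)
  qed simp
  moreover have "(\<integral>y. weak_laplacian (\<lambda>_. c) y * cnj (weak_laplacian v y) \<partial>cell) = 0"
    by (rule pairing_AE_zero[OF weak_laplacian_const]) (use v H2_per_const(1)[of c] in auto)
  ultimately show ?thesis by (simp add: bloch_form_cell shifted_0)
qed

text \<open>
  Constants are eigenfunctions with eigenvalue \<open>0\<close>, and the form at \<open>0\<close> is nonnegative.
\<close>

lemma bloch_eigenvalue1_0: "bloch_eigenvalue1 A \<rho> 0 = 0"
  unfolding bloch_eigenvalue1_def
proof (rule Least_equality)
  have "bloch_eigenfunction A \<rho> 0 0 (\<lambda>_. 1)"
    unfolding bloch_eigenfunction_def
  proof (intro conjI ballI)
    show "(\<lambda>_ :: real^'n. 1) \<in> H2_per" by (rule H2_per_const(1))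
    show "\<not> (AE y :: real^'n in lebesgue. (1 :: complex) = 0)"
      by (simp add: AE_lebesgue_iff_negligible)
  qed (simp add: bloch_form_0_const_left)
  then show "\<exists>u. bloch_eigenfunction A \<rho> 0 0 u" by blast
next
  fix \<mu> assume "\<exists>u. bloch_eigenfunction A \<rho> 0 \<mu> u"
  then obtain u where u: "u \<in> H2_per" "\<not> (AE y in lebesgue. u y = 0)"
    and e: "bloch_form A \<rho> 0 u u = complex_of_real \<mu> * (LINT y:period_cell|lebesgue. u y * cnj (u y))"
    unfolding bloch_eigenfunction_def by blast
  define N where "N = (\<integral>y. (cmod (u y))\<^sup>2 \<partial>cell)"
  have "(LINT y:period_cell|lebesgue. u y * cnj (u y)) = complex_of_real N"
    unfolding cell_integral_eq N_def complex_norm_square[symmetric]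
    by (simp flip: of_real_power add: integral_complex_of_real)
  then have "0 \<le> \<mu> * N" using bloch_form_0_nonneg[OF u(1)] e by simp
  moreover have "N > 0"
  proof -
    have "N \<noteq> 0"
    proof
      assume "N = 0"
      then have "AE y in cell. u y = 0" using AE_zero_if_L2_zero[of u] u(1) by (simp add: N_def)
      moreover have "ae_periodic u" using H2_perD(1)[OF u(1), of undefined] by (auto simp: is_weak_partial_def dest: L2_perD)
      ultimately have "AE y in lebesgue. u y = 0" by (intro AE_cell_imp_AE[where P="\<lambda>z. z = 0"])
      then show False using u(2) by blast
    qed
    then show ?thesis unfolding N_def by (simp add: order_less_le)
  qed
  ultimately show "0 \<le> \<mu>" by (simp add: zero_le_mult_iff)
qed

section \<open>The corrector and the derivative of the eigenfunction\<close>

text \<open>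
  The term \<open>\<integral> Ae\<^sub>l \<sqdot> \<nabla>v\<^sup>*\<close> of the cell problem; the equation reads \<open>a[0](\<chi>\<^sub>l, v) = -\<close>\<open>cell_load l v\<close>.
\<close>

definition cell_load :: "'n \<Rightarrow> (real^'n \<Rightarrow> complex) \<Rightarrow> complex" where
  "cell_load l v = (\<integral>y. (\<Sum>k\<in>UNIV. coeff k l y * cnj (weak_partial k v y)) \<partial>cell)"

text \<open>
  Along an axis the form is a polynomial in \<open>t\<close> whose coefficients are bounded functionals of \<open>u\<close>. This reduces the
  differentiation of \<open>a[te\<^sub>l](\<phi>(te\<^sub>l), v)\<close> to the product rule. Only the coefficient of \<open>t\<close> at constant \<open>u\<close>
  is needed explicitly.
\<close>

lemma bloch_form_axis_expansion:
  assumes v: "v \<in> H2_per"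
  shows "\<exists>B :: nat \<Rightarrow> (real^'n \<Rightarrow> complex) \<Rightarrow> complex. (\<forall>n. H2_functional (B n)) \<and>
    (\<forall>u\<in>H2_per. \<forall>t. bloch_form A \<rho> (t *\<^sub>R axis l 1) u v = (\<Sum>n\<le>4. complex_of_real t ^ n * B n u)) \<and>
    (\<forall>u\<in>H2_per. \<forall>K. (AE y in cell. u y = K) \<longrightarrow> B 1 u = \<i> * K * cell_load l v)"
proof -
  define p where "p m = (\<lambda>y. \<Sum>k\<in>UNIV. coeff k m y * cnj (weak_partial k v y))" for m
  define q where "q m = (\<lambda>y. coeff l m y * cnj (v y))" for m
  define w0 where "w0 = (\<lambda>y. cnj (weak_laplacian v y))"
  define w1 where "w1 = (\<lambda>y. cnj (weak_partial l v y))"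
  define w2 where "w2 = (\<lambda>y. cnj (v y))"
  have W: "p m \<in> cell_L2" "q m \<in> cell_L2" "w0 \<in> cell_L2" "w1 \<in> cell_L2" "w2 \<in> cell_L2" for m
    unfolding p_def q_def w0_def w1_def w2_def
    by (intro cell_L2_sum coeff_mult_cell_L2 cell_L2_cnj H2_per_cell_L2 H2_per_laplacian_cell_L2 v)+
  define r where "r = complex_of_real (\<rho>\<^sup>2)"
  define I where "I f g = (\<integral>y. f y * g y \<partial>cell)" for f g :: "real^'n \<Rightarrow> complex"
  define B :: "nat \<Rightarrow> (real^'n \<Rightarrow> complex) \<Rightarrow> complex" where "B n = 
    (if n = 0 then (\<lambda>u. (\<Sum>m\<in>UNIV. I (weak_partial m u) (p m)) + r * I (weak_laplacian u) w0)
     else if n = 1 then (\<lambda>u. (- \<i>) * (\<Sum>m\<in>UNIV. I (weak_partial m u) (q m)) + (\<i> * I u (p l)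
          + ((- 2 * \<i> * r) * I (weak_laplacian u) w1 + (2 * \<i> * r) * I (weak_partial l u) w0)))
     else if n = 2 then (\<lambda>u. I u (q l) + ((- r) * I (weak_laplacian u) w2 + ((4 * r) * I (weak_partial l u) w1 + (- r) * I u w0)))
     else if n = 3 then (\<lambda>u. (- 2 * \<i> * r) * I (weak_partial l u) w2 + (2 * \<i> * r) * I u w1)
     else (\<lambda>u. r * I u w2))" for n
  show ?thesis
  proof (rule exI[of _ B], intro conjI allI ballI impI)
    have ifI: "H2_functional (if c then L else M)" if "H2_functional L" "H2_functional M"
      for c and L M :: "(real^'n \<Rightarrow> complex) \<Rightarrow> complex" using that by simp
    show "H2_functional (B n)" for n
      unfolding B_def I_def
      by (intro ifI H2_functional_add H2_functional_cmult H2_functional_sum H2_functional_basic H2_functional_laplacian W)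
  next
    fix u :: "real^'n \<Rightarrow> complex" and K assume u: "u \<in> H2_per" and K: "AE y in cell. u y = K"
    have z: "I (weak_partial m u) g = 0" "I (weak_laplacian u) g = 0" if "g \<in> cell_L2" for m g
      unfolding I_def by (rule pairing_AE_zero; use H2_per_AE_const[OF u K] u that in auto)+
    have "I u (p l) = (\<integral>y. K * p l y \<partial>cell)"
      unfolding I_def
    proof (rule integral_cong_AE)
      show "(\<lambda>y. u y * p l y) \<in> borel_measurable cell" "(\<lambda>y. K * p l y) \<in> borel_measurable cell"
        using cell_L2D(1)[OF W(1)] cell_L2D(1)[OF H2_per_cell_L2(1)[OF u]] by measurable
      show "AE y in cell. u y * p l y = K * p l y" using K by eventually_elim simp
    qed
    then show "B 1 u = \<i> * K * cell_load l v"
      using z W by (simp add: B_def p_def cell_load_def)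
  next
    fix u :: "real^'n \<Rightarrow> complex" and t assume u: "u \<in> H2_per"
    define \<tau> where "\<tau> = complex_of_real t"
    let ?\<eta> = "t *\<^sub>R axis l 1 :: real^'n"
    have ax: "complex_of_real (?\<eta> $ j) = (if j = l then \<tau> else 0)" for j by (simp add: axis_def \<tau>_def)
    have ui: "integrable cell (\<lambda>y. f y * g y)" if "f \<in> {u, weak_laplacian u} \<union> range (\<lambda>m. weak_partial m u)"
      "g \<in> {w0, w1, w2} \<union> range p \<union> range q" for f g
      using that u W by (intro cell_L2_mult_integrable) auto
    have 1: "cdot (complex_matrix (A y) *v shifted_grad ?\<eta> u y) (shifted_grad ?\<eta> v y)
       = (\<Sum>m\<in>UNIV. weak_partial m u y * p m y) + ((- \<i> * \<tau>) * (\<Sum>m\<in>UNIV. weak_partial m u y * q m y)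
         + ((\<i> * \<tau>) * (u y * p l y) + \<tau>\<^sup>2 * (u y * q l y)))" for y
    proof -
      have s1: "(\<Sum>m\<in>UNIV. coeff k m y * shifted_grad ?\<eta> u y $ m) = (\<Sum>m\<in>UNIV. coeff k m y * weak_partial m u y) + \<i> * \<tau> * u y * coeff k l y" for k
      proof -
        have "coeff k m y * shifted_grad ?\<eta> u y $ m = coeff k m y * weak_partial m u y + (if m = l then \<i> * \<tau> * u y * coeff k l y else 0)" for m
          unfolding shifted_grad_def vec_lambda_beta ax by (simp add: algebra_simps)
        then show ?thesis by (simp add: sum.distrib)
      qed
      have s2: "X * cnj (shifted_grad ?\<eta> v y $ k) = X * cnj (weak_partial k v y) + (if k = l then - (\<i> * \<tau>) * X * w2 y else 0)" for X k
        unfolding shifted_grad_def vec_lambda_beta ax by (simp add: algebra_simps \<tau>_def w2_def)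
      have "cdot (complex_matrix (A y) *v shifted_grad ?\<eta> u y) (shifted_grad ?\<eta> v y)
        = (\<Sum>k\<in>UNIV. ((\<Sum>m\<in>UNIV. coeff k m y * weak_partial m u y) + \<i> * \<tau> * u y * coeff k l y) * cnj (weak_partial k v y))
          - \<i> * \<tau> * ((\<Sum>m\<in>UNIV. coeff l m y * weak_partial m u y) + \<i> * \<tau> * u y * coeff l l y) * w2 y"
        unfolding cdot_matrix s1 s2 sum.distrib[of "\<lambda>k. _ k * cnj (_ k)"] by (simp add: sum.distrib)
      also have "(\<Sum>k\<in>UNIV. ((\<Sum>m\<in>UNIV. coeff k m y * weak_partial m u y) + \<i> * \<tau> * u y * coeff k l y) * cnj (weak_partial k v y))
        = (\<Sum>m\<in>UNIV. weak_partial m u y * p m y) + \<i> * \<tau> * u y * p l y"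
      proof -
        have "(\<Sum>k\<in>UNIV. (\<Sum>m\<in>UNIV. coeff k m y * weak_partial m u y) * cnj (weak_partial k v y))
          = (\<Sum>m\<in>UNIV. weak_partial m u y * p m y)"
          unfolding p_def sum_distrib_left sum_distrib_right by (subst sum.swap) (simp add: mult_ac)
        moreover have "(\<Sum>k\<in>UNIV. \<i> * \<tau> * u y * coeff k l y * cnj (weak_partial k v y)) = \<i> * \<tau> * u y * p l y"
          by (simp add: p_def sum_distrib_left mult_ac)
        ultimately show ?thesis unfolding distrib_right sum.distrib by simp
      qed
      also have "(\<Sum>m\<in>UNIV. coeff l m y * weak_partial m u y) * w2 y = (\<Sum>m\<in>UNIV. weak_partial m u y * q m y)"
        by (simp add: q_def w2_def sum_distrib_left sum_distrib_right mult_ac)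
      then have "\<i> * \<tau> * ((\<Sum>m\<in>UNIV. coeff l m y * weak_partial m u y) + \<i> * \<tau> * u y * coeff l l y) * w2 y
          = \<i> * \<tau> * (\<Sum>m\<in>UNIV. weak_partial m u y * q m y) - \<tau>\<^sup>2 * (u y * q l y)"
        by (simp add: algebra_simps q_def w2_def power2_eq_square)
      finally show ?thesis by (simp add: algebra_simps)
    qed
    have sl: "shifted_laplacian ?\<eta> w y = weak_laplacian w y + 2 * \<i> * \<tau> * weak_partial l w y - \<tau>\<^sup>2 * w y" for w y
    proof -
      have "(\<Sum>j\<in>UNIV. complex_of_real (?\<eta> $ j) * weak_partial j w y) = \<tau> * weak_partial l w y"
        unfolding ax by (simp add: if_distrib[of "\<lambda>x. x * _"] cong: if_cong)
      moreover have "complex_of_real ((norm ?\<eta>)\<^sup>2) = \<tau>\<^sup>2" by (simp add: \<tau>_def)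
      ultimately show ?thesis by (simp add: shifted_laplacian_def mult.assoc)
    qed
    have 2: "shifted_laplacian ?\<eta> u y * cnj (shifted_laplacian ?\<eta> v y)
       = weak_laplacian u y * w0 y + ((- 2 * \<i> * \<tau>) * (weak_laplacian u y * w1 y) + ((- \<tau>\<^sup>2) * (weak_laplacian u y * w2 y)
         + ((2 * \<i> * \<tau>) * (weak_partial l u y * w0 y) + ((4 * \<tau>\<^sup>2) * (weak_partial l u y * w1 y)
         + ((- 2 * \<i> * \<tau>^3) * (weak_partial l u y * w2 y) + ((- \<tau>\<^sup>2) * (u y * w0 y)
         + ((2 * \<i> * \<tau>^3) * (u y * w1 y) + \<tau>^4 * (u y * w2 y))))))))" for y
    proof -
      have cv: "cnj (shifted_laplacian ?\<eta> v y) = w0 y - 2 * \<i> * \<tau> * w1 y - \<tau>\<^sup>2 * w2 y"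
        unfolding sl by (simp add: w0_def w1_def w2_def \<tau>_def)
      show ?thesis unfolding cv unfolding sl by (simp add: algebra_simps power2_eq_square power3_eq_cube power4_eq_xxxx)
    qed
    have "bloch_form A \<rho> ?\<eta> u v = ((\<Sum>m\<in>UNIV. I (weak_partial m u) (p m)) + ((- \<i> * \<tau>) * (\<Sum>m\<in>UNIV. I (weak_partial m u) (q m))
         + ((\<i> * \<tau>) * I u (p l) + \<tau>\<^sup>2 * I u (q l))))
       + r * (I (weak_laplacian u) w0 + ((- 2 * \<i> * \<tau>) * I (weak_laplacian u) w1 + ((- \<tau>\<^sup>2) * I (weak_laplacian u) w2
         + ((2 * \<i> * \<tau>) * I (weak_partial l u) w0 + ((4 * \<tau>\<^sup>2) * I (weak_partial l u) w1
         + ((- 2 * \<i> * \<tau>^3) * I (weak_partial l u) w2 + ((- \<tau>\<^sup>2) * I u w0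
         + ((2 * \<i> * \<tau>^3) * I u w1 + \<tau>^4 * I u w2))))))))"
      unfolding bloch_form_cell 1 2 r_def I_def
      by (simp add: ui)
    also have "\<dots> = (\<Sum>n\<le>4. \<tau> ^ n * B n u)"
      by (simp add: B_def eval_nat_numeral atMost_Suc) (simp add: algebra_simps)
    finally show "bloch_form A \<rho> ?\<eta> u v = (\<Sum>n\<le>4. complex_of_real t ^ n * B n u)" by (simp add: \<tau>_def)
  qed
qed

lemma bloch_form_0_functional:
  assumes "v \<in> H2_per"
  obtains F where "H2_functional F" "\<And>u. u \<in> H2_per \<Longrightarrow> F u = bloch_form A \<rho> 0 u v"
proof -
  obtain B where B: "\<forall>n. H2_functional (B n)"
    "\<forall>u\<in>H2_per. \<forall>t. bloch_form A \<rho> (t *\<^sub>R axis undefined 1) u v = (\<Sum>n\<le>4. complex_of_real t ^ n * B n u)"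
    using bloch_form_axis_expansion[OF assms, where l=undefined] by blast
  have "B 0 u = bloch_form A \<rho> 0 u v" if "u \<in> H2_per" for u
    using B(2)[rule_format, OF that, of 0] by (simp add: eval_nat_numeral atMost_Suc)
  then show ?thesis using that[of "B 0"] B(1) by simp
qed

lemma cdot_matrix_axis_add:
  "cdot (complex_matrix (A y) *v (axis l 1 + \<xi>)) \<zeta>
     = (\<Sum>k\<in>UNIV. coeff k l y * cnj (\<zeta> $ k)) + cdot (complex_matrix (A y) *v \<xi>) \<zeta>"
proof -
  have "coeff k m y * (axis l 1 + \<xi>) $ m = (if m = l then coeff k m y else 0) + coeff k m y * \<xi> $ m" for k m
    by (simp add: axis_def algebra_simps)
  then show ?thesis unfolding cdot_matrix by (simp add: sum.distrib distrib_right)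
qed

lemma cell_solution_form:
  assumes c: "cell_solution A \<rho> l c" and v: "v \<in> H2_per"
  shows "bloch_form A \<rho> 0 c v = - cell_load l v"
proof -
  have cH: "c \<in> H2_per" using c by (simp add: cell_solution_def)
  have i1: "integrable cell (\<lambda>y. \<Sum>k\<in>UNIV. coeff k l y * cnj (weak_partial k v y))"
    by (intro cell_L2_integrable cell_L2_sum coeff_mult_cell_L2 cell_L2_cnj H2_per_cell_L2 v)
  have i2: "integrable cell (\<lambda>y. cdot (complex_matrix (A y) *v weak_grad c y) (weak_grad v y))"
    by (intro cdot_integrable weak_grad_cell_L2 v cH)
  have "(\<integral>y. cdot (complex_matrix (A y) *v (axis l 1 + weak_grad c y)) (weak_grad v y) \<partial>cell)
     = cell_load l v + (\<integral>y. cdot (complex_matrix (A y) *v weak_grad c y) (weak_grad v y) \<partial>cell)"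
    unfolding cdot_matrix_axis_add cell_load_def using i1 i2 by (simp add: weak_grad_def)
  moreover have "complex_of_real (\<rho>\<^sup>2) * (\<integral>y. weak_laplacian c y * cnj (weak_laplacian v y) \<partial>cell)
     + (\<integral>y. cdot (complex_matrix (A y) *v (axis l 1 + weak_grad c y)) (weak_grad v y) \<partial>cell) = 0"
    using c v by (simp add: cell_solution_def cell_integral_eq)
  ultimately show ?thesis unfolding bloch_form_cell shifted_0 by (simp add: algebra_simps eq_neg_iff_add_eq_0)
qed

text \<open>
  Testing the equation of \<open>\<chi>\<^sub>k\<close> with the conjugate of \<open>\<chi>\<^sub>l\<close> shows that the left-hand side is \<open>- Q k l\<close>, where \<open>Q\<close>
  contains no conjugations and is symmetric because \<open>A\<close> is.
\<close>

lemma corrector_symmetric: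
  assumes c: "\<And>j. cell_solution A \<rho> j (c j)"
  shows "(\<Sum>m\<in>UNIV. \<integral>y. weak_partial m (c l) y * coeff k m y \<partial>cell) = (\<Sum>m\<in>UNIV. \<integral>y. weak_partial m (c k) y * coeff l m y \<partial>cell)"
proof -
  have cH: "c j \<in> H2_per" for j using c by (simp add: cell_solution_def)
  define Q where "Q k l = (\<integral>y. (\<Sum>p\<in>UNIV. (\<Sum>m\<in>UNIV. coeff p m y * weak_partial m (c k) y) * weak_partial p (c l) y) \<partial>cell)
      + complex_of_real (\<rho>\<^sup>2) * (\<integral>y. weak_laplacian (c k) y * weak_laplacian (c l) y \<partial>cell)" for k l
  have L2a: "(\<lambda>y. \<Sum>m\<in>UNIV. coeff p m y * weak_partial m (c k) y) \<in> cell_L2" for p k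
    by (intro cell_L2_sum coeff_mult_cell_L2 H2_per_cell_L2 cH)
  have meas: "(\<lambda>y. \<Sum>p\<in>UNIV. (\<Sum>m\<in>UNIV. coeff p m y * weak_partial m (c k) y) * weak_partial p (c l) y) \<in> borel_measurable cell" for k l
    by (intro borel_measurable_integrable Bochner_Integration.integrable_sum cell_L2_mult_integrable L2a H2_per_cell_L2 cH)
  have Qsym: "Q k l = Q l k" for k l
  proof -
    have "(\<integral>y. (\<Sum>p\<in>UNIV. (\<Sum>m\<in>UNIV. coeff p m y * weak_partial m (c k) y) * weak_partial p (c l) y) \<partial>cell)
        = (\<integral>y. (\<Sum>p\<in>UNIV. (\<Sum>m\<in>UNIV. coeff p m y * weak_partial m (c l) y) * weak_partial p (c k) y) \<partial>cell)"
    proof (rule integral_cong_AE[OF meas meas])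
      show "AE y in cell. (\<Sum>p\<in>UNIV. (\<Sum>m\<in>UNIV. coeff p m y * weak_partial m (c k) y) * weak_partial p (c l) y)
         = (\<Sum>p\<in>UNIV. (\<Sum>m\<in>UNIV. coeff p m y * weak_partial m (c l) y) * weak_partial p (c k) y)"
        using coeff_symmetric
      proof eventually_elim
        case (elim y)
        have "(\<Sum>p\<in>UNIV. (\<Sum>m\<in>UNIV. coeff p m y * weak_partial m (c k) y) * weak_partial p (c l) y)
           = (\<Sum>m\<in>UNIV. \<Sum>p\<in>UNIV. coeff p m y * weak_partial m (c k) y * weak_partial p (c l) y)"
          unfolding sum_distrib_right by (rule sum.swap)
        also have "\<dots> = (\<Sum>m\<in>UNIV. (\<Sum>p\<in>UNIV. coeff m p y * weak_partial p (c l) y) * weak_partial m (c k) y)"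
          unfolding sum_distrib_right
        proof (intro sum.cong refl)
          fix m p
          have "coeff p m y = coeff m p y" using elim by blast
          then show "coeff p m y * weak_partial m (c k) y * weak_partial p (c l) y = coeff m p y * weak_partial p (c l) y * weak_partial m (c k) y"
            by simp
        qed
        finally show ?case .
      qed
    qed
    then show ?thesis by (simp add: Q_def mult.commute)
  qed
  have R: "(\<Sum>m\<in>UNIV. \<integral>y. weak_partial m (c l) y * coeff k m y \<partial>cell) = - Q k l" for k l
  proof -
    let ?v = "\<lambda>y. cnj (c l y)"
    note cv = H2_per_cnj[OF cH[of l]]
    have gr: "AE y in cell. \<forall>j\<in>UNIV. cnj (weak_partial j ?v y) = weak_partial j (c l) y"
    proof (rule AE_finite_allI)
      show "AE y in cell. cnj (weak_partial j ?v y) = weak_partial j (c l) y" for j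
        using cv(2)[of j] by eventually_elim simp
    qed simp
    have lap: "AE y in cell. cnj (weak_laplacian ?v y) = weak_laplacian (c l) y"
      using weak_laplacian_AE[OF cv(3)] by eventually_elim (simp add: weak_laplacian_def)
    have "bloch_form A \<rho> 0 (c k) ?v = Q k l"
    proof -
      have "(\<integral>y. cdot (complex_matrix (A y) *v weak_grad (c k) y) (weak_grad ?v y) \<partial>cell)
        = (\<integral>y. (\<Sum>p\<in>UNIV. (\<Sum>m\<in>UNIV. coeff p m y * weak_partial m (c k) y) * weak_partial p (c l) y) \<partial>cell)"
      proof (rule integral_cong_AE[OF _ meas])
        show "(\<lambda>y. cdot (complex_matrix (A y) *v weak_grad (c k) y) (weak_grad ?v y)) \<in> borel_measurable cell"
          by (intro borel_measurable_integrable cdot_integrable weak_grad_cell_L2 cH cv)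
        show "AE y in cell. cdot (complex_matrix (A y) *v weak_grad (c k) y) (weak_grad ?v y)
           = (\<Sum>p\<in>UNIV. (\<Sum>m\<in>UNIV. coeff p m y * weak_partial m (c k) y) * weak_partial p (c l) y)"
          using gr by eventually_elim (simp add: cdot_matrix weak_grad_def)
      qed
      moreover have "(\<integral>y. weak_laplacian (c k) y * cnj (weak_laplacian ?v y) \<partial>cell)
         = (\<integral>y. weak_laplacian (c k) y * weak_laplacian (c l) y \<partial>cell)"
      proof (rule integral_cong_AE)
        show "(\<lambda>y. weak_laplacian (c k) y * cnj (weak_laplacian ?v y)) \<in> borel_measurable cell"
          by (intro borel_measurable_integrable cell_L2_mult_integrable cell_L2_cnj H2_per_laplacian_cell_L2 cH cv)
        show "(\<lambda>y. weak_laplacian (c k) y * weak_laplacian (c l) y) \<in> borel_measurable cell"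
          by (intro borel_measurable_integrable cell_L2_mult_integrable H2_per_laplacian_cell_L2 cH)
        show "AE y in cell. weak_laplacian (c k) y * cnj (weak_laplacian ?v y) = weak_laplacian (c k) y * weak_laplacian (c l) y"
          using lap by eventually_elim simp
      qed
      ultimately show ?thesis by (simp add: bloch_form_cell shifted_0 Q_def)
    qed
    moreover have "cell_load k ?v = (\<Sum>m\<in>UNIV. \<integral>y. weak_partial m (c l) y * coeff k m y \<partial>cell)"
    proof -
      have "cell_load k ?v = (\<integral>y. (\<Sum>m\<in>UNIV. weak_partial m (c l) y * coeff k m y) \<partial>cell)"
        unfolding cell_load_def
      proof (rule integral_cong_AE)
        show "(\<lambda>y. \<Sum>j\<in>UNIV. coeff j k y * cnj (weak_partial j ?v y)) \<in> borel_measurable cell"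
          by (intro borel_measurable_integrable Bochner_Integration.integrable_sum cell_L2_mult_integrable coeff_cell_L2 cell_L2_cnj H2_per_cell_L2 cv)
        show "(\<lambda>y. \<Sum>m\<in>UNIV. weak_partial m (c l) y * coeff k m y) \<in> borel_measurable cell"
          by (intro borel_measurable_integrable Bochner_Integration.integrable_sum cell_L2_mult_integrable coeff_cell_L2 H2_per_cell_L2 cH)
        show "AE y in cell. (\<Sum>j\<in>UNIV. coeff j k y * cnj (weak_partial j ?v y)) = (\<Sum>m\<in>UNIV. weak_partial m (c l) y * coeff k m y)"
          using gr coeff_symmetric
        proof eventually_elim
          case (elim y)
          have "coeff j k y = coeff k j y" for j using elim(2) by blast
          then show ?case using elim(1) by (simp add: mult.commute)
        qed
      qed
      also have "\<dots> = (\<Sum>m\<in>UNIV. \<integral>y. weak_partial m (c l) y * coeff k m y \<partial>cell)"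
        by (intro Bochner_Integration.integral_sum cell_L2_mult_integrable coeff_cell_L2 H2_per_cell_L2 cH)
      finally show ?thesis .
    qed
    ultimately show ?thesis using cell_solution_form[OF c cv(1), of k] by (metis minus_minus)
  qed
  show ?thesis unfolding R using Qsym by simp
qed

text \<open>
  Differentiating the eigenvalue equation at \<open>0\<close> along \<open>e\<^sub>l\<close>: the right-hand side has derivative zero since \<open>\<Lambda>\<close> and
  its partial derivative vanish, and the left-hand side contributes \<open>a[0](D, v)\<close> and the coefficient of \<open>t\<close>
  in the form at the constant \<open>\<kappa>\<close>. Comparison with the cell problem shows that \<open>D - i\<kappa>\<chi>\<^sub>l\<close> lies in the kernel
  of the form.
\<close>

lemma corrector_derivative:
  fixes \<phi> :: "real^'n \<Rightarrow> real^'n \<Rightarrow> complex"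
  assumes D: "has_H2_partial l \<phi> 0 D"
    and H: "\<forall>\<^sub>F \<eta> in nhds 0. \<phi> \<eta> \<in> H2_per"
    and ef: "\<forall>\<^sub>F \<eta> in nhds 0. \<forall>v\<in>H2_per. bloch_form A \<rho> \<eta> (\<phi> \<eta>) v
        = complex_of_real (\<Lambda> \<eta>) * (\<integral>y. \<phi> \<eta> y * cnj (v y) \<partial>cell)"
    and \<Lambda>: "\<Lambda> 0 = 0" "\<Lambda> differentiable (at 0)" "partial_deriv l \<Lambda> 0 = 0"
    and K: "AE y in cell. \<phi> 0 y = \<kappa>"
    and c: "cell_solution A \<rho> l c"
  shows "\<exists>K. AE y in lebesgue. D y - \<i> * \<kappa> * c y = K"
proof -
  have cH: "c \<in> H2_per" using c by (simp add: cell_solution_def)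
  have DH: "D \<in> H2_per" using D by (simp add: has_H2_partial_def)
  have p0: "\<phi> 0 \<in> H2_per" using H by (rule eventually_nhds_x_imp_x)
  have form: "bloch_form A \<rho> 0 D v = - (\<i> * \<kappa>) * cell_load l v" if v: "v \<in> H2_per" for v
  proof -
    obtain B where B': "\<forall>n. H2_functional (B n)"
      "\<forall>u\<in>H2_per. \<forall>t. bloch_form A \<rho> (t *\<^sub>R axis l 1) u v = (\<Sum>n\<le>4. complex_of_real t ^ n * B n u)"
      "\<forall>u\<in>H2_per. \<forall>K. (AE y in cell. u y = K) \<longrightarrow> B 1 u = \<i> * K * cell_load l v"
      using bloch_form_axis_expansion[OF v, where l=l] by blast
    note B = B'[rule_format]
    have B0: "B 0 u = bloch_form A \<rho> 0 u v" if "u \<in> H2_per" for u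
      using B(2)[OF that, of 0] by (simp add: eval_nat_numeral atMost_Suc)
    define M where "M u = (\<integral>y. u y * cnj (v y) \<partial>cell)" for u :: "real^'n \<Rightarrow> complex"
    have MF: "H2_functional M" unfolding M_def by (rule H2_functional_basic) (use v in auto)
    have der: "((\<lambda>t. L (\<phi> (t *\<^sub>R axis l 1))) has_vector_derivative L D) (at 0)" if "H2_functional L" for L
      using H2_functional_has_vector_derivative[OF that D H] by simp
    have pw: "((\<lambda>t. complex_of_real t ^ n) has_vector_derivative of_nat n * 0 ^ (n - 1)) (at 0)" for n
    proof -
      have "((\<lambda>z::complex. z ^ n) has_field_derivative of_nat n * 0 ^ (n - 1)) (at (of_real 0))"
        by (rule DERIV_cong[OF DERIV_power[OF DERIV_ident]]) simp
      then show ?thesis by (rule has_vector_derivative_real_field)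
    qed
    have "((\<lambda>t. \<Sum>n\<le>4. complex_of_real t ^ n * B n (\<phi> (t *\<^sub>R axis l 1))) has_vector_derivative
        (\<Sum>n\<le>4. complex_of_real 0 ^ n * B n D + of_nat n * 0 ^ (n - 1) * B n (\<phi> (0 *\<^sub>R axis l 1)))) (at 0)"
      by (intro has_vector_derivative_sum has_vector_derivative_mult der B pw)
    moreover have "(\<Sum>n\<le>4. complex_of_real 0 ^ n * B n D + of_nat n * 0 ^ (n - 1) * B n (\<phi> (0 *\<^sub>R axis l 1))) = B 0 D + B 1 (\<phi> 0)"
      by (simp add: eval_nat_numeral atMost_Suc)
    ultimately have 1: "((\<lambda>t. \<Sum>n\<le>4. complex_of_real t ^ n * B n (\<phi> (t *\<^sub>R axis l 1))) has_vector_derivative B 0 D + B 1 (\<phi> 0)) (at 0)"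
      by (simp only:)
    have "((\<lambda>t. \<Lambda> (0 + t *\<^sub>R axis l 1)) has_vector_derivative partial_deriv l \<Lambda> (0 + 0 *\<^sub>R axis l 1)) (at 0)"
      by (rule has_partial_deriv) (simp add: \<Lambda>)
    then have "((\<lambda>t. complex_of_real (\<Lambda> (t *\<^sub>R axis l 1))) has_vector_derivative of_real 0) (at 0)"
      by (intro has_vector_derivative_of_real) (simp add: \<Lambda> has_real_derivative_iff_has_vector_derivative)
    from has_vector_derivative_mult[OF this der[OF MF]]
    have 2: "((\<lambda>t. complex_of_real (\<Lambda> (t *\<^sub>R axis l 1)) * M (\<phi> (t *\<^sub>R axis l 1))) has_vector_derivative 0) (at 0)"
      by (simp add: \<Lambda>)
    have "\<forall>\<^sub>F \<eta> in nhds 0. \<forall>t. \<eta> = t *\<^sub>R axis l 1 \<longrightarrow> 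
        complex_of_real (\<Lambda> \<eta>) * M (\<phi> \<eta>) = (\<Sum>n\<le>4. complex_of_real t ^ n * B n (\<phi> \<eta>))"
      using H ef by eventually_elim (use v B(2) in \<open>auto simp: M_def\<close>)
    moreover have "((\<lambda>t. t *\<^sub>R axis l 1 :: real^'n) \<longlongrightarrow> 0) (nhds (0::real))"
      by (rule tendsto_eq_intros filterlim_ident | simp)+
    ultimately have "\<forall>\<^sub>F t in nhds 0. \<forall>s. t *\<^sub>R axis l 1 = s *\<^sub>R (axis l 1 :: real^'n) \<longrightarrow> 
        complex_of_real (\<Lambda> (t *\<^sub>R axis l 1)) * M (\<phi> (t *\<^sub>R axis l 1)) = (\<Sum>n\<le>4. complex_of_real s ^ n * B n (\<phi> (t *\<^sub>R axis l 1)))"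
      by (rule eventually_compose_filterlim)
    then have "\<forall>\<^sub>F t in nhds 0. complex_of_real (\<Lambda> (t *\<^sub>R axis l 1)) * M (\<phi> (t *\<^sub>R axis l 1)) = (\<Sum>n\<le>4. complex_of_real t ^ n * B n (\<phi> (t *\<^sub>R axis l 1)))"
      by (rule eventually_mono) blast
    then obtain S where S: "open S" "0 \<in> S"
      "\<And>t. t \<in> S \<Longrightarrow> complex_of_real (\<Lambda> (t *\<^sub>R axis l 1)) * M (\<phi> (t *\<^sub>R axis l 1)) = (\<Sum>n\<le>4. complex_of_real t ^ n * B n (\<phi> (t *\<^sub>R axis l 1)))"
      unfolding eventually_nhds by blast
    have "((\<lambda>t. \<Sum>n\<le>4. complex_of_real t ^ n * B n (\<phi> (t *\<^sub>R axis l 1))) has_vector_derivative 0) (at 0)"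
      by (rule has_vector_derivative_transform_within_open[OF 2 S])
    with 1 have "B 0 D + B 1 (\<phi> 0) = 0" by (rule vector_derivative_unique_at)
    then show ?thesis using B(3)[OF p0 K] B0[OF DH] by (simp add: eq_neg_iff_add_eq_0)
  qed
  define w where "w = (\<lambda>y. 1 * D y + (- (\<i> * \<kappa>)) * c y)"
  have wH: "w \<in> H2_per" unfolding w_def by (rule H2_per_lincomb(1)[OF DH cH])
  obtain F where F: "H2_functional F" "\<And>u. u \<in> H2_per \<Longrightarrow> F u = bloch_form A \<rho> 0 u w"
    using bloch_form_0_functional[OF wH] by blast
  have "F w = 1 * F D + (- (\<i> * \<kappa>)) * F c" unfolding w_def by (rule H2_functional_lincomb[OF F(1) DH cH])
  then have "bloch_form A \<rho> 0 w w = 0"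
    using F(2)[OF wH] F(2)[OF DH] F(2)[OF cH] form[OF wH] cell_solution_form[OF c wH] by simp
  from bloch_form_0_kernel[OF wH this] show ?thesis by (simp add: w_def)
qed

section \<open>Expansion of the first Bloch eigenvalue\<close>

text \<open>
  The results above are combined for an arbitrary nonzero normalisation \<open>\<kappa>\<close>. The formula for the eigenvalue is
  used twice: its real part gives the eigenvalue and its Hessian, and its imaginary part, which is identically zero,
  shows that the homogenized matrix is real.
\<close>

lemma bloch_eigenvalue_expansion:
  fixes \<phi> :: "real^'n \<Rightarrow> real^'n \<Rightarrow> complex" and c :: "'n \<Rightarrow> real^'n \<Rightarrow> complex" and \<kappa> :: complex
  assumes eigenf: "\<forall>\<^sub>F \<eta> in nhds 0. bloch_eigenfunction A \<rho> \<eta> (bloch_eigenvalue1 A \<rho> \<eta>) (\<phi> \<eta>)"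
    and analytic: "H2_analytic_at \<phi> 0"
    and normalized: "\<forall>\<^sub>F \<eta> in nhds 0. cell_mean (\<phi> \<eta>) = \<kappa>" and "\<kappa> \<noteq> 0"
    and cell: "\<And>j. cell_solution A \<rho> j (c j)"
  shows "bloch_eigenvalue1 A \<rho> differentiable (at 0)"
    and "partial_deriv l (bloch_eigenvalue1 A \<rho>) 0 = 0"
    and "\<exists>D. has_H2_partial l \<phi> 0 D \<and> (\<exists>K. AE y in lebesgue. D y - \<i> * \<phi> 0 y * c l y = K)"
    and "\<forall>\<^sub>F \<eta> in nhds 0. bloch_eigenvalue1 A \<rho> differentiable (at \<eta>)"
    and "partial_deriv l (bloch_eigenvalue1 A \<rho>) differentiable (at 0)"
    and "complex_of_real (1/2 * partial_deriv k (partial_deriv l (bloch_eigenvalue1 A \<rho>)) 0) = hom_matrix A c $ k $ l"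
proof -
  define \<Lambda> where "\<Lambda> = bloch_eigenvalue1 A \<rho>"
  define V where "V = complex_of_real (measure lebesgue (period_cell :: (real^'n) set))"
  have V: "V \<noteq> 0" using measure_period_cell_pos[where 'n='n] by (simp add: V_def)
  have cH: "c j \<in> H2_per" for j using cell by (simp add: cell_solution_def)
  have ev_H2: "\<forall>\<^sub>F \<eta> in nhds 0. \<phi> \<eta> \<in> H2_per"
    using eigenf by (rule eventually_mono) (simp add: bloch_eigenfunction_def)
  have ev_eq: "\<forall>\<^sub>F \<eta> in nhds 0. \<forall>v\<in>H2_per. bloch_form A \<rho> \<eta> (\<phi> \<eta>) v
        = complex_of_real (\<Lambda> \<eta>) * (\<integral>y. \<phi> \<eta> y * cnj (v y) \<partial>cell)"
    using eigenf by (rule eventually_mono) (simp add: bloch_eigenfunction_def cell_integral_eq \<Lambda>_def)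
  have ev_mean: "\<forall>\<^sub>F \<eta> in nhds 0. (\<integral>y. \<phi> \<eta> y \<partial>cell) = \<kappa> * V"
    using normalized by (rule eventually_mono) (use V in \<open>simp add: cell_mean_cell V_def field_simps\<close>)
  have p0: "\<phi> 0 \<in> H2_per" using ev_H2 by (rule eventually_nhds_x_imp_x)
  have \<Lambda>0: "\<Lambda> 0 = 0" unfolding \<Lambda>_def by (rule bloch_eigenvalue1_0)
  have phi0: "AE y in lebesgue. \<phi> 0 y = \<kappa>"
  proof -
    have "bloch_form A \<rho> 0 (\<phi> 0) (\<phi> 0) = 0"
      using eventually_nhds_x_imp_x[OF ev_eq] p0 by (simp add: \<Lambda>0)
    then obtain K where K: "AE y in lebesgue. \<phi> 0 y = K" using bloch_form_0_kernel[OF p0] by blast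
    have "(\<integral>y. \<phi> 0 y \<partial>cell) = integral\<^sup>L cell (\<lambda>_ :: real^'n. K)"
      by (rule integral_cong_AE) (use AE_cell[OF K] p0 in auto)
    also have "\<dots> = V * K" unfolding V_def by (rule cell_integral_const)
    finally have "\<kappa> * V = V * K" using eventually_nhds_x_imp_x[OF ev_mean] by (simp only:)
    then show ?thesis using K V by simp
  qed
  note phi0c = AE_cell[OF phi0]

  define L where "L l m u = (\<integral>y. weak_partial m u y * coeff l m y \<partial>cell)" for l m u
  define M where "M l m u = (\<integral>y. u y * coeff l m y \<partial>cell)" for l m u
  have LM: "H2_functional (L l m)" "H2_functional (M l m)" for l m
    unfolding L_def[abs_def] M_def[abs_def] by (intro H2_functional_basic coeff_cell_L2)+
  obtain s where s: "0 < s"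
    "\<forall>L. H2_functional L \<longrightarrow> (\<exists>G. has_C1_partials (\<lambda>\<eta>. L (\<phi> \<eta>)) G (sup_box s))"
    using H2_analytic_functional_C1[OF analytic] by blast
  define g where "g F = (SOME G. has_C1_partials (\<lambda>\<eta>. F (\<phi> \<eta>)) G (sup_box s))" for F :: "(real^'n \<Rightarrow> complex) \<Rightarrow> complex"
  have g: "\<And>\<eta>. \<eta> \<in> sup_box s \<Longrightarrow> ((\<lambda>\<eta>. F (\<phi> \<eta>)) has_derivative (\<lambda>h. \<Sum>j\<in>UNIV. h $ j *\<^sub>R g F j \<eta>)) (at \<eta>)"
    "\<And>j. continuous_on (sup_box s) (g F j)" if "H2_functional F" for F
    using someI_ex[OF s(2)[rule_format, OF that]] unfolding g_def[of F, symmetric] unfolding has_C1_partials_def by blast+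

  define GG where "GG l j \<eta> = (\<Sum>m\<in>UNIV. g (L l m) j \<eta> + \<i> * complex_of_real (\<eta> $ m) * g (M l m) j \<eta>) + \<i> * M l j (\<phi> \<eta>)" for l j \<eta>
  have flux: "((\<lambda>\<eta>. flux l \<eta> (\<phi> \<eta>)) has_derivative (\<lambda>v. \<Sum>j\<in>UNIV. v $ j *\<^sub>R GG l j \<eta>)) (at \<eta>)"
    if "\<eta> \<in> sup_box s" for l \<eta>
    unfolding flux_def GG_def L_def[symmetric] M_def[symmetric]
    by (rule flux_has_derivative) (intro g LM that)+
  have GGc: "continuous_on (sup_box s) (GG l j)" for l j
  proof -
    have "continuous_on (sup_box s) (\<lambda>\<eta>. M l j (\<phi> \<eta>))"
      by (rule has_derivative_continuous_on) (rule has_derivative_at_withinI[OF g(1)[OF LM(2)]])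
    then show ?thesis unfolding GG_def[abs_def] by (intro continuous_intros g LM)
  qed
  \<comment> \<open>Dividing the identity from the test function 1 by the integral of the eigenfunction leaves this factor on the fluxes.\<close>
  define c0 where "c0 = - \<i> / (\<kappa> * V)"
  have "\<forall>\<^sub>F \<eta> in nhds 0. complex_of_real (\<Lambda> \<eta>)
      = (\<Sum>k\<in>UNIV. complex_of_real (\<eta> $ k) * (c0 * flux k \<eta> (\<phi> \<eta>))) + complex_of_real (\<rho>\<^sup>2 * (\<eta> \<bullet> \<eta>)\<^sup>2)"
    using ev_H2 ev_eq ev_mean
  proof eventually_elim
    case (elim \<eta>)
    have "complex_of_real (\<Lambda> \<eta>) * (\<kappa> * V) = bloch_form A \<rho> \<eta> (\<phi> \<eta>) (\<lambda>_. 1)"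
      using elim(2)[rule_format, OF H2_per_const(1)[of 1]] elim(3) by simp
    also have "\<dots> = (\<Sum>k\<in>UNIV. complex_of_real (\<eta> $ k) * (- \<i> * flux k \<eta> (\<phi> \<eta>)))
      + complex_of_real (\<rho>\<^sup>2 * (\<eta> \<bullet> \<eta>)\<^sup>2) * (\<kappa> * V)"
      using bloch_form_const_right[OF elim(1)] elim(3) by simp
    also have "\<dots> = ((\<Sum>k\<in>UNIV. complex_of_real (\<eta> $ k) * (c0 * flux k \<eta> (\<phi> \<eta>)))
      + complex_of_real (\<rho>\<^sup>2 * (\<eta> \<bullet> \<eta>)\<^sup>2)) * (\<kappa> * V)"
      using V \<open>\<kappa> \<noteq> 0\<close> by (simp add: c0_def distrib_right sum_distrib_right)
    finally show ?case using V \<open>\<kappa> \<noteq> 0\<close> by simp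
  qed
  then obtain U0 where U0: "open U0" "0 \<in> U0" "\<And>\<eta>. \<eta> \<in> U0 \<Longrightarrow> complex_of_real (\<Lambda> \<eta>)
      = (\<Sum>k\<in>UNIV. complex_of_real (\<eta> $ k) * (c0 * flux k \<eta> (\<phi> \<eta>))) + complex_of_real (\<rho>\<^sup>2 * (\<eta> \<bullet> \<eta>)\<^sup>2)"
    unfolding eventually_nhds by blast
  define U where "U = U0 \<inter> sup_box s"
  have U: "open U" "0 \<in> U" using U0 s(1) by (auto simp: U_def)
  have flux0: "flux l 0 (\<phi> 0) = 0" for l
  proof -
    have "(\<integral>y. weak_partial m (\<phi> 0) y * coeff l m y \<partial>cell) = 0" for m
      by (rule pairing_AE_zero[OF H2_per_AE_const(1)[OF p0 phi0c]]) (use p0 in auto)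
    then show ?thesis by (simp add: flux_def)
  qed
  have fluxD: "((\<lambda>\<eta>. T (c0 * flux l \<eta> (\<phi> \<eta>))) has_derivative (\<lambda>v. \<Sum>j\<in>UNIV. v $ j * T (c0 * GG l j \<eta>))) (at \<eta>)"
    if "\<eta> \<in> U" "bounded_linear T" for l \<eta> and T :: "complex \<Rightarrow> real"
  proof -
    interpret T: bounded_linear T by fact
    have "((\<lambda>\<eta>. T (c0 * flux l \<eta> (\<phi> \<eta>))) has_derivative (\<lambda>v. T (c0 * (\<Sum>j\<in>UNIV. v $ j *\<^sub>R GG l j \<eta>)))) (at \<eta>)"
      by (intro T.has_derivative has_derivative_mult_right flux) (use that in \<open>simp add: U_def\<close>)
    then show ?thesis by (simp add: sum_distrib_left T.sum T.scaleR)
  qed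
  have cT: "continuous_on U (\<lambda>\<eta>. T (c0 * GG l j \<eta>))" if "bounded_linear T" for l j and T :: "complex \<Rightarrow> real"
    by (intro bounded_linear.continuous_on[OF that] continuous_intros continuous_on_subset[OF GGc]) (simp add: U_def)
  note reRe = fluxD[OF _ bounded_linear_Re] and reIm = fluxD[OF _ bounded_linear_Im]
  have rm: "Re (complex_of_real b * z) = b * Re z" "Im (complex_of_real b * z) = b * Im z" for b z by simp_all
  have re1: "\<Lambda> \<eta> = (\<Sum>k\<in>UNIV. \<eta> $ k * Re (c0 * flux k \<eta> (\<phi> \<eta>))) + \<rho>\<^sup>2 * (\<eta> \<bullet> \<eta>)\<^sup>2" if "\<eta> \<in> U" for \<eta>
    using arg_cong[OF U0(3)[of \<eta>], of Re] that unfolding U_def Re_sum plus_complex.sel rm Re_complex_of_real by blast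
  have im1: "0 = (\<Sum>k\<in>UNIV. \<eta> $ k * Im (c0 * flux k \<eta> (\<phi> \<eta>))) + 0 * (\<eta> \<bullet> \<eta>)\<^sup>2" if "\<eta> \<in> U" for \<eta>
    using arg_cong[OF U0(3)[of \<eta>], of Im] that unfolding U_def Im_sum plus_complex.sel rm Im_complex_of_real by simp
  have z: "Re (c0 * flux k 0 (\<phi> 0)) = 0" "Im (c0 * flux k 0 (\<phi> 0)) = 0" for k by (simp_all add: flux0)
  note re = coordinate_sum_derivatives[OF U re1 reRe cT[OF bounded_linear_Re] z(1)]
  note im = coordinate_sum_derivatives[OF U im1 reIm cT[OF bounded_linear_Im] z(2)]
  have re_diff: "\<Lambda> differentiable (at \<eta>)" if "\<eta> \<in> U" for \<eta> by (rule re(1)[OF _ _ that])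
  have d0: "\<Lambda> differentiable (at 0)" by (rule re_diff[OF U(2)])
  show "bloch_eigenvalue1 A \<rho> differentiable (at 0)" using d0 unfolding \<Lambda>_def .
  have pd0: "partial_deriv l \<Lambda> 0 = 0" for l by (rule re(2))
  show "partial_deriv l (bloch_eigenvalue1 A \<rho>) 0 = 0" using pd0 unfolding \<Lambda>_def .
  show "\<forall>\<^sub>F \<eta> in nhds 0. bloch_eigenvalue1 A \<rho> differentiable (at \<eta>)"
    unfolding eventually_nhds \<Lambda>_def[symmetric] using U re_diff by blast
  show "partial_deriv l (bloch_eigenvalue1 A \<rho>) differentiable (at 0)"
    unfolding \<Lambda>_def[symmetric] by (rule re(3))
  have corr: "\<exists>D. has_H2_partial l \<phi> 0 D \<and> (\<exists>K. AE y in lebesgue. D y - \<i> * \<kappa> * c l y = K)" for l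
    using H2_analytic_has_H2_partial[OF analytic, of l]
      corrector_derivative[OF _ ev_H2 ev_eq \<Lambda>0 d0 pd0 phi0c cell] by blast
  then show "\<exists>D. has_H2_partial l \<phi> 0 D \<and> (\<exists>K. AE y in lebesgue. D y - \<i> * \<phi> 0 y * c l y = K)"
  proof -
    obtain D K where D: "has_H2_partial l \<phi> 0 D" "AE y in lebesgue. D y - \<i> * \<kappa> * c l y = K" using corr by blast
    have "AE y in lebesgue. D y - \<i> * \<phi> 0 y * c l y = K" using D(2) phi0 by eventually_elim simp
    then show ?thesis using D(1) by blast
  qed

  \<comment> \<open>The entries of the homogenized matrix before division by the volume of the cell.\<close>
  define X where "X l k = (\<Sum>m\<in>UNIV. L l m (c k)) + (\<integral>y. coeff l k y \<partial>cell)" for l k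
  have GG0: "GG l k 0 = \<i> * \<kappa> * X l k" for l k
  proof -
    obtain D K where D: "has_H2_partial k \<phi> 0 D" "AE y in lebesgue. D y - \<i> * \<kappa> * c k y = K" using corr by blast
    have DH: "D \<in> H2_per" using D by (simp add: has_H2_partial_def)
    have "g (L l m) k 0 = \<i> * \<kappa> * L l m (c k)" for m
    proof -
      have "partial_deriv k (\<lambda>\<eta>. L l m (\<phi> \<eta>)) 0 = L l m D"
        unfolding partial_deriv_def
        by (rule vector_derivative_at[OF H2_functional_has_vector_derivative[OF LM(1) D(1) ev_H2]])
      moreover have "partial_deriv k (\<lambda>\<eta>. L l m (\<phi> \<eta>)) 0 = g (L l m) k 0"
        unfolding partial_deriv_has_derivative[OF g(1)[OF LM(1) zero_in_sup_box[OF s(1)]]]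
        by (simp add: axis_def if_distrib[of "\<lambda>x. x *\<^sub>R _"] cong: if_cong)
      moreover have "L l m D = \<i> * \<kappa> * L l m (c k)"
      proof -
        \<comment> \<open>The functional only involves derivatives, so it does not see the additive constant between the derivative and the corrector.\<close>
        let ?w = "\<lambda>y. 1 * D y + (- (\<i> * \<kappa>)) * c k y"
        have wH: "?w \<in> H2_per" by (rule H2_per_lincomb(1)[OF DH cH])
        have "AE y in cell. ?w y = K" using AE_cell[OF D(2)] by simp
        then have "L l m ?w = 0" unfolding L_def
          by (intro pairing_AE_zero H2_per_AE_const(1)[OF wH]) (use wH in auto)
        then show ?thesis using H2_functional_lincomb[OF LM(1) DH cH, of l m 1 "- (\<i> * \<kappa>)" k] by simp
      qed
      ultimately show ?thesis by simp
    qed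
    moreover have "M l k (\<phi> 0) = \<kappa> * (\<integral>y. coeff l k y \<partial>cell)"
    proof -
      have "M l k (\<phi> 0) = (\<integral>y. \<kappa> * coeff l k y \<partial>cell)"
        unfolding M_def
      proof (rule integral_cong_AE)
        show "(\<lambda>y. \<phi> 0 y * coeff l k y) \<in> borel_measurable cell"
          using p0 by (intro borel_measurable_integrable cell_L2_mult_integrable coeff_cell_L2 H2_per_cell_L2)
        show "AE y in cell. \<phi> 0 y * coeff l k y = \<kappa> * coeff l k y" using phi0c by eventually_elim simp
      qed measurable
      then show ?thesis by simp
    qed
    ultimately show ?thesis by (simp add: GG_def X_def sum_distrib_left distrib_left mult.assoc)
  qed
  have cG: "c0 * GG l k 0 = X l k / V" for l k
    using V \<open>\<kappa> \<noteq> 0\<close> by (simp add: GG0 c0_def field_simps)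
  have hom: "hom_matrix A c $ k $ l = X k l / V" for k l
  proof -
    have "(complex_matrix (A y) *v axis l 1) $ k + (complex_matrix (A y) *v weak_grad (c l) y) $ k
      = coeff k l y + (\<Sum>m\<in>UNIV. weak_partial m (c l) y * coeff k m y)" for y
      by (simp add: complex_matrix_def matrix_vector_mult_def coeff_def axis_def weak_grad_def
          if_distrib[of "\<lambda>x. x * _"] mult.commute cong: if_cong)
    moreover have "(\<integral>y. coeff k l y + (\<Sum>m\<in>UNIV. weak_partial m (c l) y * coeff k m y) \<partial>cell) = X k l"
      using coeff_cell_L2 cH by (simp add: X_def L_def cell_L2_integrable cell_L2_mult_integrable)
    ultimately show ?thesis by (simp add: hom_matrix_def cell_mean_cell V_def)
  qed
  have sym: "X k l = X l k"
  proof -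
    have "(\<integral>y. coeff k l y \<partial>cell) = (\<integral>y. coeff l k y \<partial>cell)"
    proof (rule integral_cong_AE)
      show "AE y in cell. coeff k l y = coeff l k y" using coeff_symmetric by (rule eventually_mono) blast
    qed measurable
    then show ?thesis using corrector_symmetric[OF cell, of l k] by (simp add: X_def L_def)
  qed
  have h2: "partial_deriv k (partial_deriv l \<Lambda>) 0 = 2 * Re (X k l / V)"
  proof -
    have "partial_deriv k (partial_deriv l \<Lambda>) 0 = Re (c0 * GG l k 0) + Re (c0 * GG k l 0)" by (rule re(4))
    then show ?thesis unfolding cG sym by simp
  qed
  have "partial_deriv i (\<lambda>_ :: real^'n. 0 :: real) = (\<lambda>_. 0)" for i
    by (rule ext, rule partial_deriv_has_derivative[OF has_derivative_const])
  moreover have "partial_deriv k (partial_deriv l (\<lambda>_ :: real^'n. 0 :: real)) 0 = Im (c0 * GG l k 0) + Im (c0 * GG k l 0)"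
    by (rule im(4))
  ultimately have "Im (X k l / V) = 0" unfolding cG sym by simp
  then show "complex_of_real (1/2 * partial_deriv k (partial_deriv l (bloch_eigenvalue1 A \<rho>)) 0) = hom_matrix A c $ k $ l"
    unfolding \<Lambda>_def[symmetric] h2 hom by (simp add: complex_eq_iff)
qed

end

theorem theorem6p1:
  fixes A :: "real^'n \<Rightarrow> real^'n^'n"
    and \<rho> :: real
    and \<phi> :: "real^'n \<Rightarrow> real^'n \<Rightarrow> complex"
    and c :: "'n \<Rightarrow> real^'n \<Rightarrow> complex"
  assumes A_measurable: "\<And>k l. (\<lambda>y. A y $ k $ l) \<in> borel_measurable lebesgue"
    and A_bounded: "\<exists>M. AE y in lebesgue. \<forall>k l. \<bar>A y $ k $ l\<bar> \<le> M"
    and A_symmetric: "AE y in lebesgue. transpose (A y) = A y"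
    and A_periodic: "ae_periodic A"
    and A_elliptic: "\<exists>\<alpha>>0. AE y in lebesgue. \<forall>\<xi>. (A y *v \<xi>) \<bullet> \<xi> \<ge> \<alpha> * (norm \<xi>)\<^sup>2"
    and rho_pos: "\<rho> > 0"
    and phi_eigenfunction:
      "\<forall>\<^sub>F \<eta> in nhds 0. bloch_eigenfunction A \<rho> \<eta> (bloch_eigenvalue1 A \<rho> \<eta>) (\<phi> \<eta>)"
    and phi_analytic: "H2_analytic_at \<phi> 0"
    and phi_normalized:
      "\<forall>\<^sub>F \<eta> in nhds 0. cell_mean (\<phi> \<eta>) = complex_of_real ((2 * pi) powr (- real CARD('n) / 2))"
    and cell: "\<And>j. cell_solution A \<rho> j (c j)"
  shows "bloch_eigenvalue1 A \<rho> 0 = 0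
    \<and> (bloch_eigenvalue1 A \<rho> differentiable (at 0) \<and>
       (\<forall>l. partial_deriv l (bloch_eigenvalue1 A \<rho>) 0 = 0))
    \<and> (\<forall>l. \<exists>D. has_H2_partial l \<phi> 0 D \<and>
         (\<exists>K. AE y in lebesgue. D y - \<i> * \<phi> 0 y * c l y = K))
    \<and> ((\<forall>\<^sub>F \<eta> in nhds 0. bloch_eigenvalue1 A \<rho> differentiable (at \<eta>)) \<and>
       (\<forall>l. partial_deriv l (bloch_eigenvalue1 A \<rho>) differentiable (at 0)) \<and>
       (\<forall>k l. complex_of_real (1/2 * partial_deriv k (partial_deriv l (bloch_eigenvalue1 A \<rho>)) 0)
                = hom_matrix A c $ k $ l))"
proof -
  interpret elliptic_coefficients A \<rho>
    using A_measurable A_bounded A_symmetric A_elliptic rho_pos by unfold_locales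
  have k: "complex_of_real ((2 * pi) powr (- real CARD('n) / 2)) \<noteq> 0"
    by (simp add: powr_nonneg_iff[THEN iffD1])
  note E = bloch_eigenvalue_expansion[OF phi_eigenfunction phi_analytic phi_normalized k cell]
  show ?thesis using bloch_eigenvalue1_0 E by blast
qed

end
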